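(* Let $s_1,s_2\in\mathbb R$ and $0<\vec q<\vec p<\infty$. Suppose that $s_1-\frac1{\mathbf p}=s_2-\frac1{\mathbf q}$. Then $$F_{\vec q,\infty}^{s_2}\hookrightarrow\dot E_{\vec p}^{\vec0,\vec q}B_{q_n}^{s_1}\hookrightarrow B_{\vec p,q_n}^{s_1}.$$
   Context: Conventions: $\vec p=(p_1,\dots,p_n)$, $\vec q=(q_1,\dots,q_n)$; inequalities between vectors are componentwise; $\vec0=(0,\dots,0)$; sums with exponent $\infty$ are replaced by suprema; $\frac1{\mathbf p}=\sum_i\frac1{p_i}$, $\frac1{\mathbf q}=\sum_i\frac1{q_i}$. $X\hookrightarrow Y$ means $X\subset Y$ with $\|f\|_Y\le C\|f\|_X$ for all $f\in X$. $L^{\vec p}(\mathbb R^n)$ is the mixed-norm Lebesgue space, with the $L^{p_i}$ norm taken in $x_i$ successively for $i=1,\dots,n$ ($x_1$ innermost). Mixed-norm Herz spaces: for $k\in\mathbb Z$ let $R_k=\{t\in\mathbb R:2^{k-1}\le|t|<2^k\}$. For $0<p,q\le\infty$, $\alpha\in\mathbb R$ and measurable $g$ on $\mathbb R$, $\|g\|_{\dot K_p^{\alpha,q}}=\big(\sum_{k\in\mathbb Z}2^{k\alpha q}\|g\chi_{R_k}\|_{L^p(\mathbb R)}^q\big)^{1/q}$. The space $\dot E_{\vec p}^{\vec\alpha,\vec q}(\mathbb R^n)$ consists of all measurable $f$ on $\mathbb R^n$ with $\|f\|_{\dot E_{\vec p}^{\vec\alpha,\vec q}(\mathbb R^n)}=\big\|\cdots\|f\|_{\dot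 K_{p_1}^{\alpha_1,q_1}}\cdots\big\|_{\dot K_{p_n}^{\alpha_n,q_n}}<\infty$, quasi-norms taken in $x_i$ successively for $i=1,\dots,n$ ($x_1$ innermost). Smoothness spaces: fix $\Phi,\varphi\in\mathcal S(\mathbb R^n)$ with $\operatorname{supp}\mathcal F\Phi\subset\{|\xi|\le2\}$, $|\mathcal F\Phi(\xi)|\ge c>0$ for $|\xi|\le\frac53$, $\operatorname{supp}\mathcal F\varphi\subset\{\frac12\le|\xi|\le2\}$, $|\mathcal F\varphi(\xi)|\ge c>0$ for $\frac35\le|\xi|\le\frac53$. Put $\varphi_0=\Phi$, $\varphi_k=2^{kn}\varphi(2^k\cdot)$ for $k\ge1$. For $f\in\mathcal S'(\mathbb R^n)$: $\|f\|_{\dot E_{\vec p}^{\vec\alpha,\vec q}B_\beta^s}=\big(\sum_{k\ge0}2^{ks\beta}\|\varphi_k*f\|_{\dot E_{\vec p}^{\vec\alpha,\vec q}(\mathbb R^n)}^\beta\big)^{1/\beta}$, $\|f\|_{B_{\vec p,\beta}^s}=\big(\sum_{k\ge0}2^{ks\beta}\|\varphi_k*f\|_{L^{\vec p}(\mathbb R^n)}^\beta\big)^{1/\beta}$, $\|f\|_{F_{\vec p,\beta}^s}=\big\|\big(\sum_{k\ge0}2^{ks\beta}|\varphi_k*f|^\beta\big)^{1/\beta}\big\|_{L^{\vec p}(\mathbb R^n)}$; each space consists of the $f\in\mathcal S'(\mathbb R^n)$ with finite quasi-norm. *)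

theory Defs
  imports "HOL-Analysis.Analysis" "HOL-Probability.Essential_Supremum"
begin

text \<open>
  The space \<open>\<real>\<^sup>n\<close> is \<^typ>\<open>real ^ 'n\<close> with \<open>'n\<close> of class \<open>{finite, linorder}\<close>: the variables
  \<open>x\<^sub>1, \<dots>, x\<^sub>n\<close> are the coordinates in increasing order of their index, so that index \<open>n\<close> is
  \<open>Max UNIV\<close>.  Quasi-norms take values in \<^typ>\<open>ennreal\<close>, and so do integrability exponents, whose
  meaningful range is \<open>(0, \<infinity>]\<close>.
\<close>

section \<open>Quasi-norms in one variable\<close>

definition ennpow :: "ennreal \<Rightarrow> real \<Rightarrow> ennreal"
  where "ennpow x a = (if x = \<infinity> then \<infinity> else ennreal (enn2real x powr a))"

text \<open>Only used with positive exponents \<open>a\<close>, so that \<open>0\<^sup>a = 0\<close> and \<open>\<infinity>\<^sup>a = \<infinity>\<close>.\<close>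

definition Lp_norm :: "ennreal \<Rightarrow> (real \<Rightarrow> ennreal) \<Rightarrow> ennreal"
  where "Lp_norm p g =
    (if p = \<infinity> then esssup lborel g
     else ennpow (\<integral>\<^sup>+ t. ennpow (g t) (enn2real p) \<partial>lborel) (1 / enn2real p))"

definition lq_norm :: "ennreal \<Rightarrow> ('i \<Rightarrow> ennreal) \<Rightarrow> ennreal"
  where "lq_norm q a =
    (if q = \<infinity> then (SUP k. a k)
     else ennpow (\<Sum>\<^sub>\<infinity>k. ennpow (a k) (enn2real q)) (1 / enn2real q))"

definition annulus :: "int \<Rightarrow> real set"
  where "annulus k = {t. 2 powi (k - 1) \<le> \<bar>t\<bar> \<and> \<bar>t\<bar> < 2 powi k}"

definition Herz_norm :: "real \<Rightarrow> ennreal \<Rightarrow> ennreal \<Rightarrow> (real \<Rightarrow> ennreal) \<Rightarrow> ennreal"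
  where "Herz_norm \<alpha> p q g =
    lq_norm q (\<lambda>k::int. ennreal (2 powr (real_of_int k * \<alpha>)) * Lp_norm p (\<lambda>t. g t * indicator (annulus k) t))"

section \<open>Mixed quasi-norms\<close>

definition coord_upd :: "real ^ 'n \<Rightarrow> 'n \<Rightarrow> real \<Rightarrow> real ^ 'n"
  where "coord_upd x i t = (\<chi> j. if j = i then t else x $ j)"

text \<open>
  Applying a one-variable quasi-norm \<open>N i\<close> in the \<open>i\<close>-th variable turns a function on \<open>\<real>\<^sup>n\<close> into a
  function on \<open>\<real>\<^sup>n\<close> that no longer depends on \<open>x\<^sub>i\<close>.  After all variables have been treated, starting
  with the smallest index, the result is constant and may be evaluated at \<open>0\<close>.
\<close>

definition mixed_norm ::
    "('n \<Rightarrow> (real \<Rightarrow> ennreal) \<Rightarrow> ennreal) \<Rightarrow> (real ^ 'n::{finite,linorder} \<Rightarrow> ennreal) \<Rightarrow> ennreal"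
  where "mixed_norm N g =
    fold (\<lambda>i h x. N i (\<lambda>t. h (coord_upd x i t))) (sorted_list_of_set UNIV) g 0"

definition mixed_Lp_norm ::
    "('n \<Rightarrow> ennreal) \<Rightarrow> (real ^ 'n::{finite,linorder} \<Rightarrow> ennreal) \<Rightarrow> ennreal"
  where "mixed_Lp_norm p = mixed_norm (\<lambda>i. Lp_norm (p i))"

definition mixed_Herz_norm ::
    "('n \<Rightarrow> real) \<Rightarrow> ('n \<Rightarrow> ennreal) \<Rightarrow> ('n \<Rightarrow> ennreal) \<Rightarrow> (real ^ 'n::{finite,linorder} \<Rightarrow> ennreal) \<Rightarrow> ennreal"
  where "mixed_Herz_norm \<alpha> p q = mixed_norm (\<lambda>i. Herz_norm (\<alpha> i) (p i) (q i))"

section \<open>Schwartz functions and tempered distributions\<close>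

type_synonym 'n cfun = "(real, 'n) vec \<Rightarrow> complex"
type_synonym 'n dist = "'n cfun \<Rightarrow> complex"

definition partial :: "'n \<Rightarrow> ('n::finite) cfun \<Rightarrow> real ^ 'n \<Rightarrow> complex"
  where "partial i g x = frechet_derivative g (at x) (axis i 1)"

text \<open>A mixed partial derivative of order \<open>m\<close> is given by a list of \<open>m\<close> directions.\<close>

abbreviation partials :: "'n list \<Rightarrow> ('n::finite) cfun \<Rightarrow> real ^ 'n \<Rightarrow> complex"
  where "partials is \<equiv> foldr partial is"

definition schwartz_norm :: "nat \<Rightarrow> ('n::finite) cfun \<Rightarrow> ennreal"
  where "schwartz_norm m \<psi> =
    (SUP is\<in>{is. length is \<le> m}. SUP x. ennreal ((1 + norm x) ^ m * norm (partials is \<psi> x)))"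

text \<open>Differentiability of all mixed partial derivatives amounts to \<open>\<psi>\<close> being \<open>C\<^sup>\<infinity>\<close>.\<close>

definition schwartz :: "('n::finite) cfun set"
  where "schwartz =
    {\<psi>. (\<forall>is x. partials is \<psi> differentiable (at x)) \<and> (\<forall>m. schwartz_norm m \<psi> < \<infinity>)}"

definition schwartz_topology :: "('n::finite) cfun topology"
  where "schwartz_topology = topology_generated_by
    {{\<psi>\<in>schwartz. schwartz_norm m (\<lambda>x. \<psi> x - \<psi>\<^sub>0 x) < ennreal e} | m \<psi>\<^sub>0 e. \<psi>\<^sub>0 \<in> schwartz \<and> 0 < e}"

text \<open>Only the values of a distribution on \<^const>\<open>schwartz\<close> are meaningful.\<close>

definition tempered :: "('n::finite) dist set"
  where "tempered =
    {f. (\<forall>\<psi>\<^sub>1\<in>schwartz. \<forall>\<psi>\<^sub>2\<in>schwartz. f (\<lambda>x. \<psi>\<^sub>1 x + \<psi>\<^sub>2 x) = f \<psi>\<^sub>1 + f \<psi>\<^sub>2) \<and>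
        (\<forall>c. \<forall>\<psi>\<in>schwartz. f (\<lambda>x. c * \<psi> x) = c * f \<psi>) \<and>
        continuous_map schwartz_topology euclidean f}"

definition conv ::
    "('n::finite) cfun \<Rightarrow> 'n dist \<Rightarrow> real ^ 'n \<Rightarrow> complex"
  where "conv \<psi> f x = f (\<lambda>y. \<psi> (x - y))"

definition fourier :: "('n::finite) cfun \<Rightarrow> real ^ 'n \<Rightarrow> complex"
  where "fourier \<psi> \<xi> =
    of_real ((2 * pi) powr (- real CARD('n) / 2)) * (\<integral>x. cis (- (x \<bullet> \<xi>)) * \<psi> x \<partial>lborel)"

definition supp :: "('n::finite) cfun \<Rightarrow> (real ^ 'n) set"
  where "supp g = closure {x. g x \<noteq> 0}"

section \<open>Besov and Triebel-Lizorkin quasi-norms\<close>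

definition lp_pair :: "('n::finite) cfun \<Rightarrow> 'n cfun \<Rightarrow> bool"
  where "lp_pair \<Phi> \<phi> \<longleftrightarrow>
    \<Phi> \<in> schwartz \<and> \<phi> \<in> schwartz \<and>
    supp (fourier \<Phi>) \<subseteq> {\<xi>. norm \<xi> \<le> 2} \<and>
    (\<exists>c>0. \<forall>\<xi>. norm \<xi> \<le> 5/3 \<longrightarrow> norm (fourier \<Phi> \<xi>) \<ge> c) \<and>
    supp (fourier \<phi>) \<subseteq> {\<xi>. 1/2 \<le> norm \<xi> \<and> norm \<xi> \<le> 2} \<and>
    (\<exists>c>0. \<forall>\<xi>. 3/5 \<le> norm \<xi> \<and> norm \<xi> \<le> 5/3 \<longrightarrow> norm (fourier \<phi> \<xi>) \<ge> c)"

definition dyadic ::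
    "('n::finite) cfun \<Rightarrow> 'n cfun \<Rightarrow> nat \<Rightarrow> real ^ 'n \<Rightarrow> complex"
  where "dyadic \<Phi> \<phi> k =
    (if k = 0 then \<Phi> else (\<lambda>x. of_real (2 ^ (k * CARD('n))) * \<phi> (2 ^ k *\<^sub>R x)))"

definition block ::
    "('n::finite) cfun \<Rightarrow> 'n cfun \<Rightarrow>
     'n dist \<Rightarrow> nat \<Rightarrow> real ^ 'n \<Rightarrow> ennreal"
  where "block \<Phi> \<phi> f k x = ennreal (norm (conv (dyadic \<Phi> \<phi> k) f x))"

definition HerzB_norm ::
    "('n::{finite,linorder}) cfun \<Rightarrow> 'n cfun \<Rightarrow>
     ('n \<Rightarrow> real) \<Rightarrow> ('n \<Rightarrow> ennreal) \<Rightarrow> ('n \<Rightarrow> ennreal) \<Rightarrow> real \<Rightarrow> ennreal \<Rightarrow>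
     'n dist \<Rightarrow> ennreal"
  where "HerzB_norm \<Phi> \<phi> \<alpha> p q s \<beta> f =
    lq_norm \<beta> (\<lambda>k::nat. ennreal (2 powr (real k * s)) * mixed_Herz_norm \<alpha> p q (block \<Phi> \<phi> f k))"

definition B_norm ::
    "('n::{finite,linorder}) cfun \<Rightarrow> 'n cfun \<Rightarrow>
     ('n \<Rightarrow> ennreal) \<Rightarrow> real \<Rightarrow> ennreal \<Rightarrow> 'n dist \<Rightarrow> ennreal"
  where "B_norm \<Phi> \<phi> p s \<beta> f =
    lq_norm \<beta> (\<lambda>k::nat. ennreal (2 powr (real k * s)) * mixed_Lp_norm p (block \<Phi> \<phi> f k))"

definition F_norm ::
    "('n::{finite,linorder}) cfun \<Rightarrow> 'n cfun \<Rightarrow>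
     ('n \<Rightarrow> ennreal) \<Rightarrow> real \<Rightarrow> ennreal \<Rightarrow> 'n dist \<Rightarrow> ennreal"
  where "F_norm \<Phi> \<phi> p s \<beta> f =
    mixed_Lp_norm p (\<lambda>x. lq_norm \<beta> (\<lambda>k::nat. ennreal (2 powr (real k * s)) * block \<Phi> \<phi> f k x))"

text \<open>A smoothness space is represented by its quasi-norm.\<close>

definition space_of ::
    "(('n::finite) dist \<Rightarrow> ennreal) \<Rightarrow> 'n dist set"
  where "space_of N = {f\<in>tempered. N f < \<infinity>}"

definition embeds (infix "\<hookrightarrow>" 50)
  where "N\<^sub>1 \<hookrightarrow> N\<^sub>2 \<longleftrightarrow>
    space_of N\<^sub>1 \<subseteq> space_of N\<^sub>2 \<and> (\<exists>C::real. \<forall>f\<in>space_of N\<^sub>1. N\<^sub>2 f \<le> ennreal C * N\<^sub>1 f)"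

end

theory Submission
  imports Defs "HOL-Probability.Probability"
begin

text \<open>
  Since the spectrum of \<open>\<phi>\<^sub>k * f\<close> lies in a ball of radius \<open>2\<^sup>k\<^sup>+\<^sup>1\<close>, an oversampled cardinal series
  whose kernel is a product of characteristic functions of uniform distributions yields, in every
  variable \<open>x\<^sub>i\<close> and for every small \<open>t > 0\<close>, a sub-mean-value inequality
  \<open>\<bar>F x\<bar>\<^sup>t \<le> A \<integral> \<eta> y \<bar>F (x - 2\<^sup>-\<^sup>k y e\<^sub>i)\<bar>\<^sup>t dy\<close> with \<open>A\<close> independent of \<open>f\<close> and \<open>k\<close>:
  for \<open>t \<le> 1\<close> the \<open>t\<close>-th power can be moved inside the sampling series, which is then averaged
  over all translates of the sampling lattice.  By Minkowski's inequality this property is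
  inherited, in the remaining variables, by the Herz quasi-norm in one variable.  It is therefore enough to prove a
  one-dimensional Jawerth--Franke inequality and to iterate it.  There the superlevel sets of the
  \<open>k\<close>-th function are essentially unions of intervals of length \<open>2\<^sup>-\<^sup>k\<close>, and so
  \<open>\<Sum>\<^sub>k \<Sum>\<^sub>j 2\<^sup>k\<^sup>(\<^sup>r\<^sup>-\<^sup>1\<^sup>) \<bar>E\<^sub>k \<inter> R\<^sub>j\<bar>\<^sup>r\<close> with \<open>r = q/p < 1\<close> is bounded by the measure of a neighbourhood of all
  \<open>E\<^sub>k\<close>, which a weak type estimate controls.  The second embedding is \<open>\<ell>\<^sup>q \<subseteq> \<ell>\<^sup>p\<close> on the annuli.
\<close>

section \<open>Powers of extended nonnegative reals\<close>

text \<open>Since the q_i may be below 1, duality and convolution inequalities fail. Choosing t at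
  most 1 and below every q_i makes all p_i / t and q_i / t exceed 1, so that t-th powers obey
  Minkowski's inequality. They weaken a decay of order N to order N t, whence the requirement N t
  \<ge> 2. The obstacle is uniformity: the growth of \<phi>_k * f depends on f, and the sampling
  series needs a kernel that beats this growth, yet A must not depend on f. Further factors of the
  kernel supply decay for a fixed total bandwidth, however many there are, and being bounded by 1
  they leave the estimate that yields A untouched. The iteration closes because the one-variable
  inequality bounds an l^q sum over k. Lowering it to a supremum gives, in the remaining variables,
  again a family dominated by one function. The factors 2^(k (1/p_i - 1/q_i)) multiply to 2^(k (s_1
  - s_2)), and only the last sum, of exponent q_n, is kept.\<close>

lemma ennpow_ennreal: "0 \<le> x \<Longrightarrow> ennpow (ennreal x) a = ennreal (x powr a)"
  by (simp add: ennpow_def)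

lemma ennpow_top [simp]: "ennpow \<infinity> a = \<infinity>" "ennpow top a = top"
  by (simp_all add: ennpow_def)

lemma ennpow_0 [simp]: "ennpow 0 a = 0"
  by (simp add: ennpow_def)

lemma ennpow_1 [simp]: "ennpow 1 a = 1"
  by (simp add: ennpow_def)

lemma ennpow_one [simp]: "ennpow x 1 = x"
  by (cases x) (simp_all add: ennpow_def)

lemma ennpow_eq_0_iff [simp]: "ennpow x a = 0 \<longleftrightarrow> x = 0"
  by (cases x) (auto simp: ennpow_def)

lemma ennpow_eq_top_iff [simp]: "ennpow x a = top \<longleftrightarrow> x = top"
  by (auto simp: ennpow_def)

lemma ennpow_mono: "x \<le> y \<Longrightarrow> 0 \<le> a \<Longrightarrow> ennpow x a \<le> ennpow y a"
  by (cases x; cases y) (auto simp: ennpow_def top_unique intro!: powr_mono2)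

text \<open>Free of sign conditions because \<open>0\<close> and \<open>top\<close> are fixed by
  every exponent. Hence raising to \<open>a\<close> and to \<open>1 / a\<close> are mutually inverse
  for \<open>a \<noteq> 0\<close>, which is how inequalities are moved between powers.\<close>

lemma ennpow_ennpow: "ennpow (ennpow x a) b = ennpow x (a * b)"
  by (cases x) (auto simp: ennpow_def powr_powr)

lemma ennpow_le_iff: "0 < a \<Longrightarrow> ennpow x a \<le> ennpow y a \<longleftrightarrow> x \<le> y"
  using ennpow_mono[of "ennpow x a" "ennpow y a" "1 / a"] ennpow_mono[of x y a]
  by (auto simp: ennpow_ennpow)

lemma ennpow_less_iff: "0 < a \<Longrightarrow> ennpow x a < ennpow y a \<longleftrightarrow> x < y"
  by (meson ennpow_le_iff linorder_not_le)

lemma ennpow_mult: "0 < a \<Longrightarrow> ennpow (x * y) a = ennpow x a * ennpow y a"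
proof (cases x; cases y)
  fix r s :: real assume "0 \<le> r" "x = ennreal r" "0 \<le> s" "y = ennreal s"
  then show ?thesis
    by (simp add: ennpow_ennreal powr_mult flip: ennreal_mult)
next
  fix r :: real assume "0 \<le> r" "x = ennreal r" "y = top"
  then show ?thesis
    by (cases "r = 0") (auto simp: ennreal_mult_top ennpow_ennreal)
next
  fix r :: real assume "0 \<le> r" "y = ennreal r" "x = top"
  then show ?thesis
    by (cases "r = 0") (auto simp: ennreal_top_mult ennpow_ennreal)
qed (auto simp: ennreal_top_mult)

lemma measurable_ennpow [measurable]: "(\<lambda>x. ennpow x a) \<in> borel_measurable borel"
  unfolding ennpow_def by measurable

text \<open>After division by \<open>x + y\<close> both terms lie in [0, 1], where
  \<open>u \<le> u powr a\<close>.\<close>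

lemma powr_add_le_add_powr:
  fixes x y :: real assumes "0 \<le> x" "0 \<le> y" "0 < a" "a \<le> 1"
  shows "(x + y) powr a \<le> x powr a + y powr a"
proof (cases "x + y = 0")
  case False
  then have pos: "x + y > 0" using assms by auto
  have *: "u \<le> u powr a" if "0 \<le> u" "u \<le> 1" for u :: real
    using that assms powr_mono'[of a 1 u] by (cases "u = 0") auto
  have "1 = x / (x + y) + y / (x + y)"
    using pos by (simp add: add_divide_distrib [symmetric])
  also have "\<dots> \<le> (x / (x + y)) powr a + (y / (x + y)) powr a"
    using assms pos by (intro add_mono *) (auto simp: field_simps)
  also have "\<dots> = (x powr a + y powr a) / (x + y) powr a"
    using assms pos by (simp add: powr_divide add_divide_distrib)
  finally show ?thesis using pos by (simp add: pos_le_divide_eq)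
qed (use assms in auto)

lemma ennpow_add_le: "0 < a \<Longrightarrow> a \<le> 1 \<Longrightarrow> ennpow (x + y) a \<le> ennpow x a + ennpow y a"
proof (cases x; cases y)
  fix r s :: real assume "0 < a" "a \<le> 1" "0 \<le> r" "x = ennreal r" "0 \<le> s" "y = ennreal s"
  then show ?thesis
    by (simp add: ennpow_ennreal powr_add_le_add_powr flip: ennreal_plus)
qed auto

lemma ennpow_sum_le:
  "0 < a \<Longrightarrow> a \<le> 1 \<Longrightarrow> ennpow (\<Sum>i\<in>I. f i) a \<le> (\<Sum>i\<in>I. ennpow (f i) a)"
proof (induction I rule: infinite_finite_induct)
  case (insert i I)
  then show ?case
    using ennpow_add_le[of a "f i" "sum f I"] by (auto intro: order_trans add_left_mono)
qed auto

text \<open>Infinite sums are treated as integrals over counting measure, so that Fubini and the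
  lemmas on \<open>nrm\<close> apply to them; this is the bridge to \<open>infsum\<close>.\<close>

lemma nn_integral_count_space_SUP:
  fixes f :: "'i::countable \<Rightarrow> ennreal"
  shows "(\<integral>\<^sup>+i. f i \<partial>count_space UNIV) = (SUP F\<in>{F. finite F}. sum f F)"
proof (rule antisym)
  define A where "A n = {i::'i. to_nat i < n}" for n :: nat
  have fin: "finite (A n)" for n
    by (rule finite_imageD[of to_nat]) (auto simp: A_def intro: finite_subset[of _ "{..<n}"])
  have "f i = (SUP n. f i * indicator (A n) i)" for i
  proof (rule antisym)
    have "f i = f i * indicator (A (Suc (to_nat i))) i" by (simp add: A_def)
    also have "\<dots> \<le> (SUP n. f i * indicator (A n) i)" by (intro SUP_upper) auto
    finally show "f i \<le> (SUP n. f i * indicator (A n) i)" .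
    show "(SUP n. f i * indicator (A n) i) \<le> f i"
      by (intro SUP_least) (auto simp: indicator_def)
  qed
  then have "(\<integral>\<^sup>+i. f i \<partial>count_space UNIV) =
      (\<integral>\<^sup>+i. (SUP n. f i * indicator (A n) i) \<partial>count_space UNIV)" by simp
  also have "\<dots> = (SUP n. \<integral>\<^sup>+i. f i * indicator (A n) i \<partial>count_space UNIV)"
    by (intro nn_integral_monotone_convergence_SUP)
       (auto simp: incseq_def le_fun_def A_def indicator_def)
  also have "\<dots> = (SUP n. sum f (A n))"
    by (intro SUP_cong refl, subst nn_integral_count_space'[OF fin]) (auto simp: indicator_def)
  also have "\<dots> \<le> (SUP F\<in>{F. finite F}. sum f F)"
    using fin by (intro SUP_least SUP_upper) auto
  finally show "(\<integral>\<^sup>+i. f i \<partial>count_space UNIV) \<le> (SUP F\<in>{F. finite F}. sum f F)" .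
  show "(SUP F\<in>{F. finite F}. sum f F) \<le> (\<integral>\<^sup>+i. f i \<partial>count_space UNIV)"
  proof (rule SUP_least, clarify)
    fix F :: "'i set" assume "finite F"
    then have "sum f F = (\<integral>\<^sup>+i. f i * indicator F i \<partial>count_space UNIV)"
      by (subst nn_integral_count_space'[of F]) (auto simp: indicator_def)
    also have "\<dots> \<le> (\<integral>\<^sup>+i. f i \<partial>count_space UNIV)"
      by (intro nn_integral_mono) (auto simp: indicator_def)
    finally show "sum f F \<le> (\<integral>\<^sup>+i. f i \<partial>count_space UNIV)" .
  qed
qed

lemma infsum_eq_nn_integral_count_space:
  fixes f :: "'i::countable \<Rightarrow> ennreal"
  shows "(\<Sum>\<^sub>\<infinity>i. f i) = (\<integral>\<^sup>+i. f i \<partial>count_space UNIV)"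
  by (subst nonneg_infsum_complete) (auto simp: nn_integral_count_space_SUP)

text \<open>The root is moved to the right-hand side first: a supremum over finite sets can then be
  bounded term by term. Used with \<open>a = q / p\<close>.\<close>

lemma ennpow_nn_integral_count_space_le:
  fixes f :: "'i::countable \<Rightarrow> ennreal"
  assumes "0 < a" "a \<le> 1"
  shows "ennpow (\<integral>\<^sup>+i. f i \<partial>count_space UNIV) a \<le> (\<integral>\<^sup>+i. ennpow (f i) a \<partial>count_space UNIV)"
    (is "_ \<le> ?R")
proof -
  have "(\<integral>\<^sup>+i. f i \<partial>count_space UNIV) \<le> ennpow ?R (1 / a)"
    unfolding nn_integral_count_space_SUP[of f]
  proof (rule SUP_least, clarify)
    fix F :: "'i set" assume "finite F"
    have "ennpow (sum f F) a \<le> (\<Sum>i\<in>F. ennpow (f i) a)" by (rule ennpow_sum_le[OF assms])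
    also have "\<dots> \<le> ?R"
      unfolding nn_integral_count_space_SUP using \<open>finite F\<close> by (intro SUP_upper) auto
    finally have "ennpow (sum f F) a \<le> ennpow (ennpow ?R (1 / a)) a"
      using assms by (simp add: ennpow_ennpow)
    then show "sum f F \<le> ennpow ?R (1 / a)" using assms by (simp add: ennpow_le_iff)
  qed
  then have "ennpow (\<integral>\<^sup>+i. f i \<partial>count_space UNIV) a \<le> ennpow (ennpow ?R (1 / a)) a"
    using assms by (intro ennpow_mono) auto
  then show ?thesis using assms by (simp add: ennpow_ennpow)
qed

section \<open>Minkowski's integral inequality\<close>

text \<open>By convexity the graph of u^P lies above its tangent at \<open>c\<close>; Young's
  inequality with exponents P and P / (P - 1) is the same fact.\<close>

lemma powr_tangent:
  fixes u c P :: real assumes "0 \<le> u" "0 \<le> c" "1 \<le> P"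
  shows "P * c powr (P - 1) * u \<le> u powr P + (P - 1) * c powr P"
proof (cases "u = 0 \<or> c = 0 \<or> P = 1")
  case True then show ?thesis using assms by auto
next
  case False
  then have *: "u > 0" "c > 0" "P > 1" using assms by auto
  have "(u powr P) powr (1 / P) * (c powr P) powr ((P - 1) / P)
      \<le> (1 / P) * u powr P + ((P - 1) / P) * c powr P"
    using * by (intro Youngs_inequality_0) (auto simp: field_simps)
  then have "u * c powr (P - 1) \<le> (u powr P + (P - 1) * c powr P) / P"
    using * by (simp add: powr_powr add_divide_distrib)
  then show ?thesis using * by (simp add: field_simps)
qed

lemma ennpow_tangent:
  assumes "0 \<le> c" "1 \<le> P"
  shows "ennreal (P * c powr (P - 1)) * u \<le> ennpow u P + ennreal ((P - 1) * c powr P)"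
proof (cases u)
  case (real r)
  then show ?thesis
    using powr_tangent[of r c P] assms
    by (simp add: ennpow_ennreal flip: ennreal_mult ennreal_plus)
qed auto

text \<open>Jensen's inequality for the weight \<open>w\<close>, obtained by integrating the tangent
  inequality with a free point of tangency \<open>c\<close>.\<close>

lemma ennpow_nn_integral_weight_le:
  assumes [measurable]: "u \<in> borel_measurable M" "w \<in> borel_measurable M"
    and w: "(\<integral>\<^sup>+y. w y \<partial>M) \<le> ennreal I" and I: "0 < I" and P: "1 < P"
  shows "ennpow (\<integral>\<^sup>+y. u y * w y \<partial>M) P
    \<le> ennreal (I powr (P - 1)) * (\<integral>\<^sup>+y. ennpow (u y) P * w y \<partial>M)"
proof -
  let ?S = "\<integral>\<^sup>+y. u y * w y \<partial>M" and ?J = "\<integral>\<^sup>+y. ennpow (u y) P * w y \<partial>M"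
  have *: "ennreal (P * c powr (P - 1)) * ?S \<le> ?J + ennreal ((P - 1) * c powr P * I)"
    if "0 \<le> c" for c
  proof -
    have "ennreal (P * c powr (P - 1)) * ?S = (\<integral>\<^sup>+y. ennreal (P * c powr (P - 1)) * u y * w y \<partial>M)"
      by (simp add: nn_integral_cmult mult.assoc)
    also have "\<dots> \<le> (\<integral>\<^sup>+y. ennpow (u y) P * w y + ennreal ((P - 1) * c powr P) * w y \<partial>M)"
      using ennpow_tangent[OF that, of P] P
      by (intro nn_integral_mono) (auto simp flip: distrib_right intro!: mult_right_mono)
    also have "\<dots> = ?J + ennreal ((P - 1) * c powr P) * (\<integral>\<^sup>+y. w y \<partial>M)"
      by (simp add: nn_integral_add nn_integral_cmult)
    also have "\<dots> \<le> ?J + ennreal ((P - 1) * c powr P) * ennreal I"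
      using w by (intro add_left_mono mult_left_mono) auto
    finally show ?thesis using P I by (simp add: ennreal_mult)
  qed
  show ?thesis
  proof (cases ?S)
    case (real s)
    show ?thesis
    proof (cases ?J)
      case (real j)
      \<comment> \<open>The optimal point of tangency, which is the \<open>w\<close>-mean of
        \<open>u\<close> if \<open>w\<close> has total mass \<open>I\<close>.\<close>
      define c where "c = s / I"
      have c: "0 \<le> c" using \<open>0 \<le> s\<close> I by (simp add: c_def)
      have "P * c powr (P - 1) * s \<le> j + (P - 1) * c powr P * I"
        using *[OF c] \<open>?S = ennreal s\<close> \<open>?J = ennreal j\<close> \<open>0 \<le> s\<close> \<open>0 \<le> j\<close> P I
        by (simp flip: ennreal_mult ennreal_plus)
      moreover have "c powr (P - 1) * s = s powr P / I powr (P - 1)"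
        using \<open>0 \<le> s\<close> I P powr_mult_base[of s "P - 1"]
        by (simp add: c_def powr_divide mult.commute)
      moreover have "c powr P * I = s powr P / I powr (P - 1)"
        using \<open>0 \<le> s\<close> I powr_mult_base[of I "P - 1"]
        by (simp add: c_def powr_divide field_simps)
      ultimately have "P * (s powr P / I powr (P - 1)) \<le> j + (P - 1) * (s powr P / I powr (P - 1))"
        by (simp only: mult.assoc)
      then have "s powr P / I powr (P - 1) \<le> j"
        unfolding left_diff_distrib by linarith
      then have "s powr P \<le> I powr (P - 1) * j"
        using I by (simp add: field_simps)
      then show ?thesis
        using \<open>?S = ennreal s\<close> \<open>?J = ennreal j\<close> \<open>0 \<le> s\<close> \<open>0 \<le> j\<close>
        by (simp add: ennpow_ennreal flip: ennreal_mult)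
    qed (use I in \<open>simp add: ennreal_mult_top\<close>)
  next
    case top
    then have "?J = top"
      using *[of 1] P by (auto simp: ennreal_mult_top top_unique)
    then show ?thesis using I by (simp add: ennreal_mult_top)
  qed
qed

text \<open>Instead of duality: the norms \<open>K y\<close> of the sections serve as weights in
  Jensen's inequality. Integration over x of (F / K)^P K leaves K, so the P-th power of the left
  side is at most (\<integral> K)^(P-1) \<integral> K.\<close>

lemma minkowski_nn_integral:
  assumes "sigma_finite_measure M" "finite_measure N"
    and [measurable]: "(\<lambda>(x, y). F x y) \<in> borel_measurable (M \<Otimes>\<^sub>M N)" and P: "1 \<le> P"
  shows "ennpow (\<integral>\<^sup>+x. ennpow (\<integral>\<^sup>+y. F x y \<partial>N) P \<partial>M) (1 / P)
    \<le> (\<integral>\<^sup>+y. ennpow (\<integral>\<^sup>+x. ennpow (F x y) P \<partial>M) (1 / P) \<partial>N)"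
proof (cases "P = 1")
  interpret M: sigma_finite_measure M by fact
  interpret N: finite_measure N by fact
  interpret MN: pair_sigma_finite M N ..
  case True
  then show ?thesis by (simp add: MN.Fubini')
next
  interpret M: sigma_finite_measure M by fact
  interpret N: finite_measure N by fact
  interpret MN: pair_sigma_finite M N ..
  have [measurable]: "(\<lambda>(y, x). F x y) \<in> borel_measurable (N \<Otimes>\<^sub>M M)"
    using measurable_pair_swap[OF assms(3)] by (simp add: case_prod_beta)
  case False
  then have P: "1 < P" using P by simp
  define K where "K y = ennpow (\<integral>\<^sup>+x. ennpow (F x y) P \<partial>M) (1 / P)" for y
  have [measurable]: "K \<in> borel_measurable N" unfolding K_def by measurable
  have "ennpow (\<integral>\<^sup>+x. ennpow (\<integral>\<^sup>+y. F x y \<partial>N) P \<partial>M) (1 / P) \<le> (\<integral>\<^sup>+y. K y \<partial>N)"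
  proof (rule ennreal_le_epsilon)
    fix e :: real
    assume "(\<integral>\<^sup>+y. K y \<partial>N) < top" and e: "0 < e"
    then obtain k where k: "(\<integral>\<^sup>+y. K y \<partial>N) = ennreal k" "0 \<le> k"
      by (cases "\<integral>\<^sup>+y. K y \<partial>N") auto
    \<comment> \<open>Added to \<open>K\<close>, this makes the weight nonzero so that one can
      divide by it. Since \<open>N\<close> is finite it contributes at most \<open>e\<close> in
      total.\<close>
    define d where "d = e / (measure N (space N) + 1)"
    have d: "0 < d" "d * measure N (space N) \<le> e"
      using e by (auto simp: d_def field_simps add_nonneg_pos add_pos_nonneg)
    define w where "w y = K y + ennreal d" for y
    have [measurable]: "w \<in> borel_measurable N" unfolding w_def by measurable
    define I where "I = k + e"
    have I: "0 < I" using k e by (simp add: I_def)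
    have w: "(\<integral>\<^sup>+y. w y \<partial>N) \<le> ennreal I"
    proof -
      have "(\<integral>\<^sup>+y. w y \<partial>N) = ennreal k + ennreal d * ennreal (measure N (space N))"
        using k by (simp add: w_def nn_integral_add N.emeasure_eq_measure)
      also have "\<dots> \<le> ennreal I"
        using d k e by (simp add: I_def flip: ennreal_mult ennreal_plus)
      finally show ?thesis .
    qed
    then have "(\<integral>\<^sup>+y. w y \<partial>N) \<noteq> top"
      by (metis ennreal_neq_top top_unique)
    then have "AE y in N. w y \<noteq> top"
      using nn_integral_PInf_AE[of w N] by simp
    then have wfin: "AE y in N. w y \<noteq> 0 \<and> w y \<noteq> top"
      using d by (auto simp: w_def elim!: eventually_mono)
    have 1: "ennpow (\<integral>\<^sup>+y. F x y \<partial>N) P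
      \<le> ennreal (I powr (P - 1)) * (\<integral>\<^sup>+y. ennpow (F x y / w y) P * w y \<partial>N)"
      if [measurable]: "x \<in> space M" for x
    proof -
      have "(\<integral>\<^sup>+y. F x y \<partial>N) = (\<integral>\<^sup>+y. F x y / w y * w y \<partial>N)"
      proof (rule nn_integral_cong_AE, use wfin in eventually_elim)
        fix y assume "w y \<noteq> 0 \<and> w y \<noteq> top"
        then have "w y / w y = 1" by (intro ennreal_divide_self) (auto simp: less_top)
        then show "F x y = F x y / w y * w y" by (simp add: ennreal_divide_times)
      qed
      then show ?thesis
        using ennpow_nn_integral_weight_le[OF _ _ w I P, of "\<lambda>y. F x y / w y"] by simp
    qed
    \<comment> \<open>Since \<open>K \<le> w\<close>, the section \<open>F x y / w y\<close> has
      norm at most 1 in x.\<close>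
    have 2: "(\<integral>\<^sup>+x. ennpow (F x y / w y) P * w y \<partial>M) \<le> w y"
      if "w y \<noteq> 0 \<and> w y \<noteq> top" and [measurable]: "y \<in> space N" for y
    proof -
      have "(\<integral>\<^sup>+x. ennpow (F x y / w y) P * w y \<partial>M)
          = (\<integral>\<^sup>+x. ennpow (F x y) P \<partial>M) * ennpow (inverse (w y)) P * w y"
        using P by (simp add: divide_ennreal_def ennpow_mult nn_integral_multc)
      also have "(\<integral>\<^sup>+x. ennpow (F x y) P \<partial>M) = ennpow (K y) P"
        using P by (simp add: K_def ennpow_ennpow)
      also have "ennpow (K y) P * ennpow (inverse (w y)) P = ennpow (K y / w y) P"
        using P by (simp add: divide_ennreal_def ennpow_mult)
      also have "\<dots> \<le> ennpow 1 P"
        using that P by (intro ennpow_mono divide_le_posI_ennreal)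
            (auto simp: w_def zero_less_iff_neq_zero)
      finally show ?thesis by (metis ennpow_1 mult_1 mult_right_mono zero_le)
    qed
    have "(\<integral>\<^sup>+x. ennpow (\<integral>\<^sup>+y. F x y \<partial>N) P \<partial>M)
      \<le> (\<integral>\<^sup>+x. ennreal (I powr (P - 1)) * (\<integral>\<^sup>+y. ennpow (F x y / w y) P * w y \<partial>N) \<partial>M)"
      by (intro nn_integral_mono 1)
    also have "\<dots> = ennreal (I powr (P - 1)) * (\<integral>\<^sup>+y. (\<integral>\<^sup>+x. ennpow (F x y / w y) P * w y \<partial>M) \<partial>N)"
      by (subst MN.Fubini') (auto simp: nn_integral_cmult)
    also have "\<dots> \<le> ennreal (I powr (P - 1)) * (\<integral>\<^sup>+y. w y \<partial>N)"
    proof (intro mult_left_mono nn_integral_mono_AE)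
      show "AE y in N. (\<integral>\<^sup>+x. ennpow (F x y / w y) P * w y \<partial>M) \<le> w y"
        using wfin AE_space by eventually_elim (rule 2)
    qed auto
    also have "\<dots> \<le> ennreal (I powr (P - 1)) * ennreal I"
      using w by (intro mult_left_mono) auto
    also have "\<dots> = ennpow (ennreal I) P"
      using I powr_mult_base[of I "P - 1"]
          by (simp add: ennpow_ennreal mult.commute flip: ennreal_mult)
    finally have "ennpow (\<integral>\<^sup>+x. ennpow (\<integral>\<^sup>+y. F x y \<partial>N) P \<partial>M) (1 / P) \<le> ennpow (ennpow (ennreal I) P)
        (1 / P)"
      using P by (intro ennpow_mono) auto
    also have "\<dots> = (\<integral>\<^sup>+y. K y \<partial>N) + ennreal e"
      using P k e by (simp add: ennpow_ennpow I_def)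
    finally show "ennpow (\<integral>\<^sup>+x. ennpow (\<integral>\<^sup>+y. F x y \<partial>N) P \<partial>M) (1 / P) \<le> (\<integral>\<^sup>+y. K y \<partial>N) + ennreal e" .
  qed
  then show ?thesis by (simp add: K_def)
qed

section \<open>Lebesgue quasi-norms over arbitrary measures\<close>

text \<open>Covers Lebesgue and counting measure alike, so that a Herz quasi-norm is an iterated
  \<open>nrm\<close> and one lemma serves both of its layers.\<close>

definition nrm :: "'a measure \<Rightarrow> real \<Rightarrow> ('a \<Rightarrow> ennreal) \<Rightarrow> ennreal"
  where "nrm M p g = ennpow (\<integral>\<^sup>+x. ennpow (g x) p \<partial>M) (1 / p)"

lemma Lp_norm_eq_nrm: "0 < p \<Longrightarrow> Lp_norm (ennreal p) g = nrm lborel p g"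
  by (simp add: Lp_norm_def nrm_def)

lemma lq_norm_eq_nrm:
  "0 < q \<Longrightarrow> lq_norm (ennreal q) (a :: 'i::countable \<Rightarrow> ennreal) = nrm (count_space UNIV) q a"
  by (simp add: lq_norm_def nrm_def infsum_eq_nn_integral_count_space)

lemma Herz_norm_eq_nrm:
  "0 < p \<Longrightarrow> 0 < q \<Longrightarrow> Herz_norm 0 (ennreal p) (ennreal q) g =
    nrm (count_space UNIV) q (\<lambda>j. nrm lborel p (\<lambda>t. g t * indicator (annulus j) t))"
  by (simp add: Herz_norm_def lq_norm_eq_nrm Lp_norm_eq_nrm)

lemma nrm_mono: "0 < p \<Longrightarrow> (\<And>x. x \<in> space M \<Longrightarrow> f x \<le> g x) \<Longrightarrow> nrm M p f \<le> nrm M p g"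
  unfolding nrm_def by (intro ennpow_mono nn_integral_mono) auto

lemma nrm_cmult:
  assumes "0 < p" and [measurable]: "g \<in> borel_measurable M"
  shows "nrm M p (\<lambda>x. c * g x) = c * nrm M p g"
  using assms(1) by (simp add: nrm_def ennpow_mult nn_integral_cmult ennpow_ennpow)

lemma ennpow_nrm: "0 < p \<Longrightarrow> ennpow (nrm M p g) p = (\<integral>\<^sup>+x. ennpow (g x) p \<partial>M)"
  by (simp add: nrm_def ennpow_ennpow)

text \<open>For \<open>t \<le> p\<close> the new exponent \<open>p / t\<close> is at least 1: this
  is the passage from a quasi-norm to a norm.\<close>

lemma ennpow_nrm_scale: "0 < t \<Longrightarrow> ennpow (nrm M p g) t = nrm M (p / t) (\<lambda>x. ennpow (g x) t)"
  by (simp add: nrm_def ennpow_ennpow)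

lemma nrm_count_space_ge:
  fixes f :: "'i::countable \<Rightarrow> ennreal"
  assumes "0 < p" shows "f i \<le> nrm (count_space UNIV) p f"
proof -
  have "ennpow (f i) p = sum (\<lambda>i. ennpow (f i) p) {i}" by simp
  also have "\<dots> \<le> (\<integral>\<^sup>+x. ennpow (f x) p \<partial>count_space UNIV)"
    unfolding nn_integral_count_space_SUP by (rule SUP_upper) auto
  also have "\<dots> = ennpow (nrm (count_space UNIV) p f) p"
    using assms by (simp add: ennpow_nrm)
  finally show ?thesis using assms by (simp add: ennpow_le_iff)
qed

text \<open>Minkowski's inequality with exponent \<open>p / t\<close>. The constant \<open>A\<close>
  is reproduced exactly, so it does not deteriorate when coordinates are treated one after the
  other.\<close>

lemma nrm_submean:
  assumes "sigma_finite_measure M" "finite_measure N"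
    and [measurable]: "G \<in> borel_measurable M" "(\<lambda>(x, y). H x y) \<in> borel_measurable (M \<Otimes>\<^sub>M N)"
    and le: "\<And>x. x \<in> space M \<Longrightarrow> ennpow (G x) t \<le> A * (\<integral>\<^sup>+y. ennpow (H x y) t \<partial>N)"
    and t: "0 < t" "t \<le> p"
  shows "ennpow (nrm M p G) t \<le> A * (\<integral>\<^sup>+y. ennpow (nrm M p (\<lambda>x. H x y)) t \<partial>N)"
proof -
  interpret M: sigma_finite_measure M by fact
  interpret N: finite_measure N by fact
  have P: "1 \<le> p / t" using t by simp
  have "ennpow (nrm M p G) t \<le> nrm M (p / t) (\<lambda>x. A * (\<integral>\<^sup>+y. ennpow (H x y) t \<partial>N))"
    using le t by (simp add: ennpow_nrm_scale nrm_mono)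
  also have "\<dots> = A * nrm M (p / t) (\<lambda>x. \<integral>\<^sup>+y. ennpow (H x y) t \<partial>N)"
    using t by (intro nrm_cmult) auto
  also have "\<dots> \<le> A * (\<integral>\<^sup>+y. nrm M (p / t) (\<lambda>x. ennpow (H x y) t) \<partial>N)"
    unfolding nrm_def using minkowski_nn_integral[OF assms(1,2) _ P, of "\<lambda>x y. ennpow (H x y) t"]
    by (intro mult_left_mono) auto
  finally show ?thesis using t by (simp add: ennpow_nrm_scale)
qed

lemma annulus_measurable [measurable]: "annulus k \<in> sets borel"
  unfolding annulus_def by measurable

text \<open>\<open>nrm_submean\<close> twice: on each annulus, then over the annuli. The averaging
  parameter \<open>y\<close> does not act on the variable \<open>x\<close> of the quasi-norm, so the
  cut-offs to annuli do no harm.\<close>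

lemma Herz_norm_submean:
  assumes N: "finite_measure N"
    and [measurable]: "G \<in> borel_measurable borel" "(\<lambda>(x, y). H x y) \<in> borel_measurable
        (borel \<Otimes>\<^sub>M N)"
    and le: "\<And>x. ennpow (G x) t \<le> A * (\<integral>\<^sup>+y. ennpow (H x y) t \<partial>N)"
    and t: "0 < t" "t \<le> p" "t \<le> q"
  shows "ennpow (Herz_norm 0 (ennreal p) (ennreal q) G) t
    \<le> A * (\<integral>\<^sup>+y. ennpow (Herz_norm 0 (ennreal p) (ennreal q) (\<lambda>x. H x y)) t \<partial>N)"
proof -
  interpret N: finite_measure N by fact
  have c: "sigma_finite_measure (count_space (UNIV :: int set))"
    by (rule sigma_finite_measure_count_space_countable) simp
  interpret L: pair_sigma_finite lborel N ..
  have [measurable]: "(\<lambda>(y, x). H x y) \<in> borel_measurable (N \<Otimes>\<^sub>M lborel)"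
    using measurable_pair_swap[OF assms(3)] by (simp add: case_prod_beta)
  have inner: "ennpow (nrm lborel p (\<lambda>x. G x * indicator (annulus j) x)) t
      \<le> A * (\<integral>\<^sup>+y. ennpow (nrm lborel p (\<lambda>x. H x y * indicator (annulus j) x)) t \<partial>N)" for j
    using t le by (intro nrm_submean[OF sigma_finite_lborel N]) (auto simp: indicator_def)
  have m: "(\<lambda>(j, y). nrm lborel p (\<lambda>x. H x y * indicator (annulus j) x))
      \<in> borel_measurable (count_space UNIV \<Otimes>\<^sub>M N)"
  proof (rule measurable_pair_measure_countable1)
    show "(\<lambda>y. case (j, y) of (j, y) \<Rightarrow> nrm lborel p (\<lambda>x. H x y * indicator (annulus j) x))
        \<in> borel_measurable N" for j
      unfolding nrm_def by simp
  qed auto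
  show ?thesis
    using t m inner by (simp add: Herz_norm_eq_nrm nrm_submean[OF c N])
qed

section \<open>The averaging kernel\<close>

text \<open>Comparable to (1 + |y|)^(-2). Writing it as a superposition of indicators of balls
  reduces \<open>kern\<close>-averages to averages over balls of radius 2^a.\<close>

definition kern :: "real \<Rightarrow> ennreal"
  where "kern y = (\<Sum>a. ennreal ((1/4) ^ a) * indicator (ball 0 (2 ^ a)) y)"

lemma measurable_kern [measurable]: "kern \<in> borel_measurable borel"
proof -
  have [measurable]: "ball 0 (2 ^ a) \<in> sets (borel :: real measure)" for a :: nat by simp
  show ?thesis unfolding kern_def by simp
qed

definition kmeas :: "real measure"
  where "kmeas = density lborel kern"

lemma sets_kmeas [measurable_cong, simp]: "sets kmeas = sets borel"
  by (simp add: kmeas_def)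

lemma nn_integral_kmeas:
  assumes [measurable]: "g \<in> borel_measurable borel"
  shows "(\<integral>\<^sup>+y. g y \<partial>kmeas) = (\<Sum>a. ennreal ((1/4) ^ a) *
      (\<integral>\<^sup>+y. g y * indicator (ball 0 (2 ^ a)) y \<partial>lborel))"
proof -
  have [measurable]: "ball 0 (2 ^ a) \<in> sets (borel :: real measure)" for a :: nat by simp
  have "(\<integral>\<^sup>+y. g y \<partial>kmeas) = (\<integral>\<^sup>+y. (\<Sum>a. ennreal ((1/4) ^ a) * indicator (ball 0 (2 ^ a)) y) * g y
      \<partial>lborel)"
    by (simp add: kmeas_def nn_integral_density kern_def)
  also have "\<dots> = (\<integral>\<^sup>+y. (\<Sum>a. ennreal ((1/4) ^ a) * (g y * indicator (ball 0 (2 ^ a)) y)) \<partial>lborel)"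
    by (simp add: ennreal_suminf_multc[symmetric] mult_ac)
  also have "\<dots> = (\<Sum>a. ennreal ((1/4) ^ a) * (\<integral>\<^sup>+y. g y * indicator (ball 0 (2 ^ a)) y \<partial>lborel))"
    by (subst nn_integral_suminf, measurable) (simp add: nn_integral_cmult)
  finally show ?thesis .
qed

lemma emeasure_kmeas_UNIV: "emeasure kmeas UNIV = 4"
proof -
  have "emeasure kmeas UNIV = (\<integral>\<^sup>+y. 1 \<partial>kmeas)" by (simp add: kmeas_def)
  also have "\<dots> = (\<Sum>a. ennreal ((1/4) ^ a * (2 * 2 ^ a)))"
    by (subst nn_integral_kmeas) (auto simp: ball_eq_greaterThanLessThan ennreal_mult)
  also have "\<dots> = (\<Sum>a. ennreal (2 * (1 / 2) ^ a))"
  proof -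
    have "(1/4) ^ a * (2 * 2 ^ a) = 2 * (1/2 :: real) ^ a" for a
      using power_mult_distrib[of "1/4" "2::real" a] by simp
    then show ?thesis by (simp only:)
  qed
  also have "\<dots> = 4"
    by (subst suminf_ennreal2) (auto simp: suminf_mult suminf_geometric summable_geometric)
  finally show ?thesis .
qed

lemma finite_measure_kmeas: "finite_measure kmeas"
  by (rule finite_measureI) (simp add: kmeas_def[THEN arg_cong[of _ _ space]] emeasure_kmeas_UNIV)

section \<open>Dyadic sums and annuli\<close>

lemma suminf_powr_le:
  fixes b c :: real
  assumes "0 \<le> b" "b < 1" "0 \<le> c"
  shows "(\<Sum>i. ennreal (c * b ^ i)) = ennreal (c / (1 - b))"
  using assms
  by (subst suminf_ennreal2) (auto simp: suminf_mult suminf_geometric summable_geometric)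

lemma two_powr_less_one: "s < 0 \<Longrightarrow> 2 powr s < (1 :: real)"
  using powr_less_mono[of s 0 2] by simp

text \<open>A geometric sum over j \<le> \<open>\<lfloor>log 2 M\<rfloor>\<close>, controlled by its
  largest term, which is at most M^s.\<close>

lemma nn_integral_dyadic_le:
  fixes s M :: real assumes s: "0 < s" and M: "0 \<le> M"
  shows "(\<integral>\<^sup>+j. (if 2 powr real_of_int j \<le> M then ennreal (2 powr (real_of_int j * s)) else 0)
      \<partial>count_space UNIV)
    \<le> ennreal (M powr s / (1 - 2 powr - s))" (is "?L \<le> _")
proof (cases "M = 0")
  case True
  then have "?L = (\<integral>\<^sup>+(j::int). 0 \<partial>count_space UNIV)"
    by (intro nn_integral_cong) (simp add: not_le)
  then show ?thesis by simp
next
  case False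
  then have M: "0 < M" using M by simp
  define J where "J = \<lfloor>log 2 M\<rfloor>"
  have J: "2 powr real_of_int j \<le> M \<longleftrightarrow> j \<le> J" for j :: int
    using M by (simp add: J_def le_log_iff[symmetric] le_floor_iff)
  have bij: "bij_betw (\<lambda>i. J - int i) UNIV {..J}"
    by (rule bij_betw_byWitness[where f' = "\<lambda>j. nat (J - j)"]) auto
  have "?L = (\<integral>\<^sup>+j. ennreal (2 powr (real_of_int j * s)) * indicator {..J} j \<partial>count_space UNIV)"
    by (intro nn_integral_cong) (auto simp: J)
  also have "\<dots> = (\<integral>\<^sup>+j. ennreal (2 powr (real_of_int j * s)) \<partial>count_space {..J})"
    by (simp add: nn_integral_count_space_indicator)
  also have "\<dots> = (\<integral>\<^sup>+i. ennreal (2 powr (real_of_int (J - int i) * s)) \<partial>count_space UNIV)"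
    by (rule nn_integral_bij_count_space[OF bij, symmetric])
  also have "\<dots> = (\<Sum>i. ennreal (2 powr (real_of_int J * s) * (2 powr - s) ^ i))"
    unfolding nn_integral_count_space_nat
  proof (intro suminf_cong)
    fix i :: nat
    have "(2 powr - s) ^ i = 2 powr (- s * real i)"
      by (simp add: powr_powr flip: powr_realpow)
    then have "2 powr (real_of_int J * s) * (2 powr - s) ^ i = 2 powr (real_of_int (J - int i) * s)"
      by (simp add: algebra_simps flip: powr_add)
    then show "ennreal (2 powr (real_of_int (J - int i) * s)) = ennreal
        (2 powr (real_of_int J * s) * (2 powr - s) ^ i)"
      by simp
  qed
  also have "\<dots> = ennreal (2 powr (real_of_int J * s) / (1 - 2 powr - s))"
    using s two_powr_less_one[of "- s"] by (intro suminf_powr_le) auto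
  also have "\<dots> \<le> ennreal (M powr s / (1 - 2 powr - s))"
  proof -
    have "2 powr (real_of_int J * s) = (2 powr real_of_int J) powr s" by (simp add: powr_powr)
    also have "\<dots> \<le> M powr s" using J[of J] s by (intro powr_mono2) auto
    finally show ?thesis
      using s two_powr_less_one[of "- s"] by (intro ennreal_leI divide_right_mono) auto
  qed
  finally show ?thesis .
qed

lemma nn_integral_dyadic_nat_le:
  fixes s M :: real assumes s: "0 < s" and M: "0 \<le> M"
  shows "(\<integral>\<^sup>+k. (if 2 powr - real k \<le> M then ennreal (2 powr (- real k * s)) else 0) \<partial>count_space
      UNIV)
    \<le> ennreal (M powr s / (1 - 2 powr - s))" (is "?L \<le> _")
proof -
  let ?f = "\<lambda>j. (if 2 powr real_of_int j \<le> M then ennreal (2 powr (real_of_int j * s)) else 0)"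
  have bij: "bij_betw (\<lambda>k. - int k) UNIV {..0}"
    by (rule bij_betw_byWitness[where f' = "\<lambda>j. nat (- j)"]) auto
  have "?L = (\<integral>\<^sup>+k. ?f (- int k) \<partial>count_space UNIV)" by (intro nn_integral_cong) simp
  also have "\<dots> = (\<integral>\<^sup>+j. ?f j \<partial>count_space {..0})" by (rule nn_integral_bij_count_space[OF bij])
  also have "\<dots> \<le> (\<integral>\<^sup>+j. ?f j \<partial>count_space UNIV)"
    by (subst nn_integral_count_space_indicator) (auto intro!: nn_integral_mono simp: indicator_def)
  also have "\<dots> \<le> ennreal (M powr s / (1 - 2 powr - s))" by (rule nn_integral_dyadic_le[OF s M])
  finally show ?thesis .
qed

lemma annulus_eq: "annulus j = {t. 2 powr (real_of_int j - 1) \<le> \<bar>t\<bar> \<and> \<bar>t\<bar> < 2 powr real_of_int j}"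
  using powr_real_of_int'[of 2 "j - 1"] powr_real_of_int'[of 2 j] by (simp add: annulus_def)

lemma disjoint_family_annulus: "disjoint_family annulus"
  unfolding disjoint_family_on_def
proof (intro ballI impI)
  fix i j :: int assume "i \<noteq> j"
  have *: "annulus i \<inter> annulus j = {}" if "i < j" for i j :: int
  proof -
    have "2 powr real_of_int i \<le> 2 powr (real_of_int j - 1)" using that by simp
    then show ?thesis unfolding annulus_eq by (auto simp del: powr_le_cancel_iff)
  qed
  show "annulus i \<inter> annulus j = {}" using \<open>i \<noteq> j\<close> * by (cases i j rule: linorder_cases) auto
qed

lemma emeasure_annulus_le: "emeasure lborel (annulus j) \<le> ennreal (2 * 2 powr real_of_int j)"
proof -
  have "emeasure lborel (annulus j) \<le> emeasure lborel {- (2 powr real_of_int j) .. 2 powr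
      real_of_int j}"
    unfolding annulus_eq by (intro emeasure_mono) auto
  then show ?thesis by simp
qed

lemma nn_integral_emeasure_annulus_le:
  assumes [measurable]: "U \<in> sets borel"
  shows "(\<integral>\<^sup>+j. emeasure lborel (U \<inter> annulus j) \<partial>count_space UNIV) \<le> emeasure lborel U"
proof -
  have "(\<integral>\<^sup>+j. emeasure lborel (U \<inter> annulus j) \<partial>count_space UNIV) = emeasure lborel
      (\<Union>j. U \<inter> annulus j)"
    using disjoint_family_annulus
    by (intro emeasure_UN_countable[symmetric]) (auto simp: disjoint_family_on_def)
  also have "\<dots> \<le> emeasure lborel U" by (intro emeasure_mono) auto
  finally show ?thesis .
qed

text \<open>Both components of the annulus have length 2^(j-1) \<ge> 2 l, so on at least one side of
  \<open>x\<close> there is room for an interval of length \<open>l\<close>. The cases go away from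
  the origin unless the outer edge is too close.\<close>

lemma annulus_subinterval:
  fixes x :: real
  assumes x: "x \<in> annulus j" and l: "0 < l" "4 * l \<le> 2 powr real_of_int j"
  obtains a where "{a..<a + l} \<subseteq> annulus j" "{a..<a + l} \<subseteq> ball x (2 * l)"
proof -
  define m where "m = 2 powr (real_of_int j - 1)"
  have m: "2 powr real_of_int j = 2 * m" "2 * l \<le> m" using l by (auto simp: m_def powr_diff)
  have x': "m \<le> \<bar>x\<bar>" "\<bar>x\<bar> < 2 * m" using x by (auto simp: annulus_eq m_def[symmetric] m(1))
  have A: "annulus j = {t. m \<le> \<bar>t\<bar> \<and> \<bar>t\<bar> < 2 * m}" by (simp add: annulus_eq m_def[symmetric] m(1))
  consider "0 \<le> x" "x + l \<le> 2 * m" | "0 \<le> x" "x + l > 2 * m" | "x < 0" "x - l > - 2 * m" | "x < 0"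
      "x - l \<le> - 2 * m"
    by linarith
  then show ?thesis
  proof cases
    case *: 1
    show ?thesis
    proof (rule that[of "x"])
      show "{x..<x + l} \<subseteq> annulus j"
        unfolding A using x' l m(2) * by auto
      show "{x..<x + l} \<subseteq> ball x (2 * l)"
        using l by (auto simp: dist_real_def)
    qed
  next
    case *: 2
    show ?thesis
    proof (rule that[of "x - l"])
      show "{x - l..<x - l + l} \<subseteq> annulus j"
        unfolding A using x' l m(2) * by auto
      show "{x - l..<x - l + l} \<subseteq> ball x (2 * l)"
        using l by (auto simp: dist_real_def)
    qed
  next
    case *: 3
    show ?thesis
    proof (rule that[of "x - l"])
      show "{x - l..<x - l + l} \<subseteq> annulus j"
        unfolding A using x' l m(2) * by auto
      show "{x - l..<x - l + l} \<subseteq> ball x (2 * l)"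
        using l by (auto simp: dist_real_def)
    qed
  next
    case *: 4
    show ?thesis
    proof (rule that[of "x"])
      show "{x..<x + l} \<subseteq> annulus j"
        unfolding A using x' l m(2) * by auto
      show "{x..<x + l} \<subseteq> ball x (2 * l)"
        using l by (auto simp: dist_real_def)
    qed
  qed
qed

section \<open>Neighbourhoods of level sets\<close>

text \<open>Each \<open>E k\<close> is thickened at its own scale 2^(-k), on which the k-th function
  is essentially constant. The union no longer depends on k, so the whole sum over k can be charged
  to one set.\<close>

definition nbhd :: "(nat \<Rightarrow> real set) \<Rightarrow> real set"
  where "nbhd E = (\<Union>k. \<Union>x\<in>E k. ball x (2 powr - real k))"

lemma open_nbhd: "open (nbhd E)"
  unfolding nbhd_def by auto

lemma sets_nbhd [measurable]: "nbhd E \<in> sets borel"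
  using open_nbhd by simp

lemma subset_nbhd: "E k \<subseteq> nbhd E"
  by (force simp: nbhd_def)

text \<open>If \<open>E k\<close> meets the annulus, then the neighbourhood fills an interval of
  length 2^(-k) / 2 there, so 2^(-k) \<le> 2 m for its measure m. The summands are at most m^r
  2^(-k(1-r)), and since r < 1 their sum over such k is of order m^r m^(1-r) = m.\<close>

lemma emeasure_level_annulus_le:
  assumes r: "0 < r" "r < 1" and [measurable]: "\<And>k. E k \<in> sets borel"
  shows "(\<integral>\<^sup>+k. (if - int k < j then ennreal (2 powr (real k * (r - 1))) * ennpow
      (emeasure lborel (E k \<inter> annulus j)) r else 0) \<partial>count_space UNIV)
    \<le> ennreal (2 / (1 - 2 powr (r - 1))) * emeasure lborel (nbhd E \<inter> annulus j)"
    (is "?L \<le> _")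
proof -
  let ?\<mu> = "emeasure lborel (nbhd E \<inter> annulus j)"
  have "?\<mu> \<le> ennreal (2 * 2 powr real_of_int j)"
    using emeasure_mono[of "nbhd E \<inter> annulus j" "annulus j" lborel] emeasure_annulus_le[of j]
    by (auto intro: order_trans)
  then obtain m where m: "?\<mu> = ennreal m" "0 \<le> m"
    by (cases ?\<mu>) (auto simp: top_unique)
  have "(if - int k < j then ennreal (2 powr (real k * (r - 1))) * ennpow
      (emeasure lborel (E k \<inter> annulus j)) r else 0)
    \<le> ennreal (m powr r) * (if 2 powr - real k \<le> 2 * m then ennreal (2 powr (- real k * (1 - r)))
        else 0)" for k
  proof (cases "- int k < j \<and> emeasure lborel (E k \<inter> annulus j) \<noteq> 0")
    case True
    then obtain x where x: "x \<in> E k" "x \<in> annulus j"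
      by (metis IntD1 IntD2 emeasure_empty ex_in_conv)
    \<comment> \<open>Then the ball of radius \<open>2 * l\<close> is the one used in
      \<open>nbhd\<close>, and \<open>4 * l\<close> equals 2^(1-k), which is at most 2^j because j
      \<ge> 1 - k.\<close>
    define l where "l = 2 powr - real k / 2"
    have "real_of_int j \<ge> 1 - real k" using True by linarith
    then have "2 powr (1 - real k) \<le> 2 powr real_of_int j" by simp
    then have l: "0 < l" "4 * l \<le> 2 powr real_of_int j"
        by (auto simp: l_def powr_diff powr_minus field_simps)
    obtain a where a: "{a..<a + l} \<subseteq> annulus j" "{a..<a + l} \<subseteq> ball x (2 * l)"
      using annulus_subinterval[OF x(2) l] .
    have "ball x (2 * l) \<subseteq> nbhd E" using x by (auto simp: l_def nbhd_def)
    then have "emeasure lborel {a..<a + l} \<le> ?\<mu>"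
      using a by (intro emeasure_mono) auto
    then have "l \<le> m" using m l by simp
    moreover have "ennpow (emeasure lborel (E k \<inter> annulus j)) r \<le> ennpow ?\<mu> r"
      using r subset_nbhd[of E k] by (intro ennpow_mono emeasure_mono) auto
    ultimately have le: "2 powr - real k \<le> 2 * m"
      and "ennpow (emeasure lborel (E k \<inter> annulus j)) r \<le> ennreal (m powr r)"
      using m by (auto simp: l_def ennpow_ennreal)
    then have "ennreal (2 powr (real k * (r - 1))) * ennpow (emeasure lborel (E k \<inter> annulus j)) r
        \<le> ennreal (2 powr (real k * (r - 1))) * ennreal (m powr r)"
      by (intro mult_left_mono) auto
    moreover have "real k * (r - 1) = - real k * (1 - r)" by (simp add: algebra_simps)
    ultimately show ?thesis
      using True le by (simp add: mult.commute)
  qed auto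
  then have "?L \<le> (\<integral>\<^sup>+k. ennreal (m powr r) * (if 2 powr - real k \<le> 2 * m then ennreal
      (2 powr (- real k * (1 - r))) else 0) \<partial>count_space UNIV)"
    by (intro nn_integral_mono) auto
  also have "\<dots> = ennreal (m powr r) * (\<integral>\<^sup>+k. (if 2 powr - real k \<le> 2 * m then ennreal
      (2 powr (- real k * (1 - r))) else 0) \<partial>count_space UNIV)"
    by (intro nn_integral_cmult) auto
  also have "\<dots> \<le> ennreal (m powr r) * ennreal ((2 * m) powr (1 - r) / (1 - 2 powr - (1 - r)))"
    using r m by (intro mult_left_mono nn_integral_dyadic_nat_le) auto
  also have "\<dots> = ennreal (m powr r * ((2 * m) powr (1 - r) / (1 - 2 powr (r - 1))))"
    using r two_powr_less_one[of "r - 1"] by (simp flip: ennreal_mult)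
  also have "\<dots> \<le> ennreal (2 / (1 - 2 powr (r - 1)) * m)"
  proof (intro ennreal_leI)
    have "m powr r * (2 * m) powr (1 - r) = 2 powr (1 - r) * m"
      using m powr_add[of m r "1 - r"] by (simp add: powr_mult)
    also have "\<dots> \<le> 2 powr 1 * m" using r m by (intro mult_right_mono powr_mono) auto
    finally show "m powr r * ((2 * m) powr (1 - r) / (1 - 2 powr (r - 1))) \<le> 2 /
        (1 - 2 powr (r - 1)) * m"
      using r two_powr_less_one[of "r - 1"] by (simp add: divide_right_mono)
  qed
  finally show ?thesis using m r two_powr_less_one[of "r - 1"] by (simp flip: ennreal_mult)
qed

text \<open>These annuli lie inside the interval of radius 2^(-k) about 0 and may be too thin for
  \<open>annulus_subinterval\<close>. Their r-th powers sum over j to order 2^(-kr), leaving 2^(-k)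
  for each k whose \<open>E k\<close> meets that interval. The sum over k is governed by the first
  such k.\<close>

lemma emeasure_level_center_le:
  assumes r: "0 < r" "r < 1" and [measurable]: "\<And>k. E k \<in> sets borel"
  shows "(\<integral>\<^sup>+k. \<integral>\<^sup>+j. (if j \<le> - int k then ennreal (2 powr (real k * (r - 1))) * ennpow
      (emeasure lborel (E k \<inter> annulus j)) r else 0) \<partial>count_space UNIV \<partial>count_space UNIV)
    \<le> ennreal (2 / (1 - 2 powr - r)) * emeasure lborel (nbhd E)"
    (is "?L \<le> _")
proof -
  define B where "B k \<longleftrightarrow> (\<exists>x\<in>E k. \<bar>x\<bar> < 2 powr - real k)" for k
  have inner: "(\<integral>\<^sup>+j. (if j \<le> - int k then ennreal (2 powr (real k * (r - 1))) * ennpow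
      (emeasure lborel (E k \<inter> annulus j)) r else 0) \<partial>count_space UNIV)
    \<le> (if B k then ennreal (2 / (1 - 2 powr - r) * 2 powr - real k) else 0)" (is "?I \<le> _") for k
  proof -
    have *: "(if j \<le> - int k then ennreal (2 powr (real k * (r - 1))) * ennpow
        (emeasure lborel (E k \<inter> annulus j)) r else 0)
      \<le> (if B k then ennreal (2 * 2 powr (real k * (r - 1))) else 0) *
         (if 2 powr real_of_int j \<le> 2 powr - real k then ennreal (2 powr (real_of_int j * r)) else
             0)" for j
    proof (cases "j \<le> - int k \<and> emeasure lborel (E k \<inter> annulus j) \<noteq> 0")
      case True
      then obtain x where x: "x \<in> E k" "x \<in> annulus j"
        by (metis IntD1 IntD2 emeasure_empty ex_in_conv)
      have j: "real_of_int j \<le> - real k" using True by linarith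
      then have j': "2 powr real_of_int j \<le> 2 powr - real k" by simp
      have "\<bar>x\<bar> < 2 powr - real k"
        using x j' unfolding annulus_eq by (auto simp del: powr_le_cancel_iff)
      then have "B k" using x by (auto simp: B_def)
      have "ennpow (emeasure lborel (E k \<inter> annulus j)) r \<le> ennpow
          (ennreal (2 * 2 powr real_of_int j)) r"
        using r emeasure_annulus_le[of j] emeasure_mono[of "E k \<inter> annulus j" "annulus j" lborel]
        by (intro ennpow_mono) auto
      also have "\<dots> = ennreal (2 powr r * 2 powr (real_of_int j * r))"
        by (simp add: ennpow_ennreal powr_mult powr_powr)
      also have "\<dots> \<le> ennreal (2 * 2 powr (real_of_int j * r))"
        using r powr_mono[of r 1 "2::real"] by (intro ennreal_leI mult_right_mono) auto
      finally have "ennreal (2 powr (real k * (r - 1))) * ennpow (emeasure lborel (E k \<inter> annulus j))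
          r
          \<le> ennreal (2 powr (real k * (r - 1))) * ennreal (2 * 2 powr (real_of_int j * r))"
        by (intro mult_left_mono) auto
      then show ?thesis using True \<open>B k\<close> j' by (simp add: ennreal_mult mult_ac)
    qed auto
    have "?I \<le> (\<integral>\<^sup>+j. (if B k then ennreal (2 * 2 powr (real k * (r - 1))) else 0) *
         (if 2 powr real_of_int j \<le> 2 powr - real k then ennreal (2 powr (real_of_int j * r)) else
             0) \<partial>count_space UNIV)"
      by (intro nn_integral_mono *)
    also have "\<dots> = (if B k then ennreal (2 * 2 powr (real k * (r - 1))) else 0) *
         (\<integral>\<^sup>+j. (if 2 powr real_of_int j \<le> 2 powr - real k then ennreal (2 powr (real_of_int j * r))
             else 0) \<partial>count_space UNIV)"
      by (intro nn_integral_cmult) auto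
    also have "\<dots> \<le> (if B k then ennreal (2 * 2 powr (real k * (r - 1))) else 0) *
         ennreal ((2 powr - real k) powr r / (1 - 2 powr - r))"
      using r by (intro mult_left_mono nn_integral_dyadic_le) auto
    also have "\<dots> = (if B k then ennreal (2 / (1 - 2 powr - r) * 2 powr - real k) else 0)"
    proof -
      have "2 powr (real k * (r - 1)) * (2 powr - real k) powr r = 2 powr - real k"
        by (simp add: powr_powr algebra_simps flip: powr_add)
      then have "2 * 2 powr (real k * (r - 1)) * ((2 powr - real k) powr r / (1 - 2 powr - r))
          = 2 / (1 - 2 powr - r) * 2 powr - real k"
        by (simp add: algebra_simps)
      then show ?thesis using r two_powr_less_one[of "- r"] by (simp flip: ennreal_mult)
    qed
    finally show ?thesis .
  qed
  show ?thesis
  proof (cases "\<exists>k. B k")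
    case False
    then have "?L \<le> (\<integral>\<^sup>+(k::nat). 0 \<partial>count_space UNIV)"
      by (intro nn_integral_mono order_trans[OF inner]) simp
    then show ?thesis by simp
  next
    case True
    \<comment> \<open>The coarsest scale that occurs: the geometric sum from \<open>k0\<close> on
      equals the length of a single ball contained in \<open>nbhd E\<close>.\<close>
    define k0 where "k0 = (LEAST k. B k)"
    have k0: "B k0" "\<And>k. B k \<Longrightarrow> k0 \<le> k"
      using True by (auto simp: k0_def intro: LeastI Least_le)
    obtain x where x: "x \<in> E k0" using k0 by (auto simp: B_def)
    let ?K = "2 / (1 - 2 powr - r)"
    have K: "0 \<le> ?K" using r two_powr_less_one[of "- r"] by simp
    have "?L \<le> (\<integral>\<^sup>+k. ennreal ?K * (if 2 powr - real k \<le> 2 powr - real k0 then ennreal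
        (2 powr (- real k * 1)) else 0) \<partial>count_space UNIV)"
      using k0(2) K by (intro nn_integral_mono order_trans[OF inner]) (auto simp flip: ennreal_mult)
    also have "\<dots> = ennreal ?K * (\<integral>\<^sup>+k. (if 2 powr - real k \<le> 2 powr - real k0 then ennreal
        (2 powr (- real k * 1)) else 0) \<partial>count_space UNIV)"
      by (intro nn_integral_cmult) auto
    also have "\<dots> \<le> ennreal ?K * ennreal ((2 powr - real k0) powr 1 / (1 - 2 powr - 1))"
      by (intro mult_left_mono nn_integral_dyadic_nat_le) auto
    also have "\<dots> = ennreal ?K * emeasure lborel (ball x (2 powr - real k0))"
      by (simp add: ball_eq_greaterThanLessThan powr_minus mult.commute)
    also have "\<dots> \<le> ennreal ?K * emeasure lborel (nbhd E)"
    proof (intro mult_left_mono emeasure_mono)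
      show "ball x (2 powr - real k0) \<subseteq> nbhd E" using x by (auto simp: nbhd_def)
    qed auto
    finally show ?thesis .
  qed
qed

lemma count_space_swap:
  fixes f :: "'i \<Rightarrow> 'j \<Rightarrow> ennreal"
  shows "(\<integral>\<^sup>+i. \<integral>\<^sup>+j. f i j \<partial>count_space UNIV \<partial>count_space UNIV)
    = (\<integral>\<^sup>+j. \<integral>\<^sup>+i. f i j \<partial>count_space UNIV \<partial>count_space UNIV)"
  using nn_integral_fst_count_space[of "\<lambda>(i, j). f i j"]
      nn_integral_snd_count_space[of "\<lambda>(i, j). f i j"]
  by simp

lemma emeasure_level_sum_le:
  assumes r: "0 < r" "r < 1" and [measurable]: "\<And>k. E k \<in> sets borel"
  shows "(\<integral>\<^sup>+k. \<integral>\<^sup>+j. ennreal (2 powr (real k * (r - 1))) * ennpow (emeasure lborel (E k \<inter> annulus j))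
      r \<partial>count_space UNIV \<partial>count_space UNIV)
    \<le> ennreal (2 / (1 - 2 powr (r - 1)) + 2 / (1 - 2 powr - r)) * emeasure lborel (nbhd E)"
proof -
  define X where "X k j = ennreal (2 powr (real k * (r - 1))) * ennpow
      (emeasure lborel (E k \<inter> annulus j)) r" for k j
  \<comment> \<open>The annuli are separated at j = -k. Beyond it the bound holds for each j and
    disjointness sums it, so the summations are interchanged; below it the bound holds only for the
    double sum.\<close>
  have "(\<integral>\<^sup>+k. \<integral>\<^sup>+j. X k j \<partial>count_space UNIV \<partial>count_space UNIV)
    = (\<integral>\<^sup>+k. \<integral>\<^sup>+j. (if - int k < j then X k j else 0) + (if j \<le> - int k then X k j else 0)
        \<partial>count_space UNIV \<partial>count_space UNIV)"
    by (intro nn_integral_cong) auto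
  also have "\<dots> = (\<integral>\<^sup>+j. \<integral>\<^sup>+k. (if - int k < j then X k j else 0) \<partial>count_space UNIV \<partial>count_space UNIV)
      + (\<integral>\<^sup>+k. \<integral>\<^sup>+j. (if j \<le> - int k then X k j else 0) \<partial>count_space UNIV \<partial>count_space UNIV)"
    by (simp add: nn_integral_add count_space_swap[of "\<lambda>k j. if - int k < j then X k j else 0"])
  also have "\<dots> \<le> (\<integral>\<^sup>+j. ennreal (2 / (1 - 2 powr (r - 1))) * emeasure lborel (nbhd E \<inter> annulus j)
      \<partial>count_space UNIV)
      + ennreal (2 / (1 - 2 powr - r)) * emeasure lborel (nbhd E)"
    unfolding X_def
    by (intro add_mono nn_integral_mono emeasure_level_annulus_le emeasure_level_center_le r) auto
  also have "(\<integral>\<^sup>+j. ennreal (2 / (1 - 2 powr (r - 1))) * emeasure lborel (nbhd E \<inter> annulus j)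
      \<partial>count_space UNIV)
    = ennreal (2 / (1 - 2 powr (r - 1))) * (\<integral>\<^sup>+j. emeasure lborel (nbhd E \<inter> annulus j) \<partial>count_space
        UNIV)"
    by (intro nn_integral_cmult) auto
  also have "\<dots> \<le> ennreal (2 / (1 - 2 powr (r - 1))) * emeasure lborel (nbhd E)"
    by (intro mult_left_mono nn_integral_emeasure_annulus_le) auto
  finally have "(\<integral>\<^sup>+k. \<integral>\<^sup>+j. X k j \<partial>count_space UNIV \<partial>count_space UNIV)
      \<le> (ennreal (2 / (1 - 2 powr (r - 1))) + ennreal (2 / (1 - 2 powr - r))) * emeasure lborel
          (nbhd E)"
    by (simp add: distrib_right)
  moreover have "0 \<le> 2 / (1 - 2 powr (r - 1))" "0 \<le> 2 / (1 - 2 powr - r)"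
    using r two_powr_less_one[of "r - 1"] two_powr_less_one[of "- r"] by auto
  ultimately show ?thesis
    by (simp add: X_def)
qed

section \<open>A one-dimensional Jawerth--Franke inequality\<close>

text \<open>The covering argument for the maximal function: Vitali selects disjoint balls whose
  fivefold enlargements cover \<open>U\<close>. In one dimension these have length 10 times the
  radius, whence the factor 10.\<close>

lemma weak_type_averages:
  fixes g :: "real \<Rightarrow> ennreal"
  assumes [measurable]: "g \<in> borel_measurable borel" "U \<in> sets borel" and l: "0 < l"
    and U: "\<And>x. x \<in> U \<Longrightarrow> \<exists>\<rho>>0. ennreal (l * \<rho>) < (\<integral>\<^sup>+y. g y * indicator (ball x \<rho>) y \<partial>lborel)"
  shows "ennreal l * emeasure lborel U \<le> 10 * (\<integral>\<^sup>+y. g y \<partial>lborel)"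
proof (cases "\<integral>\<^sup>+y. g y \<partial>lborel")
  case top
  then show ?thesis by (simp add: ennreal_mult_top)
next
  case (real T)
  have [measurable]: "ball x a \<in> sets (borel :: real measure)" for x a :: real by simp
  have "\<forall>x\<in>U. \<exists>\<rho>. 0 < \<rho> \<and> ennreal (l * \<rho>) < (\<integral>\<^sup>+y. g y * indicator (ball x \<rho>) y \<partial>lborel)"
    using U by (intro ballI)
  from bchoice[OF this] obtain \<rho> where \<rho>: "\<And>x. x \<in> U \<Longrightarrow>
      0 < \<rho> x \<and> ennreal (l * \<rho> x) < (\<integral>\<^sup>+y. g y * indicator (ball x (\<rho> x)) y \<partial>lborel)"
    by blast
  \<comment> \<open>Vitali's lemma requires bounded radii; the finite total integral
    \<open>T\<close> bounds them.\<close>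
  have bnd: "0 < \<rho> x \<and> \<rho> x \<le> T / l" if "x \<in> U" for x
  proof -
    have "ennreal (l * \<rho> x) < (\<integral>\<^sup>+y. g y * indicator (ball x (\<rho> x)) y \<partial>lborel)"
      using \<rho>[OF that] by simp
    also have "\<dots> \<le> (\<integral>\<^sup>+y. g y \<partial>lborel)"
      by (intro nn_integral_mono) (auto simp: indicator_def)
    finally have "l * \<rho> x \<le> T" using real by (simp add: ennreal_less_iff l \<rho> that less_imp_le)
    then show ?thesis using \<rho>[OF that] l by (simp add: field_simps)
  qed
  obtain C where C: "countable C" "C \<subseteq> U" "pairwise (\<lambda>i j. disjnt (ball i (\<rho> i)) (ball j (\<rho> j))) C"
    "U \<subseteq> (\<Union>i\<in>C. ball i (5 * \<rho> i))"
  proof (rule Vitali_covering_lemma_balls[OF _ bnd])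
    show "U \<subseteq> (\<Union>i\<in>U. ball i (\<rho> i))" using bnd by auto
  qed auto
  have "emeasure lborel U = (\<integral>\<^sup>+y. indicator U y \<partial>lborel)" by simp
  also have "\<dots> \<le> (\<integral>\<^sup>+y. \<integral>\<^sup>+i. indicator (ball i (5 * \<rho> i)) y \<partial>count_space C \<partial>lborel)"
  proof (rule nn_integral_mono)
    fix y :: real
    show "indicator U y \<le> (\<integral>\<^sup>+i. indicator (ball i (5 * \<rho> i)) y \<partial>count_space C)"
    proof (cases "y \<in> U")
      case True
      then obtain i where i: "i \<in> C" "y \<in> ball i (5 * \<rho> i)" using C by auto
      have "(1::ennreal) = (\<integral>\<^sup>+j. indicator {i} j \<partial>count_space C)"
        using i by (subst nn_integral_indicator) auto
      also have "\<dots> \<le> (\<integral>\<^sup>+j. indicator (ball j (5 * \<rho> j)) y \<partial>count_space C)"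
        using i by (intro nn_integral_mono) (auto simp: indicator_def)
      finally show ?thesis using True by simp
    qed simp
  qed
  also have "\<dots> = (\<integral>\<^sup>+i. emeasure lborel (ball i (5 * \<rho> i)) \<partial>count_space C)"
    using C by (subst nn_integral_count_space_nn_integral) auto
  also have "\<dots> = (\<integral>\<^sup>+i. 10 * ennreal (\<rho> i) \<partial>count_space C)"
    using \<rho> C by (intro nn_integral_cong)
      (auto simp: ball_eq_greaterThanLessThan ennreal_mult' less_imp_le subset_eq)
  finally have "ennreal l * emeasure lborel U \<le> ennreal l *
      (\<integral>\<^sup>+i. 10 * ennreal (\<rho> i) \<partial>count_space C)"
    by (intro mult_left_mono) auto
  also have "\<dots> = 10 * (\<integral>\<^sup>+i. ennreal (l * \<rho> i) \<partial>count_space C)"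
    using l by (simp add: nn_integral_cmult[symmetric] ennreal_mult' mult_ac)
  also have "\<dots> \<le> 10 * (\<integral>\<^sup>+i. (\<integral>\<^sup>+y. g y * indicator (ball i (\<rho> i)) y \<partial>lborel) \<partial>count_space C)"
    using \<rho> C by (intro mult_left_mono nn_integral_mono) (auto simp: less_imp_le subset_eq)
  also have "\<dots> = 10 * (\<integral>\<^sup>+y. (\<integral>\<^sup>+i. g y * indicator (ball i (\<rho> i)) y \<partial>count_space C) \<partial>lborel)"
    using C by (subst nn_integral_count_space_nn_integral) auto
  also have "\<dots> \<le> 10 * (\<integral>\<^sup>+y. g y \<partial>lborel)"
  proof (intro mult_left_mono nn_integral_mono)
    fix y :: real
    show "(\<integral>\<^sup>+i. g y * indicator (ball i (\<rho> i)) y \<partial>count_space C) \<le> g y"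
    proof (cases "\<exists>i\<in>C. y \<in> ball i (\<rho> i)")
      case True
      then obtain i where i: "i \<in> C" "y \<in> ball i (\<rho> i)" by auto
      have uniq: "j = i" if "j \<in> C" "y \<in> ball j (\<rho> j)" for j
        using C(3) i that by (auto simp: pairwise_def disjnt_iff)
      have "(\<integral>\<^sup>+j. g y * indicator (ball j (\<rho> j)) y \<partial>count_space C) =
          (\<integral>\<^sup>+j. g y * indicator {i} j \<partial>count_space C)"
      proof (rule nn_integral_cong)
        fix j assume "j \<in> space (count_space C)"
        then have "j \<in> C" by simp
        then have "y \<in> ball j (\<rho> j) \<longleftrightarrow> j \<in> {i}"
          unfolding singleton_iff using i(2) by (metis uniq)
        then show "g y * indicator (ball j (\<rho> j)) y = g y * indicator {i} j"
          by (simp add: indicator_def)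
      qed
      also have "\<dots> = g y"
        using i by (subst nn_integral_cmult_indicator) auto
      finally show ?thesis by simp
    next
      case False
      then have "(\<integral>\<^sup>+j. g y * indicator (ball j (\<rho> j)) y \<partial>count_space C) = (\<integral>\<^sup>+j. 0 \<partial>count_space C)"
        by (intro nn_integral_cong) (auto simp: indicator_def)
      then show ?thesis by simp
    qed
  qed auto
  finally show ?thesis .
qed

text \<open>The part of \<open>G\<close>^t below \<open>L\<close> contributes at most
  \<open>4 * L\<close> to a \<open>kern\<close>-average, 4 being the mass of \<open>kern\<close>. If
  all averages of the part \<open>H\<close> above \<open>L\<close> were small, it would contribute
  at most another \<open>4 * L\<close>. Together this gives at most \<open>8 * A * L\<close>, which
  is l^t, a contradiction where \<open>g k x > l\<close>. Only \<open>H\<close> then enters the weak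
  type bound, and this truncation makes the later sum over levels converge.\<close>

lemma emeasure_nbhd_level_le:
  fixes g :: "nat \<Rightarrow> real \<Rightarrow> ennreal"
  assumes [measurable]: "\<And>k. g k \<in> borel_measurable borel" "G \<in> borel_measurable borel"
    and le: "\<And>k x. g k x \<le> G x" and t: "0 < t" and A: "0 < A" and l: "0 < l"
    and sub: "\<And>k x. ennpow (g k x) t \<le> ennreal A *
        (\<integral>\<^sup>+y. ennpow (g k (x - y * 2 powr - real k)) t \<partial>kmeas)"
  defines "L \<equiv> l powr t / (8 * A)"
  shows "ennreal L * emeasure lborel (nbhd (\<lambda>k. {x. ennreal l < g k x}))
    \<le> 10 * (\<integral>\<^sup>+y. ennpow (G y) t * indicator {y. ennreal L < ennpow (G y) t} y \<partial>lborel)"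
proof -
  define H where "H y = ennpow (G y) t * indicator {y. ennreal L < ennpow (G y) t} y" for y
  have [measurable]: "H \<in> borel_measurable borel" unfolding H_def by measurable
  have [measurable]: "ball x a \<in> sets (borel :: real measure)" for x a :: real by simp
  have L: "0 < L" using l A by (simp add: L_def)
  have avg: "\<exists>\<rho>>0. ennreal (L * \<rho>) < (\<integral>\<^sup>+y. H y * indicator (ball z \<rho>) y \<partial>lborel)"
    if "z \<in> nbhd (\<lambda>k. {x. ennreal l < g k x})" for z
  proof -
  from that obtain k x where x: "ennreal l < g k x" and z: "dist x z < 2 powr - real k"
    by (auto simp: nbhd_def)
  define h where "h = 2 powr - real k"
  have h: "0 < h" by (simp add: h_def)
  have "\<exists>a::nat. ennreal (2 * 2 ^ a * L) < (\<integral>\<^sup>+y. H (x - y * h) * indicator (ball 0 (2 ^ a)) y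
      \<partial>lborel)"
  proof (rule ccontr)
    assume "\<not> ?thesis"
    then have small: "(\<integral>\<^sup>+y. H (x - y * h) * indicator (ball 0 (2 ^ a)) y \<partial>lborel) \<le> ennreal
        (2 * 2 ^ a * L)" for a :: nat
      by (auto simp: not_less)
    have "(\<integral>\<^sup>+y. H (x - y * h) \<partial>kmeas) \<le> (\<Sum>a. ennreal ((1/4) ^ a) * ennreal (2 * 2 ^ a * L))"
      by (subst nn_integral_kmeas) (auto intro!: suminf_le mult_left_mono small)
    also have "\<dots> = (\<Sum>a. ennreal (2 * L * (1/2) ^ a))"
    proof -
      have "ennreal ((1/4) ^ a) * ennreal (2 * 2 ^ a * L) = ennreal (2 * L * (1/2) ^ a)" for a
      proof -
        have *: "(1/4) ^ a * (2 * 2 ^ a * L) = 2 * L * (1/2) ^ a"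
          using power_mult_distrib[of "1/4" "2::real" a] by simp
        show ?thesis unfolding *[symmetric] using L by (subst ennreal_mult) auto
      qed
      then show ?thesis by (simp only:)
    qed
    also have "\<dots> = ennreal (4 * L)" using L by (subst suminf_powr_le) auto
    finally have H: "(\<integral>\<^sup>+y. H (x - y * h) \<partial>kmeas) \<le> ennreal (4 * L)" .
    have "ennreal (l powr t) = ennpow (ennreal l) t" using l by (simp add: ennpow_ennreal)
    also have "\<dots> < ennpow (g k x) t" using x t by (simp add: ennpow_less_iff)
    also have "\<dots> \<le> ennreal A * (\<integral>\<^sup>+y. ennpow (g k (x - y * h)) t \<partial>kmeas)"
      using sub[of k x] by (simp add: h_def)
    also have "\<dots> \<le> ennreal A * (\<integral>\<^sup>+y. ennreal L + H (x - y * h) \<partial>kmeas)"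
    proof (intro mult_left_mono nn_integral_mono)
      fix y
      have "ennpow (g k (x - y * h)) t \<le> ennpow (G (x - y * h)) t"
        using le t by (intro ennpow_mono) auto
      also have "\<dots> \<le> ennreal L + H (x - y * h)"
        by (cases "ennreal L < ennpow (G (x - y * h)) t") (auto simp: H_def not_less)
      finally show "ennpow (g k (x - y * h)) t \<le> ennreal L + H (x - y * h)" .
    qed auto
    also have "\<dots> = ennreal A * (ennreal L * 4 + (\<integral>\<^sup>+y. H (x - y * h) \<partial>kmeas))"
      using emeasure_kmeas_UNIV by (subst nn_integral_add) (auto simp: kmeas_def)
    also have "\<dots> \<le> ennreal A * (ennreal L * 4 + ennreal (4 * L))"
      using H by (intro mult_left_mono add_left_mono) auto
    also have "\<dots> = ennreal (l powr t)"
    proof -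
      have "ennreal L * 4 = ennreal (L * 4)" using L by (simp add: ennreal_mult')
      moreover have "A * (L * 4 + 4 * L) = l powr t" using A by (simp add: L_def)
      ultimately show ?thesis using L A by (simp flip: ennreal_mult ennreal_plus)
    qed
    finally show False by simp
  qed
  then obtain a :: nat where a: "ennreal (2 * 2 ^ a * L) <
      (\<integral>\<^sup>+y. H (x - y * h) * indicator (ball 0 (2 ^ a)) y \<partial>lborel)"
    by blast
  \<comment> \<open>The average was found at \<open>x\<close>, but the covering needs it at the
    nearby point \<open>z\<close>. As |x - z| < h \<le> 2^a h, doubling the radius suffices.\<close>
  define \<rho> where "\<rho> = 2 * 2 ^ a * h"
  have "ennreal (L * \<rho>) = ennreal h * ennreal (2 * 2 ^ a * L)"
    using h L by (simp add: \<rho>_def mult_ac flip: ennreal_mult)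
  also have "\<dots> < ennreal h * (\<integral>\<^sup>+y. H (x - y * h) * indicator (ball 0 (2 ^ a)) y \<partial>lborel)"
    using a h by (intro ennreal_mult_strict_left_mono) auto
  also have "\<dots> \<le> ennreal h * (\<integral>\<^sup>+y. H (x - y * h) * indicator (ball z \<rho>) (x - y * h) \<partial>lborel)"
  proof (rule mult_left_mono, rule nn_integral_mono)
    fix y :: real
    have "x - y * h \<in> ball z \<rho>" if "y \<in> ball 0 (2 ^ a)"
    proof -
      have "\<bar>y\<bar> * h < 2 ^ a * h" using that h by auto
      moreover have "h \<le> 2 ^ a * h" using h by simp
      moreover have "\<bar>z - (x - y * h)\<bar> \<le> \<bar>x - z\<bar> + \<bar>y\<bar> * h"
        using h abs_triangle_ineq[of "z - x" "y * h"]
            by (simp add: abs_mult abs_minus_commute algebra_simps)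
      ultimately show ?thesis using z unfolding \<rho>_def h_def[symmetric] by (simp add: dist_real_def)
    qed
    then show "H (x - y * h) * indicator (ball 0 (2 ^ a)) y \<le> H (x - y * h) * indicator (ball z \<rho>)
        (x - y * h)"
      by (auto simp: indicator_def)
  qed auto
  also have "\<dots> = (\<integral>\<^sup>+y. H y * indicator (ball z \<rho>) y \<partial>lborel)"
    using h by (subst nn_integral_real_affine[of "\<lambda>y. H y * indicator (ball z \<rho>) y" "- h" x])
      (auto simp: mult.commute)
  finally show ?thesis
    using h by (intro exI[of _ \<rho>]) (auto simp: \<rho>_def)
  qed
  show ?thesis
    using weak_type_averages[OF _ _ L avg] by (simp add: H_def)
qed

text \<open>For finite x > 0 the single layer 2^u < x \<le> 2^(u+1) already suffices, which costs
  2^a; for infinite x the layers are unbounded.\<close>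

lemma layer_ennpow_le:
  assumes a: "0 < a"
  shows "ennpow x a \<le> ennreal (2 powr a) *
    (\<integral>\<^sup>+u. ennreal (2 powr (real_of_int u * a)) * indicator {x. ennreal (2 powr real_of_int u) < x} x
        \<partial>count_space UNIV)"
    (is "_ \<le> _ * ?S")
proof -
  have layer: "ennreal (2 powr (real_of_int u * a)) \<le> ?S" if "ennreal (2 powr real_of_int u) < x"
      for u
    using nrm_count_space_ge[of 1 "\<lambda>u. ennreal (2 powr (real_of_int u * a)) * indicator {x. ennreal
        (2 powr real_of_int u) < x} x" u] that
    by (simp add: nrm_def)
  show ?thesis
  proof (cases x)
    case top
    have "?S = top"
    proof (rule ccontr)
      assume "?S \<noteq> top"
      then obtain B where B: "?S = ennreal B" "0 \<le> B" by (cases ?S) auto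
      define u where "u = \<lceil>log 2 (B + 1) / a\<rceil>"
      have "log 2 (B + 1) \<le> real_of_int u * a"
        using a le_of_int_ceiling[of "log 2 (B + 1) / a"] unfolding u_def
            by (subst (asm) pos_divide_le_eq)
      then have "B + 1 \<le> 2 powr (real_of_int u * a)"
        using B by (simp add: log_le_iff)
      then have "ennreal (B + 1) \<le> ennreal (2 powr (real_of_int u * a))" by (intro ennreal_leI)
      also have "\<dots> \<le> ?S" using top by (intro layer) simp
      finally show False using B by simp
    qed
    then show ?thesis by (simp add: ennreal_mult_top)
  next
    case (real y)
    show ?thesis
    proof (cases "y = 0")
      case False
      then have y: "0 < y" using real by simp
      define u where "u = \<lceil>log 2 y\<rceil> - 1"
      have 1: "real_of_int u < log 2 y" "log 2 y \<le> real_of_int u + 1" by (auto simp: u_def) linarith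
      then have 2: "2 powr real_of_int u < y" "y \<le> 2 powr (real_of_int u + 1)"
        using y by (auto simp: less_log_iff log_le_iff)
      have "ennpow x a = ennreal (y powr a)" using real by (simp add: ennpow_ennreal)
      also have "\<dots> \<le> ennreal ((2 powr (real_of_int u + 1)) powr a)"
        using 2 y a by (intro ennreal_leI powr_mono2) auto
      also have "\<dots> = ennreal (2 powr a) * ennreal (2 powr (real_of_int u * a))"
        by (simp add: powr_powr algebra_simps flip: powr_add ennreal_mult)
      also have "\<dots> \<le> ennreal (2 powr a) * ?S"
        using real 2 by (intro mult_left_mono layer) (auto simp: ennreal_less_iff)
      finally show ?thesis .
    qed (use real in simp)
  qed
qed

text \<open>The q-th power of the left side is a sum over k and j of r-th powers of integrals, r = q
  / p. Cutting the functions into dyadic levels u and using r < 1 moves the r-th power onto measures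
  of level sets. At a fixed level these are summable over k and j, and the weak type bound leads
  back to \<open>G\<close>.\<close>

lemma Herz_jawerth_franke:
  assumes t: "0 < t" "t < q" "q < p" and A: "0 < A"
  obtains C :: real where "0 < C" and
    "\<And>g G. \<lbrakk>\<And>k. g k \<in> borel_measurable borel; G \<in> borel_measurable borel; \<And>k x. g k x \<le> G x;
        \<And>k x. ennpow (g k x) t \<le> ennreal A * (\<integral>\<^sup>+y. ennpow (g k (x - y * 2 powr - real k)) t \<partial>kmeas)\<rbrakk>
            \<Longrightarrow>
      lq_norm (ennreal q) (\<lambda>k. ennreal (2 powr (real k * (1 / p - 1 / q))) * Herz_norm 0 (ennreal p)
          (ennreal q) (g k))
      \<le> ennreal C * Lp_norm (ennreal q) G"
proof -
  define r where "r = q / p"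
  have r: "0 < r" "r < 1" using t by (auto simp: r_def)
  have pq: "0 < p" "0 < q" using t by auto
  define K1 where "K1 = 2 / (1 - 2 powr (r - 1)) + 2 / (1 - 2 powr - r)"
  have K1: "0 < K1"
    using r two_powr_less_one[of "r - 1"] two_powr_less_one[of "- r"]
        by (auto simp: K1_def intro!: add_pos_pos)
  \<comment> \<open>Chosen so that 1 + s = q / t: one power of V = \<open>G\<close>^t comes from the
    weak type bound, the other \<open>s\<close> from the sum over levels.\<close>
  define s where "s = (q - t) / t"
  have s: "0 < s" using t by (simp add: s_def)
  define K2 where "K2 = (8 * A) powr s / (1 - 2 powr - (q - t))"
  have K2: "0 < K2" using A t two_powr_less_one[of "- (q - t)"] by (simp add: K2_def)
  \<comment> \<open>The factors stem from the dyadic layers, the sum over k and j, the weak type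
    bound (10 times \<open>8 * A\<close>), and the final sum over levels.\<close>
  define D where "D = 2 powr q * K1 * (80 * A) * K2"
  have D: "0 < D" using K1 K2 A by (simp add: D_def)
  show thesis
  proof (rule that[of "D powr (1 / q)"])
    show "0 < D powr (1 / q)" using D by simp
    fix g :: "nat \<Rightarrow> real \<Rightarrow> ennreal" and G
    assume [measurable]: "\<And>k. g k \<in> borel_measurable borel" "G \<in> borel_measurable borel"
      and le: "\<And>k x. g k x \<le> G x"
      and sub: "\<And>k x. ennpow (g k x) t \<le> ennreal A *
          (\<integral>\<^sup>+y. ennpow (g k (x - y * 2 powr - real k)) t \<partial>kmeas)"
    define E where "E u k = {x. ennreal (2 powr real_of_int u) < g k x}" for u :: int and k
    have [measurable]: "E u k \<in> sets borel" for u k unfolding E_def by measurable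
    define X where "X k j = (\<integral>\<^sup>+x. ennpow (g k x) p * indicator (annulus j) x \<partial>lborel)" for k j
    define \<mu> where "\<mu> u k j = emeasure lborel (E u k \<inter> annulus j)" for u k j
    have X: "ennpow (X k j) r \<le> ennreal (2 powr q) *
        (\<integral>\<^sup>+u. ennreal (2 powr (real_of_int u * q)) * ennpow (\<mu> u k j) r \<partial>count_space UNIV)" for k j
    proof -
      have "X k j \<le> (\<integral>\<^sup>+x. ennreal (2 powr p) *
          (\<integral>\<^sup>+u. ennreal (2 powr (real_of_int u * p)) * indicator (E u k \<inter> annulus j) x \<partial>count_space
          UNIV) \<partial>lborel)"
        unfolding X_def
      proof (rule nn_integral_mono)
        fix x
        show "ennpow (g k x) p * indicator (annulus j) x \<le> ennreal (2 powr p) *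
            (\<integral>\<^sup>+u. ennreal (2 powr (real_of_int u * p)) * indicator (E u k \<inter> annulus j) x
            \<partial>count_space UNIV)"
        proof (cases "x \<in> annulus j")
          case True
          then have "indicator (E u k \<inter> annulus j) x =
              (indicator {y. ennreal (2 powr real_of_int u) < y} (g k x) :: ennreal)" for u
            by (auto simp: E_def indicator_def)
          then show ?thesis using True layer_ennpow_le[of p "g k x"] pq by simp
        qed simp
      qed
      also have "\<dots> = (\<integral>\<^sup>+x. \<integral>\<^sup>+u. ennreal (2 powr p) *
          (ennreal (2 powr (real_of_int u * p)) * indicator (E u k \<inter> annulus j) x) \<partial>count_space UNIV
          \<partial>lborel)"
        by (simp add: nn_integral_cmult)
      also have "\<dots> = (\<integral>\<^sup>+u. \<integral>\<^sup>+x. ennreal (2 powr p) *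
          (ennreal (2 powr (real_of_int u * p)) * indicator (E u k \<inter> annulus j) x) \<partial>lborel
          \<partial>count_space UNIV)"
        by (subst nn_integral_count_space_nn_integral) auto
      also have "\<dots> = ennreal (2 powr p) * (\<integral>\<^sup>+u. ennreal (2 powr (real_of_int u * p)) * \<mu> u k j
          \<partial>count_space UNIV)"
        by (simp add: nn_integral_cmult \<mu>_def)
      finally have "ennpow (X k j) r \<le> ennpow \<dots> r" using r by (intro ennpow_mono) auto
      also have "\<dots> = ennreal (2 powr q) * ennpow
          (\<integral>\<^sup>+u. ennreal (2 powr (real_of_int u * p)) * \<mu> u k j \<partial>count_space UNIV) r"
        using r pq by (simp add: ennpow_mult ennpow_ennreal powr_powr r_def)
      also have "\<dots> \<le> ennreal (2 powr q) * (\<integral>\<^sup>+u. ennpow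
          (ennreal (2 powr (real_of_int u * p)) * \<mu> u k j) r \<partial>count_space UNIV)"
        using r by (intro mult_left_mono ennpow_nn_integral_count_space_le) auto
      also have "\<dots> = ennreal (2 powr q) * (\<integral>\<^sup>+u. ennreal (2 powr (real_of_int u * q)) * ennpow
          (\<mu> u k j) r \<partial>count_space UNIV)"
        using r pq by (simp add: ennpow_mult ennpow_ennreal powr_powr r_def)
      finally show ?thesis .
    qed
    define V where "V y = ennpow (G y) t" for y
    have [measurable]: "V \<in> borel_measurable borel" unfolding V_def by measurable
    define L where "L u = (2 powr real_of_int u) powr t / (8 * A)" for u :: int
    have L: "0 < L u" for u using A by (simp add: L_def)
    have nb: "emeasure lborel (nbhd (E u)) \<le> ennreal (80 * A * 2 powr - (real_of_int u * t)) *
        (\<integral>\<^sup>+y. V y * indicator {y. ennreal (L u) < V y} y \<partial>lborel)" for u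
    proof -
      have "ennreal (L u) * emeasure lborel (nbhd (E u)) \<le> 10 *
          (\<integral>\<^sup>+y. V y * indicator {y. ennreal (L u) < V y} y \<partial>lborel)"
        unfolding E_def L_def V_def using t A le sub by (intro emeasure_nbhd_level_le) auto
      then have "ennreal (1 / L u) * (ennreal (L u) * emeasure lborel (nbhd (E u)))
          \<le> ennreal (1 / L u) * (10 * (\<integral>\<^sup>+y. V y * indicator {y. ennreal (L u) < V y} y \<partial>lborel))"
        by (rule mult_left_mono) auto
      moreover have "ennreal (1 / L u) * (ennreal (L u) * e) = e" for e
        using L[of u] by (simp add: mult.assoc[symmetric] flip: ennreal_mult)
      moreover have "ennreal (1 / L u) * (10 * e) = ennreal (80 * A * 2 powr - (real_of_int u * t))
          * e" for e
      proof -
        have e: "80 * A * 2 powr - (real_of_int u * t) = 1 / L u * 10"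
          using A by (simp add: L_def powr_powr powr_minus field_simps)
        have "ennreal (80 * A * 2 powr - (real_of_int u * t)) = ennreal (1 / L u) * 10"
          unfolding e using L[of u] by (subst ennreal_mult) auto
        then show ?thesis by (simp add: mult.assoc)
      qed
      ultimately show ?thesis by simp
    qed
    have "(\<integral>\<^sup>+k. \<integral>\<^sup>+j. ennreal (2 powr (real k * (r - 1))) * ennpow (X k j) r \<partial>count_space UNIV
        \<partial>count_space UNIV)
      \<le> (\<integral>\<^sup>+k. \<integral>\<^sup>+j. ennreal (2 powr (real k * (r - 1))) *
          (ennreal (2 powr q) * (\<integral>\<^sup>+u. ennreal (2 powr (real_of_int u * q)) * ennpow (\<mu> u k j) r
          \<partial>count_space UNIV)) \<partial>count_space UNIV \<partial>count_space UNIV)"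
      by (rule nn_integral_mono, rule nn_integral_mono, rule mult_left_mono, rule X) auto
    also have "\<dots> = ennreal (2 powr q) * (\<integral>\<^sup>+k. \<integral>\<^sup>+j. \<integral>\<^sup>+u. ennreal (2 powr (real_of_int u * q)) *
        (ennreal (2 powr (real k * (r - 1))) * ennpow (\<mu> u k j) r) \<partial>count_space UNIV \<partial>count_space
        UNIV \<partial>count_space UNIV)"
      by (simp add: nn_integral_cmult[symmetric] mult_ac)
    \<comment> \<open>The level u is brought outside because \<open>emeasure_level_sum_le\<close>
      concerns the level sets of one fixed u.\<close>
    also have "\<dots> = ennreal (2 powr q) * (\<integral>\<^sup>+u. ennreal (2 powr (real_of_int u * q)) *
        (\<integral>\<^sup>+k. \<integral>\<^sup>+j. ennreal (2 powr (real k * (r - 1))) * ennpow (\<mu> u k j) r \<partial>count_space UNIV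
        \<partial>count_space UNIV) \<partial>count_space UNIV)"
    proof (rule arg_cong[where f = "\<lambda>x. _ * x"])
      let ?f = "\<lambda>u k j. ennreal (2 powr (real_of_int u * q)) *
          (ennreal (2 powr (real k * (r - 1))) * ennpow (\<mu> u k j) r)"
      have "(\<integral>\<^sup>+k. \<integral>\<^sup>+j. \<integral>\<^sup>+u. ?f u k j \<partial>count_space UNIV \<partial>count_space UNIV \<partial>count_space UNIV)
          = (\<integral>\<^sup>+k. \<integral>\<^sup>+u. \<integral>\<^sup>+j. ?f u k j \<partial>count_space UNIV \<partial>count_space UNIV \<partial>count_space UNIV)"
        by (rule nn_integral_cong, rule count_space_swap)
      also have "\<dots> = (\<integral>\<^sup>+u. \<integral>\<^sup>+k. \<integral>\<^sup>+j. ?f u k j \<partial>count_space UNIV \<partial>count_space UNIV \<partial>count_space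
          UNIV)"
        by (rule count_space_swap)
      also have "\<dots> = (\<integral>\<^sup>+u. ennreal (2 powr (real_of_int u * q)) *
          (\<integral>\<^sup>+k. \<integral>\<^sup>+j. ennreal (2 powr (real k * (r - 1))) * ennpow (\<mu> u k j) r \<partial>count_space UNIV
          \<partial>count_space UNIV) \<partial>count_space UNIV)"
        by (simp add: nn_integral_cmult)
      finally show "(\<integral>\<^sup>+k. \<integral>\<^sup>+j. \<integral>\<^sup>+u. ?f u k j \<partial>count_space UNIV \<partial>count_space UNIV \<partial>count_space UNIV)
          = \<dots>" .
    qed
    also have "\<dots> \<le> ennreal (2 powr q) * (\<integral>\<^sup>+u. ennreal (2 powr (real_of_int u * q)) *
        (ennreal K1 * (ennreal (80 * A * 2 powr - (real_of_int u * t)) *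
        (\<integral>\<^sup>+y. V y * indicator {y. ennreal (L u) < V y} y \<partial>lborel))) \<partial>count_space UNIV)"
    proof (rule mult_left_mono, rule nn_integral_mono, rule mult_left_mono)
      fix u :: int
      have "(\<integral>\<^sup>+k. \<integral>\<^sup>+j. ennreal (2 powr (real k * (r - 1))) * ennpow (\<mu> u k j) r \<partial>count_space UNIV
          \<partial>count_space UNIV)
          \<le> ennreal K1 * emeasure lborel (nbhd (E u))"
        unfolding \<mu>_def K1_def by (intro emeasure_level_sum_le r) auto
      also have "\<dots> \<le> ennreal K1 * (ennreal (80 * A * 2 powr - (real_of_int u * t)) *
          (\<integral>\<^sup>+y. V y * indicator {y. ennreal (L u) < V y} y \<partial>lborel))"
        by (rule mult_left_mono, rule nb) auto
      finally show "(\<integral>\<^sup>+k. \<integral>\<^sup>+j. ennreal (2 powr (real k * (r - 1))) * ennpow (\<mu> u k j) r \<partial>count_space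
          UNIV \<partial>count_space UNIV) \<le> \<dots>" .
    qed auto
    also have "\<dots> = ennreal (2 powr q) * (\<integral>\<^sup>+u. ennreal (K1 * (80 * A)) *
        (\<integral>\<^sup>+y. ennreal (2 powr (real_of_int u * (q - t))) *
        (V y * indicator {y. ennreal (L u) < V y} y) \<partial>lborel) \<partial>count_space UNIV)"
    proof (rule arg_cong[where f = "\<lambda>x. _ * x"], rule nn_integral_cong)
      fix u :: int
      have "2 powr (real_of_int u * q) * (K1 * (80 * A * 2 powr - (real_of_int u * t))) = K1 *
          (80 * A) * 2 powr (real_of_int u * (q - t))"
      proof -
        have e: "2 powr (real_of_int u * (q - t)) = 2 powr (real_of_int u * q) * 2 powr -
            (real_of_int u * t)"
          by (simp add: algebra_simps flip: powr_add)
        show ?thesis unfolding e by (simp only: mult_ac)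
      qed
      then have "ennreal (2 powr (real_of_int u * q)) *
          (ennreal K1 * ennreal (80 * A * 2 powr - (real_of_int u * t))) = ennreal (K1 * (80 * A)) *
          ennreal (2 powr (real_of_int u * (q - t)))"
        using K1 A by (simp flip: ennreal_mult)
      then show "ennreal (2 powr (real_of_int u * q)) *
          (ennreal K1 * (ennreal (80 * A * 2 powr - (real_of_int u * t)) *
          (\<integral>\<^sup>+y. V y * indicator {y. ennreal (L u) < V y} y \<partial>lborel)))
        = ennreal (K1 * (80 * A)) * (\<integral>\<^sup>+y. ennreal (2 powr (real_of_int u * (q - t))) *
            (V y * indicator {y. ennreal (L u) < V y} y) \<partial>lborel)"
        by (subst nn_integral_cmult) (auto simp: mult.assoc[symmetric])
    qed
    also have "\<dots> = ennreal (2 powr q) * (ennreal (K1 * (80 * A)) *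
        (\<integral>\<^sup>+y. \<integral>\<^sup>+u. ennreal (2 powr (real_of_int u * (q - t))) *
        (V y * indicator {y. ennreal (L u) < V y} y) \<partial>count_space UNIV \<partial>lborel))"
      by (subst nn_integral_count_space_nn_integral) (auto simp: nn_integral_cmult)
    also have "\<dots> \<le> ennreal (2 powr q) * (ennreal (K1 * (80 * A)) *
        (\<integral>\<^sup>+y. ennreal K2 * ennpow (G y) q \<partial>lborel))"
    proof (rule mult_left_mono, rule mult_left_mono, rule nn_integral_mono)
      fix y
      show "(\<integral>\<^sup>+u. ennreal (2 powr (real_of_int u * (q - t))) *
          (V y * indicator {y. ennreal (L u) < V y} y) \<partial>count_space UNIV) \<le> ennreal K2 * ennpow
          (G y) q"
      proof (cases "V y")
        case top
        then have "G y = top" by (simp add: V_def)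
        then show ?thesis using K2 by (simp add: ennreal_mult_top)
      next
        case (real v)
        \<comment> \<open>\<open>L u < v\<close> means 2^u < (8 A v)^(1/t), so the levels present at
          \<open>y\<close> form a dyadic sum with cut-off \<open>M\<close>. It has the exponent q -
          t, positive by the choice of t.\<close>
        define M where "M = (8 * A * v) powr (1 / t)"
        have "(\<integral>\<^sup>+u. ennreal (2 powr (real_of_int u * (q - t))) *
            (V y * indicator {y. ennreal (L u) < V y} y) \<partial>count_space UNIV)
          \<le> (\<integral>\<^sup>+u. ennreal v * (if 2 powr real_of_int u \<le> M then ennreal
              (2 powr (real_of_int u * (q - t))) else 0) \<partial>count_space UNIV)"
        proof (rule nn_integral_mono)
          fix u :: int
          have "2 powr real_of_int u \<le> M" if "ennreal (L u) < V y"
          proof -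
            have "L u < v" using that real L[of u] by (simp add: ennreal_less_iff)
            then have "(2 powr real_of_int u) powr t \<le> 8 * A * v"
              using A by (simp add: L_def field_simps)
            then have "((2 powr real_of_int u) powr t) powr (1 / t) \<le> M"
              unfolding M_def using t by (intro powr_mono2) auto
            then show ?thesis using t by (simp add: powr_powr)
          qed
          then show "ennreal (2 powr (real_of_int u * (q - t))) *
              (V y * indicator {y. ennreal (L u) < V y} y)
            \<le> ennreal v * (if 2 powr real_of_int u \<le> M then ennreal
                (2 powr (real_of_int u * (q - t))) else 0)"
            using real by (auto simp: indicator_def mult.commute)
        qed
        also have "\<dots> = ennreal v * (\<integral>\<^sup>+u. (if 2 powr real_of_int u \<le> M then ennreal
            (2 powr (real_of_int u * (q - t))) else 0) \<partial>count_space UNIV)"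
          by (intro nn_integral_cmult) auto
        also have "\<dots> \<le> ennreal v * ennreal (M powr (q - t) / (1 - 2 powr - (q - t)))"
          using t by (intro mult_left_mono nn_integral_dyadic_le) (auto simp: M_def)
        also have "\<dots> = ennreal (K2 * (v * v powr s))"
        proof -
          have "M powr (q - t) = (8 * A) powr s * v powr s"
            using t A real by (simp add: M_def powr_powr powr_mult s_def)
          then show ?thesis
            using real two_powr_less_one[of "- (q - t)"] t
                by (simp add: K2_def mult_ac flip: ennreal_mult)
        qed
        also have "v * v powr s = v powr (q / t)"
          using real t powr_mult_base[of v s] by (simp add: s_def diff_divide_distrib)
        also have "ennreal (K2 * v powr (q / t)) = ennreal K2 * ennpow (V y) (q / t)"
          using real K2 by (simp add: ennpow_ennreal ennreal_mult)
        also have "\<dots> = ennreal K2 * ennpow (G y) q" using t by (simp add: V_def ennpow_ennpow)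
        finally show ?thesis .
      qed
    qed auto
    also have "\<dots> = ennreal D * (\<integral>\<^sup>+y. ennpow (G y) q \<partial>lborel)"
      using K1 K2 A by (simp add: D_def nn_integral_cmult ennreal_mult mult_ac)
    finally have main: "(\<integral>\<^sup>+k. \<integral>\<^sup>+j. ennreal (2 powr (real k * (r - 1))) * ennpow (X k j) r
        \<partial>count_space UNIV \<partial>count_space UNIV)
        \<le> ennreal D * (\<integral>\<^sup>+y. ennpow (G y) q \<partial>lborel)" .
    have Lp: "ennpow (nrm lborel p (\<lambda>t. g k t * indicator (annulus j) t)) q = ennpow (X k j) r" for
        k j
    proof -
      have "ennpow (g k t * indicator (annulus j) t) p = ennpow (g k t) p * indicator (annulus j) t"
          for t
        by (simp add: indicator_def)
      then show ?thesis using pq by (simp add: nrm_def X_def ennpow_ennpow r_def)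
    qed
    have "ennpow (lq_norm (ennreal q) (\<lambda>k. ennreal (2 powr (real k * (1 / p - 1 / q))) * Herz_norm 0
        (ennreal p) (ennreal q) (g k))) q
        = (\<integral>\<^sup>+k. ennpow (ennreal (2 powr (real k * (1 / p - 1 / q)))) q *
            (\<integral>\<^sup>+j. ennpow (X k j) r \<partial>count_space UNIV) \<partial>count_space UNIV)"
      using pq by (simp add: lq_norm_eq_nrm Herz_norm_eq_nrm ennpow_nrm ennpow_mult Lp)
    also have "\<dots> = (\<integral>\<^sup>+k. \<integral>\<^sup>+j. ennreal (2 powr (real k * (r - 1))) * ennpow (X k j) r \<partial>count_space
        UNIV \<partial>count_space UNIV)"
    proof (rule nn_integral_cong)
      fix k :: nat
      \<comment> \<open>The weight demanded by the level set estimate is exactly the q-th power of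
        the weight 2^(k (1/p - 1/q)), which fixes the shift in smoothness.\<close>
      have "real k * (1 / p - 1 / q) * q = real k * (r - 1)" using pq
          by (simp add: r_def field_simps)
      then have "ennpow (ennreal (2 powr (real k * (1 / p - 1 / q)))) q = ennreal
          (2 powr (real k * (r - 1)))"
        by (simp only: ennpow_ennreal powr_ge_zero powr_powr)
      then show "ennpow (ennreal (2 powr (real k * (1 / p - 1 / q)))) q *
          (\<integral>\<^sup>+j. ennpow (X k j) r \<partial>count_space UNIV)
        = (\<integral>\<^sup>+j. ennreal (2 powr (real k * (r - 1))) * ennpow (X k j) r \<partial>count_space UNIV)"
        by (simp add: nn_integral_cmult)
    qed
    also have "\<dots> \<le> ennreal D * (\<integral>\<^sup>+y. ennpow (G y) q \<partial>lborel)" by (rule main)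
    also have "\<dots> = ennpow (ennreal (D powr (1 / q)) * Lp_norm (ennreal q) G) q"
      using pq D by (simp add: ennpow_mult ennpow_ennreal powr_powr Lp_norm_eq_nrm ennpow_nrm)
    finally show "lq_norm (ennreal q) (\<lambda>k. ennreal (2 powr (real k * (1 / p - 1 / q))) * Herz_norm 0
        (ennreal p) (ennreal q) (g k))
      \<le> ennreal (D powr (1 / q)) * Lp_norm (ennreal q) G"
      using pq by (simp add: ennpow_le_iff)
  qed
qed

section \<open>Iterating over the coordinates\<close>

lemma coord_upd_eq: "coord_upd x i t = x + (t - x $ i) *\<^sub>R axis i 1"
  by (simp add: coord_upd_def vec_eq_iff axis_def)

lemma measurable_coord_upd [measurable]:
  assumes [measurable]: "f \<in> borel_measurable M" "h \<in> borel_measurable M"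
  shows "(\<lambda>z. coord_upd (f z) i (h z)) \<in> borel_measurable M"
  unfolding coord_upd_eq cart_eq_inner_axis by measurable

lemma coord_upd_minus_axis_same: "coord_upd x i t - c *\<^sub>R axis i 1 = coord_upd x i (t - c)"
  by (simp add: coord_upd_def vec_eq_iff axis_def)

lemma coord_upd_minus_axis_other:
  "i \<noteq> j \<Longrightarrow> coord_upd x i t - c *\<^sub>R axis j 1 = coord_upd (x - c *\<^sub>R axis j 1) i t"
  by (simp add: coord_upd_def vec_eq_iff axis_def)

context
  fixes g :: "real ^ 'n::finite \<Rightarrow> ennreal" and p q :: real
  assumes g [measurable]: "g \<in> borel_measurable borel" and pq: "0 < p" "0 < q"
begin

lemma measurable_Lp_coord_upd:
  "(\<lambda>x. Lp_norm (ennreal p) (\<lambda>t. g (coord_upd x i t))) \<in> borel_measurable borel"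
  using pq by (simp add: Lp_norm_eq_nrm nrm_def)

lemma measurable_Herz_coord_upd:
  "(\<lambda>x. Herz_norm 0 (ennreal p) (ennreal q) (\<lambda>t. g (coord_upd x i t))) \<in> borel_measurable borel"
proof -
  have [measurable]: "(\<lambda>x. nrm lborel p (\<lambda>t. g (coord_upd x i t) * indicator (annulus j) t)) \<in>
      borel_measurable borel" for j
    by (simp add: nrm_def)
  have "(\<lambda>x. \<integral>\<^sup>+j. ennpow (nrm lborel p (\<lambda>t. g (coord_upd x i t) * indicator (annulus j) t)) q
      \<partial>count_space UNIV) \<in> borel_measurable borel"
  proof (rule sigma_finite_measure.borel_measurable_nn_integral)
    show "sigma_finite_measure (count_space (UNIV :: int set))"
      by (rule sigma_finite_measure_count_space_countable) simp
    show "(\<lambda>(x, j). ennpow (nrm lborel p (\<lambda>t. g (coord_upd x i t) * indicator (annulus j) t)) q)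
        \<in> borel_measurable (borel \<Otimes>\<^sub>M count_space UNIV)"
      by (subst measurable_pair_swap_iff, rule measurable_pair_measure_countable1) auto
  qed
  then show ?thesis using pq by (simp add: Herz_norm_eq_nrm nrm_def[of "count_space UNIV"])
qed

lemma Lp_coord_upd_cmult:
  "Lp_norm (ennreal p) (\<lambda>t. c * g (coord_upd x i t)) = c * Lp_norm (ennreal p)
      (\<lambda>t. g (coord_upd x i t))"
  using pq by (simp add: Lp_norm_eq_nrm nrm_cmult)

lemma Herz_coord_upd_cmult:
  "Herz_norm 0 (ennreal p) (ennreal q) (\<lambda>t. c * g (coord_upd x i t))
    = c * Herz_norm 0 (ennreal p) (ennreal q) (\<lambda>t. g (coord_upd x i t))"
  using pq by (simp add: Herz_norm_eq_nrm nrm_cmult mult.assoc)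

end

text \<open>\<open>mixed_norm\<close> for an arbitrary list of coordinates and without evaluation at
  0, so that induction over the list is possible.\<close>

abbreviation fold_coords ::
    "('n \<Rightarrow> (real \<Rightarrow> ennreal) \<Rightarrow> ennreal) \<Rightarrow> 'n list \<Rightarrow> (real ^ 'n \<Rightarrow> ennreal) \<Rightarrow> real ^ 'n \<Rightarrow> ennreal"
  where "fold_coords N \<equiv> fold (\<lambda>i h x. N i (\<lambda>t. h (coord_upd x i t)))"

lemma fold_coords_Lp_cmult:
  assumes "\<And>i. 0 < p i" "g \<in> borel_measurable borel"
  shows "fold_coords (\<lambda>i. Lp_norm (ennreal (p i))) xs (\<lambda>x. c * g x)
    = (\<lambda>x. c * fold_coords (\<lambda>i. Lp_norm (ennreal (p i))) xs g x)"
  using assms(2)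
proof (induction xs arbitrary: g)
  case (Cons i xs)
  then show ?case
    using assms(1)[of i] by (simp add: Lp_coord_upd_cmult measurable_Lp_coord_upd)
qed simp

lemma fold_coords_Herz_cmult:
  assumes "\<And>i. 0 < p i" "\<And>i. 0 < q i" "g \<in> borel_measurable borel"
  shows "fold_coords (\<lambda>i. Herz_norm 0 (ennreal (p i)) (ennreal (q i))) xs (\<lambda>x. c * g x)
    = (\<lambda>x. c * fold_coords (\<lambda>i. Herz_norm 0 (ennreal (p i)) (ennreal (q i))) xs g x)"
  using assms(3)
proof (induction xs arbitrary: g)
  case (Cons i xs)
  then show ?case
    using assms(1,2)[of i] by (simp add: Herz_coord_upd_cmult measurable_Herz_coord_upd)
qed simp

text \<open>Formulated for a single direction \<open>i\<close>, since a quasi-norm in another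
  variable then leaves it intact; the shift has the scale 2^(-k) of the k-th block.\<close>

definition submean :: "real \<Rightarrow> real \<Rightarrow> nat \<Rightarrow> 'n \<Rightarrow> (real ^ 'n::finite \<Rightarrow> ennreal) \<Rightarrow> bool"
  where "submean t A k i g \<longleftrightarrow> (\<forall>x. ennpow (g x) t
    \<le> ennreal A * (\<integral>\<^sup>+y. ennpow (g (x - (y * 2 powr - real k) *\<^sub>R axis i 1)) t \<partial>kmeas))"

lemma submean_cmult:
  assumes "submean t A k i g" "0 < t" and [measurable]: "g \<in> borel_measurable borel"
  shows "submean t A k i (\<lambda>x. c * g x)"
  unfolding submean_def
proof
  fix x
  have "ennpow c t * ennpow (g x) t
      \<le> ennpow c t * (ennreal A * (\<integral>\<^sup>+y. ennpow (g (x - (y * 2 powr - real k) *\<^sub>R axis i 1)) t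
          \<partial>kmeas))"
    using assms(1) unfolding submean_def by (intro mult_left_mono) auto
  then show "ennpow (c * g x) t
      \<le> ennreal A * (\<integral>\<^sup>+y. ennpow (c * g (x - (y * 2 powr - real k) *\<^sub>R axis i 1)) t \<partial>kmeas)"
    using assms(2) by (simp add: ennpow_mult nn_integral_cmult mult.left_commute)
qed

text \<open>Translation along axis \<open>j\<close> commutes with replacing coordinate
  \<open>i\<close>, so \<open>Herz_norm_submean\<close> applies with the translation as
  parameter.\<close>

lemma submean_Herz_coord_upd:
  assumes sub: "submean t A k j g" and "i \<noteq> j" and [measurable]: "g \<in> borel_measurable borel"
    and t: "0 < t" "t \<le> p" "t \<le> q"
  shows "submean t A k j (\<lambda>x. Herz_norm 0 (ennreal p) (ennreal q) (\<lambda>\<tau>. g (coord_upd x i \<tau>)))"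
  unfolding submean_def
proof
  fix x
  have le: "ennpow (g (coord_upd x i \<tau>)) t
      \<le> ennreal A * (\<integral>\<^sup>+y. ennpow (g (coord_upd (x - (y * 2 powr - real k) *\<^sub>R axis j 1) i \<tau>)) t
          \<partial>kmeas)" for \<tau>
    using sub \<open>i \<noteq> j\<close> unfolding submean_def
    by (auto simp flip: coord_upd_minus_axis_other)
  show "ennpow (Herz_norm 0 (ennreal p) (ennreal q) (\<lambda>\<tau>. g (coord_upd x i \<tau>))) t
      \<le> ennreal A * (\<integral>\<^sup>+y. ennpow (Herz_norm 0 (ennreal p) (ennreal q)
          (\<lambda>\<tau>. g (coord_upd (x - (y * 2 powr - real k) *\<^sub>R axis j 1) i \<tau>))) t \<partial>kmeas)"
    using t by (intro Herz_norm_submean finite_measure_kmeas le) auto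
qed

text \<open>The coordinate at the head is innermost and is treated first. The induction hypothesis
  is then applied to the functions obtained from it, multiplied by the dyadic weights gained
  there.\<close>

lemma fold_coords_jawerth_franke:
  fixes p q :: "'n::finite \<Rightarrow> real"
  assumes t: "0 < t" "\<And>i. t < q i" "\<And>i. q i < p i" and A: "0 < A"
    and xs: "xs \<noteq> []" "distinct xs"
  shows "\<exists>C>0. \<forall>g G. (\<forall>k. g k \<in> borel_measurable borel) \<longrightarrow> G \<in> borel_measurable borel \<longrightarrow>
      (\<forall>k x. g k x \<le> G x) \<longrightarrow> (\<forall>k. \<forall>i\<in>set xs. submean t A k i (g k)) \<longrightarrow>
      (\<forall>x. lq_norm (ennreal (q (last xs))) (\<lambda>k::nat. ennreal
          (2 powr (real k * (\<Sum>i\<in>set xs. 1 / p i - 1 / q i))) *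
          fold_coords (\<lambda>i. Herz_norm 0 (ennreal (p i)) (ennreal (q i))) xs (g k) x)
        \<le> ennreal C * fold_coords (\<lambda>i. Lp_norm (ennreal (q i))) xs G x)"
  using xs
proof (induction xs rule: list_nonempty_induct)
  have pq: "0 < p i" "0 < q i" "t \<le> p i" "t \<le> q i" for i
    using t(1) t(2)[of i] t(3)[of i] by auto
  {
    fix i
    obtain C :: real where C: "0 < C" and
      "\<And>g G. \<lbrakk>\<And>k. g k \<in> borel_measurable borel; G \<in> borel_measurable borel; \<And>k x. g k x \<le> G x;
          \<And>k x. ennpow (g k x) t \<le> ennreal A *
              (\<integral>\<^sup>+y. ennpow (g k (x - y * 2 powr - real k)) t \<partial>kmeas)\<rbrakk> \<Longrightarrow>
        lq_norm (ennreal (q i)) (\<lambda>k. ennreal (2 powr (real k * (1 / p i - 1 / q i))) * Herz_norm 0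
            (ennreal (p i)) (ennreal (q i)) (g k))
        \<le> ennreal C * Lp_norm (ennreal (q i)) G"
      using Herz_jawerth_franke[OF t(1) t(2)[of i] t(3)[of i] A] by blast
    note jf = this(2)
    have "lq_norm (ennreal (q i)) (\<lambda>k. ennreal (2 powr (real k * (1 / p i - 1 / q i))) * Herz_norm 0
        (ennreal (p i)) (ennreal (q i)) (\<lambda>\<tau>. g k (coord_upd x i \<tau>)))
        \<le> ennreal C * Lp_norm (ennreal (q i)) (\<lambda>\<tau>. G (coord_upd x i \<tau>))"
      if [measurable]: "\<And>k. g k \<in> borel_measurable borel" "G \<in> borel_measurable borel"
        and "\<And>k x. g k x \<le> G x" "\<And>k. submean t A k i (g k)" for g G x
      using that(3,4) unfolding submean_def
      by (intro jf) (auto simp flip: coord_upd_minus_axis_same)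
    with C have "\<exists>C>0. \<forall>g G x. (\<forall>k. g k \<in> borel_measurable borel) \<longrightarrow> G \<in> borel_measurable borel \<longrightarrow>
        (\<forall>k x. g k x \<le> G x) \<longrightarrow> (\<forall>k. submean t A k i (g k)) \<longrightarrow>
        lq_norm (ennreal (q i)) (\<lambda>k. ennreal (2 powr (real k * (1 / p i - 1 / q i))) * Herz_norm 0
            (ennreal (p i)) (ennreal (q i)) (\<lambda>\<tau>. g k (coord_upd x i \<tau>)))
        \<le> ennreal C * Lp_norm (ennreal (q i)) (\<lambda>\<tau>. G (coord_upd x i \<tau>))"
      by blast
  }
  note step = this
  {
    case (single i)
    obtain C where C: "C > 0" "\<forall>g G x. (\<forall>k. g k \<in> borel_measurable borel) \<longrightarrow> G \<in> borel_measurable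
        borel \<longrightarrow>
        (\<forall>k x. g k x \<le> G x) \<longrightarrow> (\<forall>k. submean t A k i (g k)) \<longrightarrow>
        lq_norm (ennreal (q i)) (\<lambda>k. ennreal (2 powr (real k * (1 / p i - 1 / q i))) * Herz_norm 0
            (ennreal (p i)) (ennreal (q i)) (\<lambda>\<tau>. g k (coord_upd x i \<tau>)))
        \<le> ennreal C * Lp_norm (ennreal (q i)) (\<lambda>\<tau>. G (coord_upd x i \<tau>))"
      using step[of i] by blast
    then show ?case by (intro exI[of _ C]) simp
  next
    case (cons i xs)
    let ?\<sigma> = "\<Sum>i\<in>set xs. 1 / p i - 1 / q i"
    let ?HF = "fold_coords (\<lambda>i. Herz_norm 0 (ennreal (p i)) (ennreal (q i)))"
    let ?LF = "fold_coords (\<lambda>i. Lp_norm (ennreal (q i)))"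
    obtain C1 where C1: "C1 > 0" and step: "\<And>g G x. (\<forall>k. g k \<in> borel_measurable borel) \<longrightarrow> G \<in>
        borel_measurable borel \<longrightarrow>
        (\<forall>k x. g k x \<le> G x) \<longrightarrow> (\<forall>k. submean t A k i (g k)) \<longrightarrow>
        lq_norm (ennreal (q i)) (\<lambda>k. ennreal (2 powr (real k * (1 / p i - 1 / q i))) * Herz_norm 0
            (ennreal (p i)) (ennreal (q i)) (\<lambda>\<tau>. g k (coord_upd x i \<tau>)))
        \<le> ennreal C1 * Lp_norm (ennreal (q i)) (\<lambda>\<tau>. G (coord_upd x i \<tau>))"
      using step[of i] by blast
    obtain C2 where C2: "C2 > 0" and IH: "\<And>g G x. \<lbrakk>\<forall>k. g k \<in> borel_measurable borel; G \<in>
        borel_measurable borel;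
        \<forall>k x. g k x \<le> G x; \<forall>k. \<forall>i\<in>set xs. submean t A k i (g k)\<rbrakk> \<Longrightarrow>
        lq_norm (ennreal (q (last xs))) (\<lambda>k::nat. ennreal (2 powr (real k * ?\<sigma>)) * ?HF xs (g k) x)
          \<le> ennreal C2 * ?LF xs G x"
      using cons.IH cons.prems by auto
    show ?case
    proof (intro exI[of _ "C2 * C1"] conjI allI impI)
      show "0 < C2 * C1" using C1 C2 by simp
      fix g :: "nat \<Rightarrow> real ^ 'n \<Rightarrow> ennreal" and G x
      assume g: "\<forall>k. g k \<in> borel_measurable borel" and G: "G \<in> borel_measurable borel"
        and le: "\<forall>k x. g k x \<le> G x" and sub: "\<forall>k. \<forall>i\<in>set (i # xs). submean t A k i (g k)"
      define h where "h k x = Herz_norm 0 (ennreal (p i)) (ennreal (q i))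
          (\<lambda>\<tau>. g k (coord_upd x i \<tau>))" for k x
      define H where "H x = Lp_norm (ennreal (q i)) (\<lambda>\<tau>. G (coord_upd x i \<tau>))" for x
      \<comment> \<open>The weight belongs to the new k-th function. By homogeneity it is extracted
        again at the end, where the exponents for \<open>i\<close> and \<open>xs\<close> add
        up.\<close>
      define a where "a k = ennreal (2 powr (real k * (1 / p i - 1 / q i)))" for k :: nat
      have h [measurable]: "h k \<in> borel_measurable borel" for k
        unfolding h_def using g pq by (intro measurable_Herz_coord_upd) auto
      have H [measurable]: "H \<in> borel_measurable borel"
        unfolding H_def using G pq[of i] by (intro measurable_Lp_coord_upd[where q = "q i"]) auto
      have "lq_norm (ennreal (q (last xs))) (\<lambda>k. ennreal (2 powr (real k * ?\<sigma>)) * ?HF xs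
          (\<lambda>x. a k * h k x) x)
          \<le> ennreal C2 * ?LF xs (\<lambda>x. ennreal C1 * H x) x"
      proof (rule IH)
        show "\<forall>k x. a k * h k x \<le> ennreal C1 * H x"
        proof (intro allI)
          fix k x
          \<comment> \<open>Each term is below the l^q quasi-norm, which \<open>step\<close> bounds
            by a function free of k: this supplies the new dominating function.\<close>
          have "a k * h k x \<le> lq_norm (ennreal (q i)) (\<lambda>k. a k * h k x)"
            using pq[of i] nrm_count_space_ge[of "q i" "\<lambda>k. a k * h k x" k]
                by (simp add: lq_norm_eq_nrm)
          also have "\<dots> \<le> ennreal C1 * H x"
            using step[of g G x] g G le sub by (simp add: a_def h_def H_def)
          finally show "a k * h k x \<le> ennreal C1 * H x" .
        qed
        show "\<forall>k. \<forall>j\<in>set xs. submean t A k j (\<lambda>x. a k * h k x)"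
        proof (intro allI ballI)
          fix k j assume "j \<in> set xs"
          then have "submean t A k j (h k)"
            unfolding h_def using cons.prems sub g t(1) pq
            by (intro submean_Herz_coord_upd) auto
          then show "submean t A k j (\<lambda>x. a k * h k x)"
            using t(1) by (intro submean_cmult) auto
        qed
      qed auto
      also have "?LF xs (\<lambda>x. ennreal C1 * H x) x = ennreal C1 * ?LF (i # xs) G x"
        using pq H by (subst fold_coords_Lp_cmult) (auto simp: H_def[abs_def])
      also have "(\<lambda>k. ennreal (2 powr (real k * ?\<sigma>)) * ?HF xs (\<lambda>x. a k * h k x) x)
          = (\<lambda>k. ennreal (2 powr (real k * (\<Sum>i\<in>set (i # xs). 1 / p i - 1 / q i))) * ?HF (i # xs)
              (g k) x)"
      proof
        fix k
        have "?HF xs (\<lambda>x. a k * h k x) x = a k * ?HF (i # xs) (g k) x"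
          using pq h by (subst fold_coords_Herz_cmult) (auto simp: h_def[abs_def])
        moreover have "ennreal (2 powr (real k * ?\<sigma>)) * a k = ennreal
            (2 powr (real k * (\<Sum>i\<in>set (i # xs). 1 / p i - 1 / q i)))"
          using cons.prems by (simp add: a_def distrib_left add.commute flip: ennreal_mult powr_add)
        ultimately show "ennreal (2 powr (real k * ?\<sigma>)) * ?HF xs (\<lambda>x. a k * h k x) x
            = ennreal (2 powr (real k * (\<Sum>i\<in>set (i # xs). 1 / p i - 1 / q i))) * ?HF (i # xs) (g k)
                x"
          by (simp add: mult.assoc[symmetric])
      qed
      finally show "lq_norm (ennreal (q (last (i # xs))))
          (\<lambda>k. ennreal (2 powr (real k * (\<Sum>i\<in>set (i # xs). 1 / p i - 1 / q i))) * ?HF (i # xs) (g k)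
          x)
          \<le> ennreal (C2 * C1) * ?LF (i # xs) G x"
        using cons.hyps C1 C2 by (simp add: ennreal_mult mult.assoc)
    qed
  }
qed

section \<open>Comparison of Lebesgue and Herz quasi-norms\<close>

lemma Union_annulus: "(\<Union>j. annulus j) = - {0}"
proof (rule set_eqI)
  fix t :: real
  show "t \<in> (\<Union>j. annulus j) \<longleftrightarrow> t \<in> - {0}"
  proof
    assume "t \<in> - {0}"
    then have t: "0 < \<bar>t\<bar>" by simp
    define j where "j = \<lfloor>log 2 \<bar>t\<bar>\<rfloor> + 1"
    have "real_of_int j - 1 \<le> log 2 \<bar>t\<bar>" "log 2 \<bar>t\<bar> < real_of_int j"
      by (auto simp: j_def)
    then have "t \<in> annulus j" using t by (simp add: annulus_eq le_log_iff log_less_iff)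
    then show "t \<in> (\<Union>j. annulus j)" by blast
  next
    assume "t \<in> (\<Union>j. annulus j)"
    then obtain j where "2 powr (real_of_int j - 1) \<le> \<bar>t\<bar>" by (auto simp: annulus_eq)
    moreover have "0 < 2 powr (real_of_int j - 1)" by simp
    ultimately show "t \<in> - {0}" by auto
  qed
qed

text \<open>The annuli omit only the null set {0}, so the integral of g^p is the sum of the
  \<open>X j\<close>; its r-th power, r = q / p \<le> 1, is subadditive.\<close>

lemma Lp_le_Herz:
  assumes [measurable]: "g \<in> borel_measurable borel" and pq: "0 < q" "q \<le> p"
  shows "Lp_norm (ennreal p) g \<le> Herz_norm 0 (ennreal p) (ennreal q) g"
proof -
  have p: "0 < p" using pq by simp
  define X where "X j = (\<integral>\<^sup>+t. ennpow (g t) p * indicator (annulus j) t \<partial>lborel)" for j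
  define r where "r = q / p"
  have r: "0 < r" "r \<le> 1" using pq by (auto simp: r_def)
  have one: "(\<integral>\<^sup>+j. indicator (annulus j) t \<partial>count_space UNIV) = (indicator (- {0}) t :: ennreal)"
      for t
  proof (cases "t = 0")
    case True
    then have "t \<notin> annulus j" for j using Union_annulus by blast
    then show ?thesis using True by simp
  next
    case False
    then obtain i where i: "t \<in> annulus i" using Union_annulus by blast
    have "indicator (annulus j) t = (indicator {i} j :: ennreal)" for j
      using i disjoint_family_annulus by (cases "i = j")
          (auto simp: disjoint_family_on_def indicator_def)
    then show ?thesis using False by simp
  qed
  have "(\<integral>\<^sup>+t. ennpow (g t) p \<partial>lborel) = (\<integral>\<^sup>+t. ennpow (g t) p * indicator (- {0}) t \<partial>lborel)"
    using AE_lborel_singleton[of "0::real"] by (intro nn_integral_cong_AE)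
        (auto elim!: eventually_mono)
  also have "\<dots> = (\<integral>\<^sup>+t. \<integral>\<^sup>+j. ennpow (g t) p * indicator (annulus j) t \<partial>count_space UNIV \<partial>lborel)"
    by (simp add: nn_integral_cmult one)
  also have "\<dots> = (\<integral>\<^sup>+j. X j \<partial>count_space UNIV)"
    unfolding X_def by (rule nn_integral_count_space_nn_integral) auto
  finally have "ennpow (Lp_norm (ennreal p) g) q = ennpow (\<integral>\<^sup>+j. X j \<partial>count_space UNIV) r"
    using p by (simp add: Lp_norm_eq_nrm nrm_def ennpow_ennpow r_def)
  also have "\<dots> \<le> (\<integral>\<^sup>+j. ennpow (X j) r \<partial>count_space UNIV)"
    using r by (rule ennpow_nn_integral_count_space_le)
  also have "\<dots> = ennpow (Herz_norm 0 (ennreal p) (ennreal q) g) q"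
  proof -
    have "ennpow (g t * indicator (annulus j) t) p = ennpow (g t) p * indicator (annulus j) t" for j
        t
      by (simp add: indicator_def)
    then show ?thesis
      using p pq by (simp add: Herz_norm_eq_nrm ennpow_nrm)
          (simp add: nrm_def X_def ennpow_ennpow r_def)
  qed
  finally show ?thesis using pq by (simp add: ennpow_le_iff)
qed

text \<open>Two functions are allowed because the two sides already differ after the first
  coordinate.\<close>

lemma fold_coords_Lp_le_Herz:
  assumes pq: "\<And>i. 0 < q i" "\<And>i. q i \<le> p i" and "h \<in> borel_measurable borel" "\<And>x. g x \<le> h x"
  shows "fold_coords (\<lambda>i. Lp_norm (ennreal (p i))) xs g x
    \<le> fold_coords (\<lambda>i. Herz_norm 0 (ennreal (p i)) (ennreal (q i))) xs h x"
  using assms(3,4)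
proof (induction xs arbitrary: g h)
  case (Cons i xs)
  note [measurable] = Cons.prems(1)
  have p: "0 < p i" using pq[of i] by simp
  have "Lp_norm (ennreal (p i)) (\<lambda>t. g (coord_upd x i t)) \<le> Herz_norm 0 (ennreal (p i))
      (ennreal (q i)) (\<lambda>t. h (coord_upd x i t))" for x
  proof -
    have "Lp_norm (ennreal (p i)) (\<lambda>t. g (coord_upd x i t)) \<le> Lp_norm (ennreal (p i))
        (\<lambda>t. h (coord_upd x i t))"
      using p Cons.prems by (simp add: Lp_norm_eq_nrm nrm_mono)
    also have "\<dots> \<le> Herz_norm 0 (ennreal (p i)) (ennreal (q i)) (\<lambda>t. h (coord_upd x i t))"
      using pq by (intro Lp_le_Herz) auto
    finally show ?thesis .
  qed
  then show ?case
    using Cons.IH[OF measurable_Herz_coord_upd[OF Cons.prems(1) p pq(1)]] by simp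
qed simp

section \<open>An interpolation formula for exponentials\<close>

text \<open>The uniform distribution on [-d, d].\<close>

definition ubox :: "real \<Rightarrow> real measure"
  where "ubox d = density lborel (\<lambda>\<tau>. ennreal (indicator {-d..d} \<tau> / (2 * d)))"

text \<open>The cardinal sine sin(ud) / (ud), kept as a characteristic function so that
  multiplication by it becomes averaging over translates.\<close>

definition ufac :: "real \<Rightarrow> real \<Rightarrow> complex"
  where "ufac d u = (\<integral>\<tau>. cis (u * \<tau>) \<partial>ubox d)"

lemma sets_ubox [measurable_cong, simp]: "sets (ubox d) = sets borel"
  by (simp add: ubox_def)

lemma space_ubox [simp]: "space (ubox d) = UNIV"
  by (simp add: ubox_def)

lemma prob_space_ubox:
  assumes "0 < d" shows "prob_space (ubox d)"
proof (rule prob_spaceI)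
  have "emeasure (ubox d) (space (ubox d)) = (\<integral>\<^sup>+\<tau>. ennreal (indicator {-d..d} \<tau> / (2 * d)) \<partial>lborel)"
    by (simp add: ubox_def emeasure_density)
  also have "\<dots> = (\<integral>\<^sup>+\<tau>. ennreal (1 / (2 * d)) * indicator {-d..d} \<tau> \<partial>lborel)"
    by (intro nn_integral_cong) (auto simp: indicator_def)
  also have "\<dots> = 1"
    using assms by (simp add: nn_integral_cmult flip: ennreal_mult)
  finally show "emeasure (ubox d) (space (ubox d)) = 1" .
qed

lemma AE_ubox: "0 < d \<Longrightarrow> AE \<tau> in ubox d. \<bar>\<tau>\<bar> \<le> d"
  unfolding ubox_def by (subst AE_density) (auto simp: indicator_def)

lemma AE_ubox_neq: "AE \<tau> in ubox d. \<tau> \<noteq> c"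
  unfolding ubox_def
  by (subst AE_density) (use AE_lborel_singleton[of c] in \<open>auto elim!: eventually_mono\<close>)

lemma measurable_cis [measurable]: "cis \<in> borel_measurable borel"
  by (intro borel_measurable_continuous_onI continuous_on_cis continuous_on_id)

lemma integrable_ubox:
  fixes f :: "real \<Rightarrow> complex"
  assumes "0 < d" "f \<in> borel_measurable borel" "\<And>\<tau>. norm (f \<tau>) \<le> B"
  shows "integrable (ubox d) f"
proof -
  interpret prob_space "ubox d" by (rule prob_space_ubox) fact
  show ?thesis using assms by (intro integrable_const_bound[of _ B]) auto
qed

lemma norm_ufac_le_1: "0 < d \<Longrightarrow> norm (ufac d u) \<le> 1"
proof -
  assume d: "0 < d"
  interpret prob_space "ubox d" by (rule prob_space_ubox) fact
  have "norm (ufac d u) \<le> (\<integral>\<tau>. norm (cis (u * \<tau>)) \<partial>ubox d)"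
    unfolding ufac_def by (rule integral_norm_bound)
  then show ?thesis using prob_space by simp
qed

lemma ufac_0 [simp]: "0 < d \<Longrightarrow> ufac d 0 = 1"
proof -
  assume d: "0 < d"
  interpret prob_space "ubox d" by (rule prob_space_ubox) fact
  show ?thesis using prob_space by (simp add: ufac_def)
qed

lemma ufac_eq:
  assumes d: "0 < d" and u: "u \<noteq> 0"
  shows "ufac d u = of_real (sin (u * d) / (u * d))"
proof -
  let ?F = "\<lambda>\<tau>. cis (u * \<tau>) / (\<i> * of_real u)"
  have "(LBINT \<tau>. indicat_real {-d..d} \<tau> *\<^sub>R cis (u * \<tau>)) = ?F d - ?F (- d)"
  proof (rule integral_FTC_Icc)
    show "continuous_on {-d..d} (\<lambda>\<tau>. cis (u * \<tau>))" by (intro continuous_intros)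
    fix \<tau>
    have "((\<lambda>\<tau>. exp (\<i> * of_real (u * \<tau>)) / (\<i> * of_real u)) has_vector_derivative exp
        (\<i> * of_real (u * \<tau>))) (at \<tau>)"
      using u by (auto intro!: derivative_eq_intros has_vector_derivative_real_field simp:
          field_simps)
    then show "(?F has_vector_derivative cis (u * \<tau>)) (at \<tau> within {-d..d})"
      by (simp add: cis_conv_exp has_vector_derivative_at_within)
  qed (use d in simp)
  also have "\<dots> = of_real (2 * sin (u * d) / u)"
  proof -
    have "cis (u * d) - cis (u * - d) = \<i> * of_real (2 * sin (u * d))"
      by (simp add: complex_eq_iff)
    then show ?thesis by (simp add: diff_divide_distrib[symmetric])
  qed
  finally have *: "(LBINT \<tau>. indicat_real {-d..d} \<tau> *\<^sub>R cis (u * \<tau>)) = of_real (2 * sin (u * d) / u)"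
      .
  have "ufac d u = (LBINT \<tau>. (indicat_real {-d..d} \<tau> / (2 * d)) *\<^sub>R cis (u * \<tau>))"
    unfolding ufac_def ubox_def using d by (subst integral_density) auto
  also have "\<dots> = (LBINT \<tau>. (1 / (2 * d)) *\<^sub>R (indicat_real {-d..d} \<tau> *\<^sub>R cis (u * \<tau>)))"
    by (intro Bochner_Integration.integral_cong) auto
  also have "\<dots> = (1 / (2 * d)) *\<^sub>R (LBINT \<tau>. indicat_real {-d..d} \<tau> *\<^sub>R cis (u * \<tau>))"
    by (rule integral_scaleR_right)
  finally show ?thesis
    unfolding * using d u by (simp add: scaleR_conv_of_real field_simps)
qed

lemma norm_ufac_le: "0 < d \<Longrightarrow> u \<noteq> 0 \<Longrightarrow> norm (ufac d u) \<le> 1 / (d * \<bar>u\<bar>)"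
  by (auto simp: ufac_eq norm_divide norm_mult abs_mult mult.commute divide_right_mono
      simp del: of_real_divide of_real_mult)

lemma ufac_pi_int: "(m :: int) \<noteq> 0 \<Longrightarrow> ufac pi (of_int m) = 0"
  by (simp add: ufac_eq sin_zero_iff_int2)

text \<open>The factor \<open>ufac pi\<close> is the kernel of the classical cardinal series and
  vanishes at the nonzero integers. The factors from \<open>ds\<close> improve the decay; each costs
  bandwidth \<open>d\<close>.\<close>

definition ikern :: "real list \<Rightarrow> real \<Rightarrow> complex"
  where "ikern ds u = (\<Prod>d\<leftarrow>ds. ufac d u) * ufac pi u"

text \<open>The Cesaro mean of the a_m, with weights 1 - |m| / M. As a double sum it becomes a
  square for exponentials, so that positivity of the Fejer kernel is immediate.\<close>

definition fejer_mean :: "nat \<Rightarrow> (int \<Rightarrow> complex) \<Rightarrow> complex"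
  where "fejer_mean M a = (\<Sum>j<M. \<Sum>l<M. a (int j - int l)) / of_nat M"

text \<open>Fejer mean in \<theta> of the candidate series for exp(i u \<theta>). For empty
  \<open>ds\<close> the coefficients are the Fourier coefficients of that function on (-pi,
  pi).\<close>

definition ikern_mean :: "real list \<Rightarrow> nat \<Rightarrow> real \<Rightarrow> real \<Rightarrow> complex"
  where "ikern_mean ds M u \<theta> = fejer_mean M (\<lambda>m. cis (of_int m * \<theta>) * ikern ds (u - of_int m))"

lemma fejer_mean_ubox:
  assumes "0 < d" and a: "\<And>m. a m = (\<integral>\<tau>. b m \<tau> \<partial>ubox d)"
    and b [measurable]: "\<And>m. b m \<in> borel_measurable borel" "\<And>m \<tau>. norm (b m \<tau>) \<le> B m"
  shows "fejer_mean M a = (\<integral>\<tau>. fejer_mean M (\<lambda>m. b m \<tau>) \<partial>ubox d)"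
proof -
  have [simp]: "integrable (ubox d) (b m)" for m
    using assms by (intro integrable_ubox) auto
  show ?thesis by (simp add: fejer_mean_def a)
qed

text \<open>In exp(i m \<theta>) exp(i (u - m) \<tau>) the index m occurs only with \<theta> -
  \<tau>. A further factor thus amounts to averaging over shifts |\<tau>| \<le> d.\<close>

lemma ikern_mean_Cons:
  assumes "0 < d"
  shows "ikern_mean (d # ds) M u \<theta> = (\<integral>\<tau>. cis (u * \<tau>) * ikern_mean ds M u (\<theta> - \<tau>) \<partial>ubox d)"
proof -
  have "ikern_mean (d # ds) M u \<theta>
      = (\<integral>\<tau>. fejer_mean M (\<lambda>m. cis (of_int m * \<theta>) * cis ((u - of_int m) * \<tau>) * ikern ds
          (u - of_int m)) \<partial>ubox d)"
    unfolding ikern_mean_def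
  proof (rule fejer_mean_ubox)
    fix m :: int and \<tau>
    show "cis (of_int m * \<theta>) * ikern (d # ds) (u - of_int m)
        = (\<integral>\<tau>. cis (of_int m * \<theta>) * cis ((u - of_int m) * \<tau>) * ikern ds (u - of_int m) \<partial>ubox d)"
      by (simp add: ikern_def ufac_def[of d] mult.assoc)
    show "norm (cis (of_int m * \<theta>) * cis ((u - of_int m) * \<tau>) * ikern ds (u - of_int m)) \<le> norm
        (ikern ds (u - of_int m))"
      by (simp add: norm_mult)
  qed (use assms in auto)
  also have "\<dots> = (\<integral>\<tau>. cis (u * \<tau>) * ikern_mean ds M u (\<theta> - \<tau>) \<partial>ubox d)"
  proof -
    have "cis (of_int m * \<theta>) * cis ((u - of_int m) * \<tau>) = cis (u * \<tau>) * cis (of_int m * (\<theta> - \<tau>))"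
        for m \<tau>
      by (simp add: cis_mult algebra_simps)
    then show ?thesis
      by (simp add: ikern_mean_def fejer_mean_def sum_distrib_left mult.assoc)
  qed
  finally show ?thesis .
qed

section \<open>The Fejer kernel and convergence of Fejer means\<close>

definition fejer_kernel :: "nat \<Rightarrow> real \<Rightarrow> real"
  where "fejer_kernel M \<theta> = (norm (\<Sum>j<M. cis (of_nat j * \<theta>)))\<^sup>2 / of_nat M"

lemma fejer_mean_cis: "fejer_mean M (\<lambda>m. cis (of_int m * \<theta>)) = of_real (fejer_kernel M \<theta>)"
proof -
  have "(\<Sum>j<M. \<Sum>l<M. cis (of_int (int j - int l) * \<theta>))
      = (\<Sum>j<M. cis (of_nat j * \<theta>)) * cnj (\<Sum>l<M. cis (of_nat l * \<theta>))"
    by (simp add: sum_product cis_cnj cis_mult algebra_simps)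
  also have "\<dots> = of_real ((norm (\<Sum>j<M. cis (of_nat j * \<theta>)))\<^sup>2)"
    by (simp only: complex_norm_square)
  finally show ?thesis by (simp add: fejer_mean_def fejer_kernel_def)
qed

lemma fejer_kernel_nonneg: "0 \<le> fejer_kernel M \<theta>"
  by (simp add: fejer_kernel_def)

text \<open>The geometric sum D satisfies |D| \<le> M and |1 - exp(i \<theta>)| |D| \<le> 2. The
  three combinations give domination near the singular point, decay away from it, and
  integrability.\<close>

lemma fejer_kernel_bounds:
  assumes "0 < M"
  shows "norm (1 - cis \<theta>) * fejer_kernel M \<theta> \<le> 2"
    and "(norm (1 - cis \<theta>))\<^sup>2 * fejer_kernel M \<theta> \<le> 4 / of_nat M"
    and "fejer_kernel M \<theta> \<le> of_nat M"
proof -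
  define D where "D = (\<Sum>j<M. cis (of_nat j * \<theta>))"
  have "norm D \<le> (\<Sum>j<M. norm (cis (of_nat j * \<theta>)))" unfolding D_def by (rule norm_sum)
  then have D1: "norm D \<le> of_nat M" by simp
  have "(1 - cis \<theta>) * D = 1 - cis \<theta> ^ M"
    by (simp add: D_def Complex.DeMoivre[symmetric] one_diff_power_eq)
  then have "norm (1 - cis \<theta>) * norm D \<le> norm (1 :: complex) + norm (cis \<theta> ^ M)"
    by (metis norm_mult norm_triangle_ineq4)
  then have D2: "norm (1 - cis \<theta>) * norm D \<le> 2" by (simp add: norm_power)
  have "norm (1 - cis \<theta>) * norm D * norm D \<le> 2 * of_nat M"
    using D1 D2 by (intro mult_mono) auto
  then show "norm (1 - cis \<theta>) * fejer_kernel M \<theta> \<le> 2"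
    unfolding fejer_kernel_def D_def[symmetric] using assms
        by (simp add: power2_eq_square field_simps)
  have "(norm (1 - cis \<theta>) * norm D)\<^sup>2 \<le> 2\<^sup>2" using D2 by (intro power_mono) auto
  then show "(norm (1 - cis \<theta>))\<^sup>2 * fejer_kernel M \<theta> \<le> 4 / of_nat M"
    using assms by (simp add: fejer_kernel_def D_def[symmetric] power_mult_distrib
        divide_right_mono)
  have "(norm D)\<^sup>2 \<le> (of_nat M)\<^sup>2" using D1 by (intro power_mono) auto
  then show "fejer_kernel M \<theta> \<le> of_nat M"
    unfolding fejer_kernel_def D_def[symmetric] using assms
        by (simp add: power2_eq_square field_simps)
qed

lemma measurable_fejer_kernel [measurable]: "fejer_kernel M \<in> borel_measurable borel"
  unfolding fejer_kernel_def by measurable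

lemma ikern_mean_Nil: "ikern_mean [] M u \<theta> = (\<integral>\<tau>. cis (u * \<tau>) * of_real (fejer_kernel M (\<theta> - \<tau>))
    \<partial>ubox pi)"
proof -
  have "ikern_mean [] M u \<theta>
      = (\<integral>\<tau>. fejer_mean M (\<lambda>m. cis (of_int m * \<theta>) * cis ((u - of_int m) * \<tau>)) \<partial>ubox pi)"
    unfolding ikern_mean_def
  proof (rule fejer_mean_ubox)
    fix m :: int and \<tau>
    show "cis (of_int m * \<theta>) * ikern [] (u - of_int m)
        = (\<integral>\<tau>. cis (of_int m * \<theta>) * cis ((u - of_int m) * \<tau>) \<partial>ubox pi)"
      by (simp add: ikern_def ufac_def)
    show "norm (cis (of_int m * \<theta>) * cis ((u - of_int m) * \<tau>)) \<le> 1"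
      by (simp add: norm_mult)
  qed auto
  also have "\<dots> = (\<integral>\<tau>. cis (u * \<tau>) * of_real (fejer_kernel M (\<theta> - \<tau>)) \<partial>ubox pi)"
  proof -
    have *: "cis (of_int m * \<theta>) * cis ((u - of_int m) * \<tau>) = cis (u * \<tau>) * cis (of_int m * (\<theta> - \<tau>))"
        for m \<tau>
      by (simp add: cis_mult algebra_simps)
    show ?thesis
      unfolding * fejer_mean_cis[symmetric] by (simp add: fejer_mean_def sum_distrib_left)
  qed
  finally show ?thesis .
qed

text \<open>\<open>ikern_mean_Nil\<close> at \<open>u = 0\<close>: the coefficients are cardinal
  sines at integers, so only m = 0 survives, with weight 1.\<close>

lemma integral_fejer_kernel:
  assumes "0 < M" shows "(\<integral>\<tau>. fejer_kernel M (\<theta> - \<tau>) \<partial>ubox pi) = 1"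
proof -
  have "ikern [] (0 - of_int m) = (if m = 0 then 1 else 0)" for m
    using ufac_pi_int[of "- m"] by (simp add: ikern_def)
  then have "ikern_mean [] M 0 \<theta> = fejer_mean M (\<lambda>m. if m = 0 then 1 else 0)"
    unfolding ikern_mean_def by (intro arg_cong[where f = "fejer_mean M"]) auto
  also have "\<dots> = 1"
    using assms by (simp add: fejer_mean_def of_nat_eq_iff)
  finally have "(\<integral>\<tau>. complex_of_real (fejer_kernel M (\<theta> - \<tau>)) \<partial>ubox pi) = 1"
    by (simp add: ikern_mean_Nil)
  then show ?thesis by simp
qed

lemma integrable_fejer_kernel:
  assumes "0 < M" shows "integrable (ubox pi) (\<lambda>\<tau>. fejer_kernel M (\<theta> - \<tau>))"
proof -
  interpret prob_space "ubox pi" by (rule prob_space_ubox) simp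
  show ?thesis
    using fejer_kernel_bounds(3)[OF assms] fejer_kernel_nonneg
    by (intro integrable_const_bound[of _ "of_nat M"]) auto
qed

lemma norm_1_minus_cis: "norm (1 - cis \<theta>) = 2 * \<bar>sin (\<theta> / 2)\<bar>"
  using dist_exp_i_1[of \<theta>] by (simp add: cis_conv_exp norm_minus_commute)

text \<open>|1 - cis x| is |x| times |sinc (x / 2)|, and sinc has no zero on the compact interval
  [-b/2, b/2] as b/2 < pi.\<close>

lemma abs_le_norm_1_minus_cis:
  assumes "b < 2 * pi"
  obtains C where "0 < C" "\<And>x. \<bar>x\<bar> \<le> b \<Longrightarrow> \<bar>x\<bar> \<le> C * norm (1 - cis x)"
proof (cases "0 \<le> b")
  case True
  have "continuous_on {-b/2..b/2} (\<lambda>x. \<bar>sinc x\<bar>)"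
    by (intro continuous_intros continuous_at_imp_continuous_on) (auto intro: isCont_sinc)
  then obtain z where z: "z \<in> {-b/2..b/2}" "\<And>x. x \<in> {-b/2..b/2} \<Longrightarrow> \<bar>sinc z\<bar> \<le> \<bar>sinc x\<bar>"
    using continuous_attains_inf[of "{-b/2..b/2}" "\<lambda>x. \<bar>sinc x\<bar>"] True by auto
  have "\<bar>z\<bar> < pi" using z(1) assms by auto
  then have "sinc z \<noteq> 0" using sin_zero_pi_iff[of z] by auto
  then have c: "0 < \<bar>sinc z\<bar>" by simp
  show thesis
  proof (rule that[of "1 / \<bar>sinc z\<bar>"])
    show "0 < 1 / \<bar>sinc z\<bar>" using c by simp
    fix x :: real assume x: "\<bar>x\<bar> \<le> b"
    show "\<bar>x\<bar> \<le> 1 / \<bar>sinc z\<bar> * norm (1 - cis x)"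
    proof (cases "x = 0")
      case False
      have "\<bar>sinc z\<bar> \<le> \<bar>sinc (x / 2)\<bar>" using x by (intro z(2)) auto
      also have "\<dots> = 2 * \<bar>sin (x / 2)\<bar> / \<bar>x\<bar>" using False by (simp add: abs_mult)
      finally show ?thesis using c False by (simp add: norm_1_minus_cis field_simps)
    qed simp
  qed
next
  case False
  then show thesis by (intro that[of 1]) auto
qed

lemma norm_cis_diff_le: "norm (cis x - cis y) \<le> \<bar>x - y\<bar>"
proof -
  have "cis x - cis y = - (cis y * (1 - cis (x - y)))"
    by (simp add: cis_mult algebra_simps)
  then have "norm (cis x - cis y) = 2 * \<bar>sin ((x - y) / 2)\<bar>"
    by (simp add: norm_mult norm_1_minus_cis)
  also have "\<dots> \<le> \<bar>x - y\<bar>" using abs_sin_x_le_abs_x[of "(x - y) / 2"] by simp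
  finally show ?thesis .
qed

text \<open>No splitting near \<theta> is needed: the Lipschitz factor |\<theta> - \<tau>| is at
  most C |1 - cis (\<theta> - \<tau>)|, which the kernel tolerates with bound 2. So the integrands
  are uniformly bounded and tend to 0 off one point. The hypothesis keeps |\<theta> - \<tau>| below
  2 pi.\<close>

lemma ikern_mean_Nil_tendsto:
  assumes "\<bar>\<theta>\<bar> < pi"
  shows "(\<lambda>M. ikern_mean [] (Suc M) u \<theta>) \<longlonglongrightarrow> cis (u * \<theta>)"
proof -
  interpret prob_space "ubox pi" by (rule prob_space_ubox) simp
  obtain C where C: "0 < C" "\<And>x. \<bar>x\<bar> \<le> pi + \<bar>\<theta>\<bar> \<Longrightarrow> \<bar>x\<bar> \<le> C * norm (1 - cis x)"
    using abs_le_norm_1_minus_cis[of "pi + \<bar>\<theta>\<bar>"] assms by auto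
  define h where "h M \<tau> = norm (cis (u * \<tau>) - cis (u * \<theta>)) * fejer_kernel (Suc M) (\<theta> - \<tau>)" for M \<tau>
  have bound: "norm (h M \<tau>) \<le> \<bar>u\<bar> * (C * 2)" if "\<bar>\<tau>\<bar> \<le> pi" for M \<tau>
  proof -
    have "norm (cis (u * \<tau>) - cis (u * \<theta>)) \<le> \<bar>u\<bar> * \<bar>\<theta> - \<tau>\<bar>"
      using norm_cis_diff_le[of "u * \<tau>" "u * \<theta>"]
      by (simp add: abs_mult[symmetric] abs_minus_commute algebra_simps)
    also have "\<dots> \<le> \<bar>u\<bar> * (C * norm (1 - cis (\<theta> - \<tau>)))"
      using that by (intro mult_left_mono C) auto
    finally have "norm (h M \<tau>) \<le> \<bar>u\<bar> * (C * norm (1 - cis (\<theta> - \<tau>))) * fejer_kernel (Suc M) (\<theta> - \<tau>)"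
      by (simp add: h_def fejer_kernel_nonneg mult_right_mono)
    also have "\<dots> = \<bar>u\<bar> * (C * (norm (1 - cis (\<theta> - \<tau>)) * fejer_kernel (Suc M) (\<theta> - \<tau>)))" by simp
    also have "\<dots> \<le> \<bar>u\<bar> * (C * 2)"
      using C by (intro mult_left_mono fejer_kernel_bounds) auto
    finally show ?thesis .
  qed
  have "(\<lambda>M. \<integral>\<tau>. h M \<tau> \<partial>ubox pi) \<longlonglongrightarrow> (\<integral>\<tau>. 0 \<partial>ubox pi)"
  proof (rule integral_dominated_convergence[where w = "\<lambda>_. \<bar>u\<bar> * (C * 2)"])
    show "AE \<tau> in ubox pi. norm (h M \<tau>) \<le> \<bar>u\<bar> * (C * 2)" for M
      using AE_ubox[of pi] bound by (auto elim!: eventually_mono)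
    show "AE \<tau> in ubox pi. (\<lambda>M. h M \<tau>) \<longlonglongrightarrow> 0"
    proof (use AE_ubox[OF pi_gt_zero] AE_ubox_neq[where d = pi and c = \<theta>] in eventually_elim)
      fix \<tau> assume \<tau>: "\<bar>\<tau>\<bar> \<le> pi" "\<tau> \<noteq> \<theta>"
      define c where "c = norm (1 - cis (\<theta> - \<tau>))"
      have "0 < \<bar>\<theta> - \<tau>\<bar>" using \<tau> by simp
      also have "\<dots> \<le> C * c" unfolding c_def using \<tau> by (intro C) auto
      finally have c: "0 < c" using C by (simp add: zero_less_mult_iff)
      have le: "fejer_kernel (Suc M) (\<theta> - \<tau>) \<le> 4 / c\<^sup>2 / real (Suc M)" for M
      proof -
        have "fejer_kernel (Suc M) (\<theta> - \<tau>) * c\<^sup>2 \<le> 4 / real (Suc M)"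
          using fejer_kernel_bounds(2)[of "Suc M" "\<theta> - \<tau>"] by (simp add: c_def mult.commute)
        then have "fejer_kernel (Suc M) (\<theta> - \<tau>) \<le> 4 / real (Suc M) / c\<^sup>2"
          using c by (subst pos_le_divide_eq) auto
        then show ?thesis by (simp add: mult.commute del: of_nat_Suc)
      qed
      have "(\<lambda>M. 4 / c\<^sup>2 / real (Suc M)) \<longlonglongrightarrow> 0"
        by (intro real_tendsto_divide_at_top[OF tendsto_const]
            filterlim_compose[OF filterlim_real_sequentially] filterlim_Suc)
      then have "(\<lambda>M. fejer_kernel (Suc M) (\<theta> - \<tau>)) \<longlonglongrightarrow> 0"
      proof (rule Lim_null_comparison[rotated])
        show "\<forall>\<^sub>F M in sequentially. norm (fejer_kernel (Suc M) (\<theta> - \<tau>)) \<le> 4 / c\<^sup>2 / real (Suc M)"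
          using le by (intro always_eventually allI) (simp add: fejer_kernel_nonneg del: of_nat_Suc)
      qed
      then show "(\<lambda>M. h M \<tau>) \<longlonglongrightarrow> 0"
        unfolding h_def by (rule tendsto_mult_right_zero)
    qed
  qed (auto simp: h_def)
  then have lim: "(\<lambda>M. \<integral>\<tau>. h M \<tau> \<partial>ubox pi) \<longlonglongrightarrow> 0" by simp
  have "norm (ikern_mean [] (Suc M) u \<theta> - cis (u * \<theta>)) \<le> (\<integral>\<tau>. h M \<tau> \<partial>ubox pi)" for M
  proof -
    note int = integrable_fejer_kernel[of "Suc M" \<theta>]
    have int1: "integrable (ubox pi) (\<lambda>\<tau>. cis (c * \<tau>) * complex_of_real
        (fejer_kernel (Suc M) (\<theta> - \<tau>)))" for c
      using int by (rule Bochner_Integration.integrable_bound[OF _ _ AE_I2]) (auto simp: norm_mult)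
    have "cis (u * \<theta>) = (\<integral>\<tau>. cis (u * \<theta>) * of_real (fejer_kernel (Suc M) (\<theta> - \<tau>)) \<partial>ubox pi)"
      using integral_fejer_kernel[of "Suc M" \<theta>] by simp
    then have "ikern_mean [] (Suc M) u \<theta> - cis (u * \<theta>)
        = (\<integral>\<tau>. cis (u * \<tau>) * of_real (fejer_kernel (Suc M) (\<theta> - \<tau>))
          - cis (u * \<theta>) * of_real (fejer_kernel (Suc M) (\<theta> - \<tau>)) \<partial>ubox pi)"
      using int1[of u] int by (subst Bochner_Integration.integral_diff) (auto simp: ikern_mean_Nil)
    also have "norm \<dots> \<le> (\<integral>\<tau>. norm (cis (u * \<tau>) * complex_of_real (fejer_kernel (Suc M) (\<theta> - \<tau>))
          - cis (u * \<theta>) * of_real (fejer_kernel (Suc M) (\<theta> - \<tau>))) \<partial>ubox pi)"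
      by (rule integral_norm_bound)
    also have "\<dots> = (\<integral>\<tau>. h M \<tau> \<partial>ubox pi)"
      by (simp add: h_def norm_mult fejer_kernel_nonneg flip: left_diff_distrib)
    finally show ?thesis .
  qed
  then show ?thesis
    using lim by (intro LIM_zero_cancel[OF Lim_null_comparison[OF always_eventually lim]]) auto
qed

lemma norm_ikern_mean_Nil_le: "norm (ikern_mean [] (Suc M) u \<theta>) \<le> 1"
proof -
  have "norm (ikern_mean [] (Suc M) u \<theta>)
      \<le> (\<integral>\<tau>. norm (cis (u * \<tau>) * complex_of_real (fejer_kernel (Suc M) (\<theta> - \<tau>))) \<partial>ubox pi)"
    unfolding ikern_mean_Nil by (rule integral_norm_bound)
  also have "\<dots> = 1"
    using integral_fejer_kernel[of "Suc M" \<theta>] by (simp add: norm_mult fejer_kernel_nonneg)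
  finally show ?thesis .
qed

lemma measurable_ikern_mean [measurable]: "ikern_mean ds M u \<in> borel_measurable borel"
  unfolding ikern_mean_def fejer_mean_def by measurable

text \<open>Induction with \<open>ikern_mean_Cons\<close>. The bound by 1 is proved alongside
  because it dominates the integrands. Each factor moves \<theta> by at most \<open>d\<close>, and
  the hypothesis keeps all these points inside (-pi, pi).\<close>

lemma ikern_mean_tendsto:
  assumes "\<And>d. d \<in> set ds \<Longrightarrow> 0 < d"
  shows "norm (ikern_mean ds (Suc M) u \<theta>) \<le> 1"
    and "\<bar>\<theta>\<bar> + sum_list ds < pi \<Longrightarrow> (\<lambda>M. ikern_mean ds (Suc M) u \<theta>) \<longlonglongrightarrow> cis (u * \<theta>)"
  using assms
proof (induction ds arbitrary: \<theta> M)
  case Nil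
  {
    case 1
    show ?case by (rule norm_ikern_mean_Nil_le)
  next
    case 2
    then show ?case by (simp add: ikern_mean_Nil_tendsto)
  }
next
  case (Cons d ds)
  {
    case 1
    then have d: "0 < d" by simp
    interpret prob_space "ubox d" by (rule prob_space_ubox) fact
    have le: "norm (cis (u * \<tau>) * ikern_mean ds (Suc M) u (\<theta> - \<tau>)) \<le> 1" for \<tau>
      using Cons.IH(1) 1 by (simp add: norm_mult)
    have "norm (ikern_mean (d # ds) (Suc M) u \<theta>)
        \<le> (\<integral>\<tau>. norm (cis (u * \<tau>) * ikern_mean ds (Suc M) u (\<theta> - \<tau>)) \<partial>ubox d)"
      unfolding ikern_mean_Cons[OF d] by (rule integral_norm_bound)
    also have "\<dots> \<le> (\<integral>\<tau>. 1 \<partial>ubox d)"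
      using le d by (intro integral_mono integrable_norm integrable_ubox[of d _ 1]) auto
    finally show ?case using prob_space by simp
  next
    case 2
    then have d: "0 < d" by simp
    interpret prob_space "ubox d" by (rule prob_space_ubox) fact
    have "(\<lambda>M. \<integral>\<tau>. cis (u * \<tau>) * ikern_mean ds (Suc M) u (\<theta> - \<tau>) \<partial>ubox d)
        \<longlonglongrightarrow> (\<integral>\<tau>. cis (u * \<theta>) \<partial>ubox d)"
    proof (rule integral_dominated_convergence[where w = "\<lambda>_. 1"])
      show "AE \<tau> in ubox d. norm (cis (u * \<tau>) * ikern_mean ds (Suc M) u (\<theta> - \<tau>)) \<le> 1" for M
        using Cons.IH(1) 2 by (simp add: norm_mult)
      show "AE \<tau> in ubox d. (\<lambda>M. cis (u * \<tau>) * ikern_mean ds (Suc M) u (\<theta> - \<tau>)) \<longlonglongrightarrow> cis (u * \<theta>)"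
      proof (use AE_ubox[OF d] in eventually_elim)
        fix \<tau> assume "\<bar>\<tau>\<bar> \<le> d"
        then have "(\<lambda>M. ikern_mean ds (Suc M) u (\<theta> - \<tau>)) \<longlonglongrightarrow> cis (u * (\<theta> - \<tau>))"
          using 2 by (intro Cons.IH(2)) auto
        then have "(\<lambda>M. cis (u * \<tau>) * ikern_mean ds (Suc M) u (\<theta> - \<tau>)) \<longlonglongrightarrow> cis (u * \<tau>) * cis
            (u * (\<theta> - \<tau>))"
          by (rule tendsto_mult_left)
        then show "(\<lambda>M. cis (u * \<tau>) * ikern_mean ds (Suc M) u (\<theta> - \<tau>)) \<longlonglongrightarrow> cis (u * \<theta>)"
          by (simp add: cis_mult algebra_simps)
      qed
    qed auto
    then show ?case using prob_space by (simp add: ikern_mean_Cons[OF d])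
  }
qed

section \<open>Cesaro means of absolutely convergent series\<close>

lemma card_diff_eq:
  assumes "\<bar>m\<bar> \<le> int M"
  shows "(\<Sum>j<M. \<Sum>l<M. if int j - int l = m then 1 else 0 :: complex) = of_int (int M - \<bar>m\<bar>)"
proof -
  have "(\<Sum>l<M. if int j - int l = m then 1 else 0 :: complex) =
      (if m \<le> int j \<and> int j < int M + m then 1 else 0)" for j
  proof -
    have "(\<Sum>l<M. if int j - int l = m then 1 else 0 :: complex) =
        (\<Sum>l<M. if l = nat (int j - m) \<and> m \<le> int j then 1 else 0)"
      by (intro sum.cong) auto
    also have "\<dots> = (if m \<le> int j then (\<Sum>l<M. if l = nat (int j - m) then 1 else 0) else 0)" by simp
    also have "\<dots> = (if m \<le> int j \<and> int j < int M + m then 1 else 0)" by auto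
    finally show ?thesis .
  qed
  then have "(\<Sum>j<M. \<Sum>l<M. if int j - int l = m then 1 else 0 :: complex)
      = (\<Sum>j<M. if m \<le> int j \<and> int j < int M + m then 1 else 0)" by simp
  also have "\<dots> = of_nat (card {j. j < M \<and> m \<le> int j \<and> int j < int M + m})"
    by (simp add: sum.If_cases Int_def conj_commute)
  also have "{j. j < M \<and> m \<le> int j \<and> int j < int M + m} = {nat m..<nat (min (int M) (int M + m))}"
    by auto
  also have "of_nat (card \<dots>) = (of_int (int M - \<bar>m\<bar>) :: complex)"
    using assms by (cases "0 \<le> m") (auto simp: min_def of_nat_diff)
  finally show ?thesis .
qed

lemma fejer_mean_delta_tendsto: "(\<lambda>M. fejer_mean (Suc M) (\<lambda>k. if k = m then 1 else 0)) \<longlonglongrightarrow> 1"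
proof -
  have "(\<lambda>M. 1 - complex_of_int \<bar>m\<bar> * inverse (of_nat (Suc M))) \<longlonglongrightarrow> 1 - complex_of_int \<bar>m\<bar> * 0"
    by (intro tendsto_intros LIMSEQ_Suc[OF lim_inverse_n])
  then have "(\<lambda>M. 1 - complex_of_int \<bar>m\<bar> * inverse (of_nat (Suc M))) \<longlonglongrightarrow> 1" by simp
  moreover have "\<forall>\<^sub>F M in sequentially. 1 - complex_of_int \<bar>m\<bar> * inverse (of_nat (Suc M))
      = fejer_mean (Suc M) (\<lambda>k. if k = m then 1 else 0)"
  proof (rule eventually_sequentiallyI[of "nat \<bar>m\<bar>"])
    fix M assume "nat \<bar>m\<bar> \<le> M"
    then have "fejer_mean (Suc M) (\<lambda>k. if k = m then 1 else 0) = of_int (int (Suc M) - \<bar>m\<bar>) / of_nat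
        (Suc M)"
      unfolding fejer_mean_def by (subst card_diff_eq) auto
    also have "\<dots> = (of_nat (Suc M) - complex_of_int \<bar>m\<bar>) / of_nat (Suc M)"
      by (simp only: of_int_diff of_int_of_nat_eq)
    also have "\<dots> = 1 - complex_of_int \<bar>m\<bar> * inverse (of_nat (Suc M))"
      by (simp add: divide_inverse left_diff_distrib del: of_nat_Suc)
    finally show "1 - complex_of_int \<bar>m\<bar> * inverse (of_nat (Suc M))
        = fejer_mean (Suc M) (\<lambda>k. if k = m then 1 else 0)" by simp
  qed
  ultimately show ?thesis by (rule Lim_transform_eventually)
qed

lemma fejer_mean_tendsto_infsum:
  assumes a: "(\<lambda>m. norm (a m)) summable_on UNIV"
  shows "(\<lambda>M. fejer_mean (Suc M) a) \<longlonglongrightarrow> infsum a UNIV"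
proof (rule LIMSEQ_I)
  fix e :: real assume e: "0 < e"
  obtain F where F: "finite F" "dist (\<Sum>m\<in>F. norm (a m)) (\<Sum>\<^sub>\<infinity>m. norm (a m)) \<le> e / 4"
    using infsum_finite_approximation[OF a, of "e / 4"] e by auto
  have sF: "(\<lambda>m. norm (a m)) summable_on F" using F by simp
  have sC: "(\<lambda>m. norm (a m)) summable_on - F" by (rule summable_on_subset_banach[OF a]) simp
  have tail: "(\<Sum>\<^sub>\<infinity>m\<in>-F. norm (a m)) \<le> e / 4"
  proof -
    have "(\<Sum>\<^sub>\<infinity>m\<in>-F. norm (a m)) = (\<Sum>\<^sub>\<infinity>m. norm (a m)) - (\<Sum>m\<in>F. norm (a m))"
      using F(1) infsum_Diff[OF a sF] by (simp add: Compl_eq_Diff_UNIV)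
    then show ?thesis using F(2) unfolding dist_real_def by linarith
  qed
  define c where "c m = (if m \<in> F then 0 else a m)" for m
  have c: "norm (fejer_mean (Suc M) c) \<le> e / 4" for M
  proof -
    \<comment> \<open>For fixed j the integers j - l are distinct, so a row sums at most the tail
      outside \<open>F\<close>. There are M + 1 rows and the mean divides by M + 1, whence
      uniformity in M.\<close>
    have row: "(\<Sum>l<Suc M. norm (c (int j - int l))) \<le> e / 4" for j
    proof -
      let ?I = "(\<lambda>l. int j - int l) ` {..<Suc M}"
      have "(\<Sum>l<Suc M. norm (c (int j - int l))) = (\<Sum>m\<in>?I. norm (c m))"
        by (subst sum.reindex) (auto simp: inj_on_def)
      also have "\<dots> = (\<Sum>m\<in>?I - F. norm (a m))"
        by (intro sum.mono_neutral_cong_right) (auto simp: c_def)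
      also have "\<dots> \<le> (\<Sum>\<^sub>\<infinity>m\<in>-F. norm (a m))"
        by (intro finite_sum_le_infsum sC) auto
      finally show ?thesis using tail by simp
    qed
    have "norm (\<Sum>j<Suc M. \<Sum>l<Suc M. c (int j - int l)) \<le>
        (\<Sum>j<Suc M. \<Sum>l<Suc M. norm (c (int j - int l)))"
      by (intro order_trans[OF norm_sum] sum_mono norm_sum)
    also have "\<dots> \<le> (\<Sum>j<Suc M. e / 4)" by (intro sum_mono row)
    finally have "norm (\<Sum>j<Suc M. \<Sum>l<Suc M. c (int j - int l)) \<le> real (Suc M) * (e / 4)" by simp
    then show ?thesis
      unfolding fejer_mean_def norm_divide
          by (simp add: pos_divide_le_eq mult.commute del: of_nat_Suc sum.lessThan_Suc)
  qed
  have split: "fejer_mean M a = fejer_mean M c +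
      (\<Sum>m\<in>F. a m * fejer_mean M (\<lambda>k. if k = m then 1 else 0))" for M
  proof -
    have dec: "a k = c k + (\<Sum>m\<in>F. a m * (if k = m then 1 else 0))" for k
      using F by (auto simp: c_def if_distrib cong: if_cong)
    have "(\<Sum>j<M. \<Sum>l<M. a (int j - int l))
        = (\<Sum>j<M. \<Sum>l<M. c (int j - int l) + (\<Sum>m\<in>F. a m * (if int j - int l = m then 1 else 0)))"
      by (intro sum.cong refl dec)
    also have "\<dots> = (\<Sum>j<M. \<Sum>l<M. c (int j - int l)) +
        (\<Sum>j<M. \<Sum>l<M. \<Sum>m\<in>F. a m * (if int j - int l = m then 1 else 0))"
      by (simp only: sum.distrib)
    also have "(\<Sum>j<M. \<Sum>l<M. \<Sum>m\<in>F. a m * (if int j - int l = m then 1 else 0))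
        = (\<Sum>m\<in>F. a m * (\<Sum>j<M. \<Sum>l<M. if int j - int l = m then 1 else 0))"
      by (simp only: sum_distrib_left sum.swap[where A = "{..<M}" and B = F])
    finally show ?thesis
      by (simp only: fejer_mean_def add_divide_distrib sum_divide_distrib[where A = F]
          times_divide_eq_right)
  qed
  have "(\<lambda>M. \<Sum>m\<in>F. a m * fejer_mean (Suc M) (\<lambda>k. if k = m then 1 else 0)) \<longlonglongrightarrow> (\<Sum>m\<in>F. a m * 1)"
    by (intro tendsto_sum tendsto_mult_left fejer_mean_delta_tendsto)
  then have "(\<lambda>M. \<Sum>m\<in>F. a m * fejer_mean (Suc M) (\<lambda>k. if k = m then 1 else 0)) \<longlonglongrightarrow> (\<Sum>m\<in>F. a m)"
    by simp
  moreover have "0 < e / 4" using e by simp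
  ultimately have "\<exists>N. \<forall>M\<ge>N. norm ((\<Sum>m\<in>F. a m * fejer_mean (Suc M) (\<lambda>k. if k = m then 1 else 0)) -
      (\<Sum>m\<in>F. a m)) < e / 4"
    by (rule LIMSEQ_D)
  then obtain N where N: "\<And>M. N \<le> M \<Longrightarrow>
      norm ((\<Sum>m\<in>F. a m * fejer_mean (Suc M) (\<lambda>k. if k = m then 1 else 0)) - (\<Sum>m\<in>F. a m)) < e / 4"
    by blast
  have "infsum a UNIV - (\<Sum>m\<in>F. a m) = infsum a (- F)"
    using infsum_Diff[OF abs_summable_summable[OF a] summable_on_finite[OF F(1)]] F(1)
    by (simp add: Compl_eq_Diff_UNIV)
  moreover have "norm (infsum a (- F)) \<le> (\<Sum>\<^sub>\<infinity>m\<in>-F. norm (a m))" by (rule norm_infsum_bound[OF sC])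
  ultimately have S: "norm ((\<Sum>m\<in>F. a m) - infsum a UNIV) \<le> e / 4"
    using tail by (metis norm_minus_commute order_trans)
  show "\<exists>N. \<forall>M\<ge>N. norm (fejer_mean (Suc M) a - infsum a UNIV) < e"
  proof (intro exI allI impI)
    fix M assume "N \<le> M"
    let ?B = "\<Sum>m\<in>F. a m * fejer_mean (Suc M) (\<lambda>k. if k = m then 1 else 0)"
    have "fejer_mean (Suc M) a - infsum a UNIV
        = fejer_mean (Suc M) c + (?B - (\<Sum>m\<in>F. a m)) + ((\<Sum>m\<in>F. a m) - infsum a UNIV)"
      by (simp add: split)
    also have "norm \<dots> \<le> norm (fejer_mean (Suc M) c) + norm (?B - (\<Sum>m\<in>F. a m)) + norm
        ((\<Sum>m\<in>F. a m) - infsum a UNIV)"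
      by (meson norm_triangle_ineq order_trans add_right_mono)
    also have "\<dots> < e" using c[of M] N[OF \<open>N \<le> M\<close>] S e by linarith
    finally show "norm (fejer_mean (Suc M) a - infsum a UNIV) < e" .
  qed
qed

text \<open>Absolute summability identifies the sum with the limit of its Fejer means, which
  \<open>ikern_mean_tendsto\<close> computes.\<close>

lemma infsum_cis_ikern:
  assumes ds: "\<And>d. d \<in> set ds \<Longrightarrow> 0 < d" "\<bar>\<theta>\<bar> + sum_list ds < pi"
    and summable: "(\<lambda>m. norm (ikern ds (u - of_int m))) summable_on UNIV"
  shows "(\<Sum>\<^sub>\<infinity>m. cis (of_int m * \<theta>) * ikern ds (u - of_int m)) = cis (u * \<theta>)"
proof (rule LIMSEQ_unique)
  show "(\<lambda>M. ikern_mean ds (Suc M) u \<theta>) \<longlonglongrightarrow> (\<Sum>\<^sub>\<infinity>m. cis (of_int m * \<theta>) * ikern ds (u - of_int m))"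
    unfolding ikern_mean_def using summable by (intro fejer_mean_tendsto_infsum)
        (simp add: norm_mult)
  show "(\<lambda>M. ikern_mean ds (Suc M) u \<theta>) \<longlonglongrightarrow> cis (u * \<theta>)"
    using ds by (intro ikern_mean_tendsto) auto
qed

section \<open>Fourier inversion for band-limited functions\<close>

lemma lborel_integral_affine_euclidean:
  fixes f :: "'a::euclidean_space \<Rightarrow> complex"
  assumes [measurable]: "f \<in> borel_measurable borel" and c: "c \<noteq> 0"
  shows "(\<integral>x. f x \<partial>lborel) = of_real (\<bar>c\<bar> ^ DIM('a)) * (\<integral>x. f (t + c *\<^sub>R x) \<partial>lborel)"
proof -
  have "(\<integral>x. f x \<partial>lborel) = (\<integral>x. f x \<partial>(density (distr lborel borel (\<lambda>x. t + c *\<^sub>R x))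
      (\<lambda>_. ennreal (\<bar>c\<bar> ^ DIM('a)))))"
    using lborel_affine[OF c, of t] by simp
  also have "\<dots> = (\<integral>x. \<bar>c\<bar> ^ DIM('a) *\<^sub>R f x \<partial>distr lborel borel (\<lambda>x. t + c *\<^sub>R x))"
    by (subst integral_density) auto
  also have "\<dots> = (\<integral>x. \<bar>c\<bar> ^ DIM('a) *\<^sub>R f (t + c *\<^sub>R x) \<partial>lborel)"
    by (subst integral_distr) auto
  also have "\<dots> = \<bar>c\<bar> ^ DIM('a) *\<^sub>R (\<integral>x. f (t + c *\<^sub>R x) \<partial>lborel)"
    by (rule integral_scaleR_right)
  finally show ?thesis by (simp add: scaleR_conv_of_real)
qed

section \<open>Fourier transforms of Gaussians\<close>

lemma gaussian_1d:
  shows "integrable lborel (\<lambda>x :: real. cis (z * x) * of_real (exp (- x\<^sup>2 / 2)))"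
    and "(\<integral>x. cis (z * x) * complex_of_real (exp (- x\<^sup>2 / 2)) \<partial>lborel) = of_real
        (sqrt (2 * pi) * exp (- z\<^sup>2 / 2))"
proof -
  have int: "integrable lborel (\<lambda>x :: real. exp (- x\<^sup>2 / 2))"
    using integrable_mult_right[OF integrable_std_normal_moment[of 0], of "sqrt (2 * pi)"]
    by (simp add: std_normal_density_def)
  show i: "integrable lborel (\<lambda>x :: real. cis (z * x) * of_real (exp (- x\<^sup>2 / 2)))"
    using int by (rule Bochner_Integration.integrable_bound[OF _ _ AE_I2]) (auto simp: norm_mult)
  have "of_real (exp (- z\<^sup>2 / 2)) = (\<integral>x. cis (z * x) \<partial>std_normal_distribution)"
    using char_std_normal_distribution by (simp add: char_def fun_eq_iff cis_conv_exp)
  also have "\<dots> = (\<integral>x. std_normal_density x *\<^sub>R cis (z * x) \<partial>lborel)"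
    by (subst integral_density) auto
  also have "\<dots> = (\<integral>x. of_real (1 / sqrt (2 * pi)) * (cis (z * x) * of_real (exp (- x\<^sup>2 / 2)))
      \<partial>lborel)"
    by (intro Bochner_Integration.integral_cong)
        (auto simp: std_normal_density_def scaleR_conv_of_real)
  also have "\<dots> = of_real (1 / sqrt (2 * pi)) * (\<integral>x. cis (z * x) * of_real (exp (- x\<^sup>2 / 2)) \<partial>lborel)"
    by (rule integral_mult_right_zero)
  finally show "(\<integral>x. cis (z * x) * complex_of_real (exp (- x\<^sup>2 / 2)) \<partial>lborel) = of_real
      (sqrt (2 * pi) * exp (- z\<^sup>2 / 2))"
    by (simp add: field_simps)
qed

lemma norm_power2_eq_sum_Basis: "(norm (x :: 'a::euclidean_space))\<^sup>2 = (\<Sum>b\<in>Basis. (x \<bullet> b)\<^sup>2)"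
  unfolding power2_norm_eq_inner by (subst euclidean_inner) (simp add: power2_eq_square)

lemma cis_sum: "finite A \<Longrightarrow> cis (\<Sum>a\<in>A. f a) = (\<Prod>a\<in>A. cis (f a))"
proof (induction A rule: finite_induct)
  case (insert a A)
  then show ?case using cis_mult[of "f a" "sum f A"] by simp
qed simp

lemma gaussian_euclidean:
  fixes z :: "'a::euclidean_space"
  shows "integrable lborel (\<lambda>x. cis (z \<bullet> x) * complex_of_real (exp (- (norm x)\<^sup>2 / 2)))"
    and "(\<integral>x. cis (z \<bullet> x) * complex_of_real (exp (- (norm x)\<^sup>2 / 2)) \<partial>lborel)
      = of_real (sqrt (2 * pi) ^ DIM('a) * exp (- (norm z)\<^sup>2 / 2))"
proof -
  interpret product_sigma_finite "\<lambda>_. lborel :: real measure" ..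
  let ?g = "\<lambda>(b::'a) t. cis ((z \<bullet> b) * t) * complex_of_real (exp (- t\<^sup>2 / 2))"
  let ?f = "\<lambda>x. cis (z \<bullet> x) * complex_of_real (exp (- (norm x)\<^sup>2 / 2))"
  let ?T = "\<lambda>f :: 'a \<Rightarrow> real. \<Sum>b\<in>Basis. f b *\<^sub>R b"
  have eq: "?f (?T f) = (\<Prod>b\<in>Basis. ?g b (f b))" for f
  proof -
    have 1: "z \<bullet> ?T f = (\<Sum>b\<in>Basis. (z \<bullet> b) * f b)"
      by (simp add: inner_sum_right mult.commute)
    have 2: "- (norm (?T f))\<^sup>2 / 2 = (\<Sum>b\<in>Basis. - (f b)\<^sup>2 / 2)"
      by (simp add: norm_power2_eq_sum_Basis sum_negf sum_divide_distrib)
    show ?thesis unfolding 1 2 by (simp add: cis_sum exp_sum prod.distrib of_real_prod)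
  qed
  have fin: "integrable (\<Pi>\<^sub>M b\<in>Basis. lborel) (\<lambda>f. \<Prod>b\<in>Basis. ?g b (f b))"
    by (intro product_integrable_prod gaussian_1d finite_Basis)
  have "integrable (distr (\<Pi>\<^sub>M b\<in>Basis. lborel) borel ?T) ?f = integrable (\<Pi>\<^sub>M b\<in>Basis. lborel)
      (\<lambda>f. ?f (?T f))"
    by (rule integrable_distr_eq) auto
  then show "integrable lborel ?f"
    unfolding lborel_eq[where 'a = 'a] eq using fin by (rule iffD2)
  have "(\<integral>x. ?f x \<partial>distr (\<Pi>\<^sub>M b\<in>Basis. lborel) borel ?T) = (\<integral>f. ?f (?T f) \<partial>(\<Pi>\<^sub>M b\<in>Basis. lborel))"
    by (rule integral_distr) auto
  then have "(\<integral>x. ?f x \<partial>lborel) = (\<integral>f. (\<Prod>b\<in>Basis. ?g b (f b)) \<partial>(\<Pi>\<^sub>M b\<in>Basis. lborel))"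
    unfolding lborel_eq[where 'a = 'a] eq .
  also have "\<dots> = (\<Prod>b\<in>Basis. \<integral>t. ?g b t \<partial>lborel)"
    by (intro product_integral_prod gaussian_1d finite_Basis)
  also have "\<dots> = of_real (\<Prod>b\<in>(Basis::'a set). sqrt (2 * pi) * exp (- (z \<bullet> b)\<^sup>2 / 2))"
    by (simp only: gaussian_1d of_real_prod)
  also have "(\<Prod>b\<in>(Basis::'a set). sqrt (2 * pi) * exp (- (z \<bullet> b)\<^sup>2 / 2)) = sqrt (2 * pi) ^ DIM('a) *
      exp (- (norm z)\<^sup>2 / 2)"
    by (simp add: prod.distrib norm_power2_eq_sum_Basis exp_sum[symmetric] sum_negf
        sum_divide_distrib)
  finally show "(\<integral>x. ?f x \<partial>lborel) = of_real (sqrt (2 * pi) ^ DIM('a) * exp (- (norm z)\<^sup>2 / 2))" .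
qed

lemma gaussian_scaled:
  fixes z :: "'a::euclidean_space"
  assumes e: "0 < e"
  shows "integrable lborel (\<lambda>x::'a. exp (- (norm (e *\<^sub>R x))\<^sup>2 / 2))"
    and "(\<integral>x. cis (z \<bullet> x) * complex_of_real (exp (- (norm (e *\<^sub>R x))\<^sup>2 / 2)) \<partial>lborel)
      = of_real ((sqrt (2 * pi) / e) ^ DIM('a) * exp (- (norm (z /\<^sub>R e))\<^sup>2 / 2))"
proof -
  have "integrable lborel (\<lambda>x::'a. norm (cis (0 \<bullet> x) * complex_of_real (exp (- (norm x)\<^sup>2 / 2))))"
    by (intro integrable_norm gaussian_euclidean)
  then have "integrable lborel (\<lambda>x::'a. exp (- (norm x)\<^sup>2 / 2))" by simp
  then have "integrable (density (distr lborel borel (\<lambda>x. 0 + e *\<^sub>R x))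
      (\<lambda>_. ennreal (\<bar>e\<bar> ^ DIM('a)))) (\<lambda>x::'a. exp (- (norm x)\<^sup>2 / 2))"
    using lborel_affine[of e "0::'a"] e by simp
  then show "integrable lborel (\<lambda>x::'a. exp (- (norm (e *\<^sub>R x))\<^sup>2 / 2))"
    using e by (subst (asm) integrable_density) (auto simp: integrable_distr_eq)
  have "(\<integral>x. cis ((z /\<^sub>R e) \<bullet> x) * complex_of_real (exp (- (norm x)\<^sup>2 / 2)) \<partial>lborel)
      = of_real (\<bar>e\<bar> ^ DIM('a)) * (\<integral>x. cis ((z /\<^sub>R e) \<bullet> (0 + e *\<^sub>R x)) * complex_of_real
          (exp (- (norm (0 + e *\<^sub>R x))\<^sup>2 / 2)) \<partial>lborel)"
    using e by (intro lborel_integral_affine_euclidean) auto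
  moreover have "(z /\<^sub>R e) \<bullet> (0 + e *\<^sub>R x) = z \<bullet> x" for x
    using e by simp
  ultimately have "of_real (sqrt (2 * pi) ^ DIM('a) * exp (- (norm (z /\<^sub>R e))\<^sup>2 / 2))
      = of_real (e ^ DIM('a)) * (\<integral>x. cis (z \<bullet> x) * complex_of_real (exp (- (norm (e *\<^sub>R x))\<^sup>2 / 2))
          \<partial>lborel)"
    (is "?l = _ * ?I")
    using e by (simp only: gaussian_euclidean abs_of_pos add_0_left)
  then have "?I = ?l / of_real (e ^ DIM('a))" using e by simp
  then show "?I = of_real ((sqrt (2 * pi) / e) ^ DIM('a) * exp (- (norm (z /\<^sub>R e))\<^sup>2 / 2))"
    by (simp add: power_divide)
qed

text \<open>Asks for an explicit integral over frequencies of norm at most \<open>R\<close>, since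
  sampling and differentiation are both carried out under this integral. Constants are absorbed in
  \<open>H\<close>.\<close>

definition band_limited :: "real \<Rightarrow> ('a::euclidean_space \<Rightarrow> complex) \<Rightarrow> bool"
  where "band_limited R g \<longleftrightarrow> (\<exists>H. integrable lborel H \<and> (\<forall>\<xi>. R < norm \<xi> \<longrightarrow> H \<xi> = 0) \<and>
    (\<forall>x. g x = (\<integral>\<xi>. H \<xi> * cis (x \<bullet> \<xi>) \<partial>lborel)))"

text \<open>Fourier inversion by Gaussian regularisation. The transform is bounded and vanishes
  outside a ball, hence integrable, so the regularised inversion integrals converge to the
  unregularised one; they are also Gaussian averages of \<open>g\<close>, which converge to a
  multiple of \<open>g x\<close>.\<close>

lemma band_limitedI:
  fixes g :: "'a::euclidean_space \<Rightarrow> complex"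
  assumes cont: "continuous_on UNIV g" and int: "integrable lborel g" and B: "\<And>x. norm (g x) \<le> B"
    and R: "\<And>\<xi>. R < norm \<xi> \<Longrightarrow> (\<integral>y. cis (- (y \<bullet> \<xi>)) * g y \<partial>lborel) = 0"
  shows "band_limited R g"
proof -
  have [measurable]: "g \<in> borel_measurable borel" using cont
      by (rule borel_measurable_continuous_onI)
  define G where "G \<xi> = (\<integral>y. cis (- (y \<bullet> \<xi>)) * g y \<partial>lborel)" for \<xi>
  have [measurable]: "G \<in> borel_measurable borel" unfolding G_def by measurable
  define L where "L = (\<integral>y. norm (g y) \<partial>lborel)"
  have GL: "norm (G \<xi>) \<le> L" for \<xi>
  proof -
    have "norm (G \<xi>) \<le> (\<integral>y. norm (cis (- (y \<bullet> \<xi>)) * g y) \<partial>lborel)"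
      unfolding G_def by (rule integral_norm_bound)
    then show ?thesis by (simp add: L_def norm_mult)
  qed
  have L: "0 \<le> L" by (simp add: L_def)
  have intG: "integrable lborel G"
  proof (rule Bochner_Integration.integrable_bound[OF _ _ AE_I2])
    show "integrable lborel (\<lambda>\<xi>::'a. L * indicator (cball 0 R) \<xi>)"
      by (intro integrable_mult_right integrable_real_indicator emeasure_lborel_cball_finite) auto
    show "norm (G \<xi>) \<le> norm (L * indicator (cball 0 R) \<xi>)" for \<xi>
      using GL R L by (cases "norm \<xi> \<le> R") (auto simp: G_def not_le)
  qed auto
  define c where "c = (2 * pi) ^ DIM('a)"
  have c: "0 < c" by (simp add: c_def)
  have inv: "(\<integral>\<xi>. G \<xi> * cis (x \<bullet> \<xi>) \<partial>lborel) = of_real c * g x" for x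
  proof (rule LIMSEQ_unique)
    define e where "e k = inverse (real (Suc k))" for k
    have e: "0 < e k" for k by (simp add: e_def)
    have e0: "e \<longlonglongrightarrow> 0" unfolding e_def by (rule LIMSEQ_inverse_real_of_nat)
    let ?J = "\<lambda>k. \<integral>\<xi>. G \<xi> * cis (x \<bullet> \<xi>) * of_real (exp (- (norm (e k *\<^sub>R \<xi>))\<^sup>2 / 2)) \<partial>lborel"
    show "?J \<longlonglongrightarrow> (\<integral>\<xi>. G \<xi> * cis (x \<bullet> \<xi>) \<partial>lborel)"
    proof (rule integral_dominated_convergence[where w = "\<lambda>\<xi>. norm (G \<xi>)"])
      show "AE \<xi> in lborel. (\<lambda>k. G \<xi> * cis (x \<bullet> \<xi>) * of_real (exp (- (norm (e k *\<^sub>R \<xi>))\<^sup>2 / 2))) \<longlonglongrightarrow> G \<xi>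
          * cis (x \<bullet> \<xi>)"
      proof (rule AE_I2)
        fix \<xi> :: 'a
        have "(\<lambda>k. G \<xi> * cis (x \<bullet> \<xi>) * of_real (exp (- (norm (e k *\<^sub>R \<xi>))\<^sup>2 / 2)))
            \<longlonglongrightarrow> G \<xi> * cis (x \<bullet> \<xi>) * of_real (exp (- (norm (0 *\<^sub>R \<xi>))\<^sup>2 / 2))"
          by (intro tendsto_intros e0) auto
        then show "(\<lambda>k. G \<xi> * cis (x \<bullet> \<xi>) * of_real (exp (- (norm (e k *\<^sub>R \<xi>))\<^sup>2 / 2))) \<longlonglongrightarrow> G \<xi> * cis
            (x \<bullet> \<xi>)"
          by simp
      qed
      show "AE \<xi> in lborel. norm (G \<xi> * cis (x \<bullet> \<xi>) * of_real (exp (- (norm (e k *\<^sub>R \<xi>))\<^sup>2 / 2))) \<le>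
          norm (G \<xi>)" for k
        by (rule AE_I2) (simp add: norm_mult mult_left_le)
    qed (use intG in auto)
    have J: "?J k = (\<integral>w. g (x + e k *\<^sub>R w) * of_real
        (sqrt (2 * pi) ^ DIM('a) * exp (- (norm w)\<^sup>2 / 2)) \<partial>lborel)" for k
    proof -
      let ?\<gamma> = "\<lambda>\<xi>::'a. complex_of_real (exp (- (norm (e k *\<^sub>R \<xi>))\<^sup>2 / 2))"
      \<comment> \<open>The Gaussian in \<xi> makes the double integral absolutely convergent, so
        that the order of integration may be changed.\<close>
      have prod: "integrable (lborel \<Otimes>\<^sub>M lborel) (\<lambda>(\<xi>, y). cis ((x - y) \<bullet> \<xi>) * ?\<gamma> \<xi> * g y)"
      proof (rule lborel_pair.Fubini_integrable)
        have "(\<integral>y. norm (cis ((x - y) \<bullet> \<xi>) * ?\<gamma> \<xi> * g y) \<partial>lborel) = exp (- (norm (e k *\<^sub>R \<xi>))\<^sup>2 / 2) *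
            L" for \<xi>
          by (simp add: norm_mult L_def)
        then show "integrable lborel (\<lambda>\<xi>. \<integral>y. norm
            (case (\<xi>, y) of (\<xi>, y) \<Rightarrow> cis ((x - y) \<bullet> \<xi>) * ?\<gamma> \<xi> * g y) \<partial>lborel)"
          unfolding prod.case using gaussian_scaled(1)[OF e[of k], where 'a = 'a] by simp
        show "AE \<xi> in lborel. integrable lborel
            (\<lambda>y. case (\<xi>, y) of (\<xi>, y) \<Rightarrow> cis ((x - y) \<bullet> \<xi>) * ?\<gamma> \<xi> * g y)"
        proof (rule AE_I2)
          fix \<xi> :: 'a
          have "integrable lborel (\<lambda>y. norm (?\<gamma> \<xi>) * norm (g y))" using int by simp
          then show "integrable lborel (\<lambda>y. case (\<xi>, y) of (\<xi>, y) \<Rightarrow> cis ((x - y) \<bullet> \<xi>) * ?\<gamma> \<xi> * g y)"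
            unfolding prod.case
            by (rule Bochner_Integration.integrable_bound[OF _ _ AE_I2]) (auto simp: norm_mult)
        qed
      qed auto
      have "?J k = (\<integral>\<xi>. (\<integral>y. cis ((x - y) \<bullet> \<xi>) * ?\<gamma> \<xi> * g y \<partial>lborel) \<partial>lborel)"
      proof (rule Bochner_Integration.integral_cong[OF refl])
        fix \<xi> :: 'a
        have "(\<integral>y. cis ((x - y) \<bullet> \<xi>) * ?\<gamma> \<xi> * g y \<partial>lborel) =
            (\<integral>y. (cis (x \<bullet> \<xi>) * ?\<gamma> \<xi>) * (cis (- (y \<bullet> \<xi>)) * g y) \<partial>lborel)"
        proof (rule Bochner_Integration.integral_cong[OF refl])
          fix y
          have "cis ((x - y) \<bullet> \<xi>) = cis (x \<bullet> \<xi>) * cis (- (y \<bullet> \<xi>))"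
              by (simp add: inner_diff_left cis_mult)
          then show "cis ((x - y) \<bullet> \<xi>) * ?\<gamma> \<xi> * g y = (cis (x \<bullet> \<xi>) * ?\<gamma> \<xi>) *
              (cis (- (y \<bullet> \<xi>)) * g y)"
            by (simp only: mult_ac)
        qed
        also have "\<dots> = (cis (x \<bullet> \<xi>) * ?\<gamma> \<xi>) * G \<xi>"
          unfolding G_def by (rule integral_mult_right_zero)
        finally show "G \<xi> * cis (x \<bullet> \<xi>) * ?\<gamma> \<xi> = (\<integral>y. cis ((x - y) \<bullet> \<xi>) * ?\<gamma> \<xi> * g y \<partial>lborel)"
          by (simp only: mult_ac)
      qed
      also have "\<dots> = (\<integral>y. (\<integral>\<xi>. cis ((x - y) \<bullet> \<xi>) * ?\<gamma> \<xi> * g y \<partial>lborel) \<partial>lborel)"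
        using lborel_pair.Fubini_integral[OF prod] by simp
      also have "\<dots> = (\<integral>y. of_real ((sqrt (2 * pi) / e k) ^ DIM('a) * exp
          (- (norm ((x - y) /\<^sub>R e k))\<^sup>2 / 2)) * g y \<partial>lborel)"
        by (simp only: integral_mult_left_zero gaussian_scaled[OF e])
      also have "\<dots> = of_real (\<bar>e k\<bar> ^ DIM('a)) *
          (\<integral>w. of_real ((sqrt (2 * pi) / e k) ^ DIM('a) * exp
          (- (norm ((x - (x + e k *\<^sub>R w)) /\<^sub>R e k))\<^sup>2 / 2)) * g (x + e k *\<^sub>R w) \<partial>lborel)"
        using e[of k] by (intro lborel_integral_affine_euclidean) auto
      also have "\<dots> = (\<integral>w. of_real (\<bar>e k\<bar> ^ DIM('a)) *
          (of_real ((sqrt (2 * pi) / e k) ^ DIM('a) * exp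
          (- (norm ((x - (x + e k *\<^sub>R w)) /\<^sub>R e k))\<^sup>2 / 2)) * g (x + e k *\<^sub>R w)) \<partial>lborel)"
        by (rule integral_mult_right_zero[symmetric])
      also have "\<dots> = (\<integral>w. g (x + e k *\<^sub>R w) * of_real
          (sqrt (2 * pi) ^ DIM('a) * exp (- (norm w)\<^sup>2 / 2)) \<partial>lborel)"
        using e[of k] by (intro Bochner_Integration.integral_cong refl)
            (simp add: power_divide field_simps)
      finally show ?thesis .
    qed
    have "?J \<longlonglongrightarrow> (\<integral>w. g x * of_real (sqrt (2 * pi) ^ DIM('a) * exp (- (norm (w::'a))\<^sup>2 / 2)) \<partial>lborel)"
      unfolding J
    proof (rule integral_dominated_convergence[where w = "\<lambda>w. B *
        (sqrt (2 * pi) ^ DIM('a) * exp (- (norm (1 *\<^sub>R w))\<^sup>2 / 2))"])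
      show "integrable lborel (\<lambda>w::'a. B * (sqrt (2 * pi) ^ DIM('a) * exp
          (- (norm (1 *\<^sub>R w))\<^sup>2 / 2)))"
        by (intro integrable_mult_right gaussian_scaled) auto
      show "AE w in lborel. (\<lambda>k. g (x + e k *\<^sub>R w) * of_real
          (sqrt (2 * pi) ^ DIM('a) * exp (- (norm w)\<^sup>2 / 2)))
          \<longlonglongrightarrow> g x * of_real (sqrt (2 * pi) ^ DIM('a) * exp (- (norm w)\<^sup>2 / 2))"
      proof (rule AE_I2)
        fix w :: 'a
        have "(\<lambda>k. x + e k *\<^sub>R w) \<longlonglongrightarrow> x + 0 *\<^sub>R w" by (intro tendsto_intros e0)
        then have "(\<lambda>k. g (x + e k *\<^sub>R w)) \<longlonglongrightarrow> g x"
          using cont by (intro isCont_tendsto_compose[where g = g])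
              (auto simp: continuous_on_eq_continuous_at)
        then show "(\<lambda>k. g (x + e k *\<^sub>R w) * of_real
            (sqrt (2 * pi) ^ DIM('a) * exp (- (norm w)\<^sup>2 / 2)))
          \<longlonglongrightarrow> g x * of_real (sqrt (2 * pi) ^ DIM('a) * exp (- (norm w)\<^sup>2 / 2))"
          by (rule tendsto_mult_right)
      qed
      show "AE w in lborel. norm (g (x + e k *\<^sub>R w) * of_real
          (sqrt (2 * pi) ^ DIM('a) * exp (- (norm w)\<^sup>2 / 2)))
          \<le> B * (sqrt (2 * pi) ^ DIM('a) * exp (- (norm (1 *\<^sub>R w))\<^sup>2 / 2))" for k
        by (rule AE_I2) (auto simp: norm_mult norm_power intro!: mult_right_mono B)
    qed auto
    also have "(\<integral>w. g x * of_real (sqrt (2 * pi) ^ DIM('a) * exp (- (norm (w::'a))\<^sup>2 / 2)) \<partial>lborel) =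
        of_real c * g x"
    proof -
      have "(\<integral>w. g x * of_real (sqrt (2 * pi) ^ DIM('a) * exp (- (norm (w::'a))\<^sup>2 / 2)) \<partial>lborel)
          = (\<integral>w. g x * of_real (sqrt (2 * pi) ^ DIM('a)) *
              (cis (0 \<bullet> w) * of_real (exp (- (norm (w::'a))\<^sup>2 / 2))) \<partial>lborel)"
        by (simp add: mult_ac)
      also have "\<dots> = g x * of_real (sqrt (2 * pi) ^ DIM('a)) * of_real
          (sqrt (2 * pi) ^ DIM('a) * exp (- (norm (0::'a))\<^sup>2 / 2))"
        by (simp only: integral_mult_right_zero gaussian_euclidean)
      also have "\<dots> = g x * of_real (sqrt (2 * pi) ^ DIM('a) *
          (sqrt (2 * pi) ^ DIM('a) * exp (- (norm (0::'a))\<^sup>2 / 2)))"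
        by (simp only: of_real_mult mult.assoc)
      also have "sqrt (2 * pi) ^ DIM('a) * (sqrt (2 * pi) ^ DIM('a) * exp (- (norm (0::'a))\<^sup>2 / 2)) =
          c"
      proof -
        have "sqrt (2 * pi) ^ DIM('a) * sqrt (2 * pi) ^ DIM('a) = c"
          unfolding c_def power_mult_distrib[symmetric] by simp
        then show ?thesis by simp
      qed
      also have "g x * of_real c = of_real c * g x" by (rule mult.commute)
      finally show ?thesis .
    qed
    finally show "?J \<longlonglongrightarrow> of_real c * g x" .
  qed
  show ?thesis
    unfolding band_limited_def
  proof (intro exI conjI allI impI)
    show "integrable lborel (\<lambda>\<xi>. G \<xi> / of_real c)" using intG by simp
    show "G \<xi> / of_real c = 0" if "R < norm \<xi>" for \<xi> using R[OF that] by (simp add: G_def)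
    show "g x = (\<integral>\<xi>. G \<xi> / of_real c * cis (x \<bullet> \<xi>) \<partial>lborel)" for x
    proof -
      have "(\<integral>\<xi>. G \<xi> / of_real c * cis (x \<bullet> \<xi>) \<partial>lborel) =
          (\<integral>\<xi>. G \<xi> * cis (x \<bullet> \<xi>) / of_real c \<partial>lborel)" by simp
      also have "\<dots> = g x" using c by (simp only: integral_divide_zero inv) simp
      finally show ?thesis by simp
    qed
  qed
qed

section \<open>Schwartz functions and tempered distributions\<close>

definition smooth :: "('n::finite) cfun \<Rightarrow> bool"
  where "smooth g \<longleftrightarrow> (\<forall>is x. partials is g differentiable (at x))"

lemma smoothD: "smooth g \<Longrightarrow> partials is g differentiable (at x)"
  by (simp add: smooth_def)

lemma schwartz_smooth: "\<psi> \<in> schwartz \<Longrightarrow> smooth \<psi>"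
  by (simp add: schwartz_def smooth_def)

lemma partial_eqI: "(g has_derivative D) (at x) \<Longrightarrow> partial i g x = D (axis i 1)"
  by (simp add: partial_def frechet_derivative_at[symmetric])

lemma partials_add:
  assumes "smooth g" "smooth h"
  shows "partials is (\<lambda>x. g x + h x) = (\<lambda>x. partials is g x + partials is h x)"
proof (induction "is")
  case (Cons i js)
  have "partial i (\<lambda>x. partials js g x + partials js h x) x = partial i (partials js g) x + partial
      i (partials js h) x" for x
  proof -
    have "(partials js g has_derivative frechet_derivative (partials js g) (at x)) (at x)"
      "(partials js h has_derivative frechet_derivative (partials js h) (at x)) (at x)"
      using assms[THEN smoothD] frechet_derivative_works by blast+
    from partial_eqI[OF has_derivative_add[OF this], of i] show ?thesis by (simp add: partial_def)
  qed
  then show ?case using Cons by simp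
qed simp

lemma partials_cmult:
  assumes "smooth g"
  shows "partials is (\<lambda>x. c * g x) = (\<lambda>x. c * partials is g x)"
proof (induction "is")
  case (Cons i js)
  have "partial i (\<lambda>x. c * partials js g x) x = c * partial i (partials js g) x" for x
  proof -
    have "(partials js g has_derivative frechet_derivative (partials js g) (at x)) (at x)"
      using assms[THEN smoothD] frechet_derivative_works by blast
    from partial_eqI[OF has_derivative_mult_right[OF this, of c], of i] show ?thesis
        by (simp add: partial_def)
  qed
  then show ?case using Cons by simp
qed simp

lemma partials_affine:
  assumes "smooth g"
  shows "partials is (\<lambda>y. g (z + a *\<^sub>R y)) = (\<lambda>y. of_real (a ^ length is) * partials is g
      (z + a *\<^sub>R y))"
proof (induction "is")
  case (Cons i js)
  have "partial i (\<lambda>y. of_real (a ^ length js) * partials js g (z + a *\<^sub>R y)) y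
      = of_real (a ^ length (i # js)) * partial i (partials js g) (z + a *\<^sub>R y)" for y
  proof -
    let ?D = "frechet_derivative (partials js g) (at (z + a *\<^sub>R y))"
    have D: "(partials js g has_derivative ?D) (at (z + a *\<^sub>R y))"
      using assms[THEN smoothD] frechet_derivative_works by blast
    have "((\<lambda>y. z + a *\<^sub>R y) has_derivative (\<lambda>v. a *\<^sub>R v)) (at y)"
      by (auto intro!: derivative_eq_intros)
    then have "((\<lambda>y. partials js g (z + a *\<^sub>R y)) has_derivative (\<lambda>v. ?D (a *\<^sub>R v))) (at y)"
      by (rule has_derivative_compose[where g = "partials js g" and f = "\<lambda>y. z + a *\<^sub>R y"]) (rule D)
    from partial_eqI[OF has_derivative_mult_right[OF this, of "of_real (a ^ length js)"], of i]
    have "partial i (\<lambda>y. of_real (a ^ length js) * partials js g (z + a *\<^sub>R y)) y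
        = of_real (a ^ length js) * ?D (a *\<^sub>R axis i 1)" .
    moreover have "?D (a *\<^sub>R axis i 1) = of_real a * partial i (partials js g) (z + a *\<^sub>R y)"
      using linear_scale[OF has_derivative_linear[OF D], of a "axis i 1"]
      by (simp add: partial_def scaleR_conv_of_real)
    ultimately show ?thesis by simp
  qed
  then show ?case using Cons by simp
qed simp

lemma smooth_add: "smooth g \<Longrightarrow> smooth h \<Longrightarrow> smooth (\<lambda>x. g x + h x)"
  unfolding smooth_def[of "\<lambda>x. g x + h x"] by (simp add: partials_add smoothD)

lemma smooth_cmult: "smooth g \<Longrightarrow> smooth (\<lambda>x. c * g x)"
  unfolding smooth_def[of "\<lambda>x. c * g x"] by (simp add: partials_cmult smoothD)

lemma smooth_affine: "smooth g \<Longrightarrow> smooth (\<lambda>y. g (z + a *\<^sub>R y))"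
  unfolding smooth_def[of "\<lambda>y. g (z + a *\<^sub>R y)"]
proof (intro allI)
  fix js y assume g: "smooth g"
  have "(\<lambda>y. partials js g (z + a *\<^sub>R y)) differentiable (at y)"
    by (rule differentiable_compose[of "partials js g" "\<lambda>y. z + a *\<^sub>R y", OF smoothD[OF g]]) simp
  then show "partials js (\<lambda>y. g (z + a *\<^sub>R y)) differentiable (at y)"
    by (simp add: partials_affine[OF g])
qed

lemma schwartz_norm_upper:
  "length is \<le> m \<Longrightarrow> ennreal ((1 + norm x) ^ m * norm (partials is \<psi> x)) \<le> schwartz_norm m \<psi>"
  unfolding schwartz_norm_def by (rule SUP_upper2[of "is"]) (auto intro: SUP_upper)

lemma schwartz_norm_least:
  "(\<And>is x. length is \<le> m \<Longrightarrow> ennreal ((1 + norm x) ^ m * norm (partials is \<psi> x)) \<le> B) \<Longrightarrow> schwartz_norm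
      m \<psi> \<le> B"
  unfolding schwartz_norm_def by (intro SUP_least) auto

lemma schwartz_norm_mono:
  fixes \<psi> :: "('n::finite) cfun"
  shows "m \<le> m' \<Longrightarrow> schwartz_norm m \<psi> \<le> schwartz_norm m' \<psi>"
proof (rule schwartz_norm_least)
  fix js :: "'n list" and x assume "m \<le> m'" "length js \<le> m"
  then have "ennreal ((1 + norm x) ^ m * norm (partials js \<psi> x)) \<le> ennreal
      ((1 + norm x) ^ m' * norm (partials js \<psi> x))"
    by (intro ennreal_leI mult_right_mono power_increasing) auto
  also have "\<dots> \<le> schwartz_norm m' \<psi>" using \<open>m \<le> m'\<close> \<open>length js \<le> m\<close> by (intro schwartz_norm_upper)
      auto
  finally show "ennreal ((1 + norm x) ^ m * norm (partials js \<psi> x)) \<le> schwartz_norm m' \<psi>" .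
qed

lemma schwartz_norm_add:
  fixes g h :: "('n::finite) cfun"
  assumes "smooth g" "smooth h"
  shows "schwartz_norm m (\<lambda>x. g x + h x) \<le> schwartz_norm m g + schwartz_norm m h"
proof (rule schwartz_norm_least)
  fix js :: "'n list" and x assume l: "length js \<le> m"
  have "ennreal ((1 + norm x) ^ m * norm (partials js (\<lambda>x. g x + h x) x))
      \<le> ennreal ((1 + norm x) ^ m * norm (partials js g x) + (1 + norm x) ^ m * norm
          (partials js h x))"
    unfolding partials_add[OF assms] by (intro ennreal_leI)
        (simp add: norm_triangle_ineq mult_left_mono flip: distrib_left)
  also have "\<dots> \<le> schwartz_norm m g + schwartz_norm m h"
    using l by (simp add: add_mono schwartz_norm_upper)
  finally show "ennreal ((1 + norm x) ^ m * norm (partials js (\<lambda>x. g x + h x) x)) \<le> schwartz_norm m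
      g + schwartz_norm m h" .
qed

lemma schwartz_norm_cmult:
  fixes g :: "('n::finite) cfun"
  assumes "smooth g"
  shows "schwartz_norm m (\<lambda>x. c * g x) \<le> ennreal (norm c) * schwartz_norm m g"
proof (rule schwartz_norm_least)
  fix js :: "'n list" and x assume l: "length js \<le> m"
  have "ennreal ((1 + norm x) ^ m * norm (partials js (\<lambda>x. c * g x) x))
      = ennreal (norm c) * ennreal ((1 + norm x) ^ m * norm (partials js g x))"
    by (simp add: partials_cmult[OF assms] norm_mult mult_ac flip: ennreal_mult)
  also have "\<dots> \<le> ennreal (norm c) * schwartz_norm m g"
    using l by (intro mult_left_mono schwartz_norm_upper) auto
  finally show "ennreal ((1 + norm x) ^ m * norm (partials js (\<lambda>x. c * g x) x)) \<le> ennreal (norm c) *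
      schwartz_norm m g" .
qed

lemma schwartzI: "smooth \<psi> \<Longrightarrow> (\<And>m. schwartz_norm m \<psi> < \<infinity>) \<Longrightarrow> \<psi> \<in> schwartz"
  by (simp add: schwartz_def smooth_def)

lemma schwartz_norm_finite: "\<psi> \<in> schwartz \<Longrightarrow> schwartz_norm m \<psi> < \<infinity>"
  by (simp add: schwartz_def)

lemma schwartz_add:
  assumes "g \<in> schwartz" "h \<in> schwartz" shows "(\<lambda>x. g x + h x) \<in> schwartz"
proof (rule schwartzI)
  show "smooth (\<lambda>x. g x + h x)" using assms[THEN schwartz_smooth] by (rule smooth_add)
  fix m
  have "schwartz_norm m (\<lambda>x. g x + h x) \<le> schwartz_norm m g + schwartz_norm m h"
    using assms[THEN schwartz_smooth] by (rule schwartz_norm_add)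
  also have "\<dots> < \<infinity>" using assms[THEN schwartz_norm_finite] by (simp add: less_top)
  finally show "schwartz_norm m (\<lambda>x. g x + h x) < \<infinity>" .
qed

lemma schwartz_cmult:
  assumes "g \<in> schwartz" shows "(\<lambda>x. c * g x) \<in> schwartz"
proof (rule schwartzI)
  show "smooth (\<lambda>x. c * g x)" using assms[THEN schwartz_smooth] by (rule smooth_cmult)
  fix m
  have "schwartz_norm m (\<lambda>x. c * g x) \<le> ennreal (norm c) * schwartz_norm m g"
    using assms[THEN schwartz_smooth] by (rule schwartz_norm_cmult)
  also have "\<dots> < \<infinity>" using assms[THEN schwartz_norm_finite, of m]
      by (simp add: ennreal_mult_less_top)
  finally show "schwartz_norm m (\<lambda>x. c * g x) < \<infinity>" .
qed

lemma schwartz_diff: "g \<in> schwartz \<Longrightarrow> h \<in> schwartz \<Longrightarrow> (\<lambda>x. g x - h x) \<in> schwartz"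
  using schwartz_add[of g "\<lambda>x. - 1 * h x"] schwartz_cmult[of h "- 1"] by simp

lemma partials_zero: "partials is (\<lambda>x :: real ^ 'n::finite. 0) = (\<lambda>x. 0)"
proof (induction "is")
  case (Cons i js)
  have "partial i (\<lambda>x :: real ^ 'n. 0) = (\<lambda>x. 0)"
    by (rule ext, rule partial_eqI[OF has_derivative_const])
  then show ?case using Cons by simp
qed simp

lemma schwartz_norm_zero [simp]: "schwartz_norm m (\<lambda>x :: real ^ 'n::finite. 0) = 0"
proof -
  have "schwartz_norm m (\<lambda>x :: real ^ 'n. 0) \<le> 0"
    by (rule schwartz_norm_least) (simp add: partials_zero)
  then show ?thesis by simp
qed

lemma schwartz_zero: "(\<lambda>x :: real ^ 'n::finite. 0) \<in> schwartz"
  by (simp add: schwartz_def partials_zero)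

lemma schwartz_sum:
  "(\<And>i. i \<in> F \<Longrightarrow> g i \<in> schwartz) \<Longrightarrow> (\<lambda>x. \<Sum>i\<in>F. g i x) \<in> schwartz"
proof (induction F rule: infinite_finite_induct)
  case (insert i F)
  then show ?case by (simp add: schwartz_add)
qed (simp_all add: schwartz_zero)

definition snorm :: "nat \<Rightarrow> ('n::finite) cfun \<Rightarrow> real"
  where "snorm m \<psi> = enn2real (schwartz_norm m \<psi>)"

lemma snorm_nonneg: "0 \<le> snorm m \<psi>"
  by (simp add: snorm_def)

lemma ennreal_snorm: "\<psi> \<in> schwartz \<Longrightarrow> ennreal (snorm m \<psi>) = schwartz_norm m \<psi>"
  using schwartz_norm_finite[of \<psi> m] by (simp add: snorm_def)

lemma snorm_bound:
  assumes "\<psi> \<in> schwartz" "length is \<le> m"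
  shows "(1 + norm x) ^ m * norm (partials is \<psi> x) \<le> snorm m \<psi>"
  using schwartz_norm_upper[OF assms(2), of x \<psi>] assms(1)
  by (simp add: ennreal_snorm[symmetric] ennreal_le_iff snorm_nonneg)

lemma partials_bound:
  assumes "\<psi> \<in> schwartz" "length is \<le> m"
  shows "norm (partials is \<psi> x) \<le> snorm m \<psi> / (1 + norm x) ^ m"
proof -
  have "0 < (1 + norm x) ^ m" by (simp add: add_pos_nonneg)
  then show ?thesis using snorm_bound[OF assms, of x] by (simp add: pos_le_divide_eq mult.commute)
qed

lemma snorm_le:
  assumes "\<psi> \<in> schwartz" "0 \<le> B" "\<And>is x. length is \<le> m \<Longrightarrow> (1 + norm x) ^ m * norm (partials is \<psi> x) \<le>
      B"
  shows "snorm m \<psi> \<le> B"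
proof -
  have "schwartz_norm m \<psi> \<le> ennreal B" using assms by (intro schwartz_norm_least ennreal_leI) auto
  then show ?thesis using assms by (simp add: ennreal_snorm[symmetric] ennreal_le_iff)
qed

text \<open>Submultiplicativity of the polynomial weights, by which decay estimates survive
  translations.\<close>

lemma one_plus_norm_le:
  fixes y :: "'a::real_normed_vector" and u :: "'b::real_normed_vector" and v ::
      "'c::real_normed_vector"
  assumes "norm y \<le> norm u + norm v" shows "(1 + norm y) ^ m \<le> (1 + norm u) ^ m * (1 + norm v) ^ m"
proof -
  have "1 + norm y \<le> (1 + norm u) * (1 + norm v)"
  proof -
    have "(1 + norm u) * (1 + norm v) = 1 + norm u + norm v + norm u * norm v"
      by (simp add: algebra_simps)
    moreover have "0 \<le> norm u * norm v" by simp
    ultimately show ?thesis using assms by linarith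
  qed
  then show ?thesis unfolding power_mult_distrib[symmetric] by (intro power_mono) auto
qed

lemma norm_le_affine:
  fixes y z :: "'a::real_normed_vector"
  assumes "1 \<le> \<bar>a\<bar>" shows "norm y \<le> norm z + norm (z + a *\<^sub>R y)"
proof -
  have "norm y \<le> \<bar>a\<bar> * norm y" using assms mult_right_mono[of 1 "\<bar>a\<bar>" "norm y"] by simp
  also have "\<dots> = norm ((z + a *\<^sub>R y) - z)" by simp
  also have "\<dots> \<le> norm (z + a *\<^sub>R y) + norm z" by (rule norm_triangle_ineq4)
  finally show ?thesis by simp
qed

text \<open>Because |a| \<ge> 1, the weight at \<open>y\<close> is at most the product of those at
  \<open>z\<close> and at \<open>z + a *\<^sub>R y\<close>, and the second is absorbed by the decay
  of \<open>g\<close>.\<close>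

lemma schwartz_affine:
  fixes g :: "('n::finite) cfun"
  assumes g: "g \<in> schwartz" and a: "1 \<le> \<bar>a\<bar>"
  shows "(\<lambda>y. g (z + a *\<^sub>R y)) \<in> schwartz"
proof (rule schwartzI)
  show "smooth (\<lambda>y. g (z + a *\<^sub>R y))" using g by (intro smooth_affine schwartz_smooth)
  fix m
  have "schwartz_norm m (\<lambda>y. g (z + a *\<^sub>R y)) \<le> ennreal (\<bar>a\<bar> ^ m * ((1 + norm z) ^ m * snorm m g))"
  proof (rule schwartz_norm_least, rule ennreal_leI)
    fix js :: "'n list" and y assume l: "length js \<le> m"
    have "(1 + norm y) ^ m * norm (partials js (\<lambda>y. g (z + a *\<^sub>R y)) y)
        = \<bar>a\<bar> ^ length js * ((1 + norm y) ^ m * norm (partials js g (z + a *\<^sub>R y)))"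
      by (simp add: partials_affine[OF schwartz_smooth[OF g]] norm_mult norm_power)
    also have "\<dots> \<le> \<bar>a\<bar> ^ m * (((1 + norm z) ^ m * (1 + norm (z + a *\<^sub>R y)) ^ m) * norm
        (partials js g (z + a *\<^sub>R y)))"
      using a l by (intro mult_mono power_increasing mult_right_mono one_plus_norm_le
          norm_le_affine) auto
    also have "\<dots> = \<bar>a\<bar> ^ m * ((1 + norm z) ^ m *
        ((1 + norm (z + a *\<^sub>R y)) ^ m * norm (partials js g (z + a *\<^sub>R y))))"
      by (simp only: mult.assoc)
    also have "\<dots> \<le> \<bar>a\<bar> ^ m * ((1 + norm z) ^ m * snorm m g)"
      by (intro mult_left_mono snorm_bound g l) auto
    finally show "(1 + norm y) ^ m * norm (partials js (\<lambda>y. g (z + a *\<^sub>R y)) y) \<le> \<bar>a\<bar> ^ m *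
        ((1 + norm z) ^ m * snorm m g)" .
  qed
  also have "\<dots> < \<infinity>" by simp
  finally show "schwartz_norm m (\<lambda>y. g (z + a *\<^sub>R y)) < \<infinity>" .
qed

section \<open>Linearity and boundedness of tempered distributions\<close>

lemma tempered_add: "f \<in> tempered \<Longrightarrow> g \<in> schwartz \<Longrightarrow> h \<in> schwartz \<Longrightarrow> f (\<lambda>x. g x + h x) = f g + f h"
  and tempered_cmult: "f \<in> tempered \<Longrightarrow> g \<in> schwartz \<Longrightarrow> f (\<lambda>x. c * g x) = c * f g"
  by (auto simp: tempered_def)

lemma tempered_diff: "f \<in> tempered \<Longrightarrow> g \<in> schwartz \<Longrightarrow> h \<in> schwartz \<Longrightarrow> f (\<lambda>x. g x - h x) = f g - f h"
  using tempered_add[of f g "\<lambda>x. - 1 * h x"] tempered_cmult[of f h "- 1"] schwartz_cmult[of h "- 1"]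
      by simp

lemma tempered_zero: "f \<in> tempered \<Longrightarrow> f (\<lambda>x. 0) = 0"
  using tempered_cmult[of f "\<lambda>x. 0" 0] schwartz_zero by simp

lemma tempered_sum:
  assumes "f \<in> tempered" "\<And>i. i \<in> F \<Longrightarrow> g i \<in> schwartz"
  shows "f (\<lambda>x. \<Sum>i\<in>F. c i * g i x) = (\<Sum>i\<in>F. c i * f (g i))"
  using assms(2)
proof (induction F rule: infinite_finite_induct)
  case (insert i F)
  then show ?case
    by (simp add: tempered_add[OF assms(1)] tempered_cmult[OF assms(1)] schwartz_cmult schwartz_sum)
qed (simp_all add: tempered_zero[OF assms(1)])

text \<open>Induction over the generated topology. Intersections are harmless because the seminorms
  increase with m.\<close>

lemma schwartz_topology_nhds_zero:
  assumes "openin schwartz_topology U" "(\<lambda>x. 0) \<in> U"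
  shows "\<exists>m e. 0 < e \<and> (\<forall>\<psi>\<in>schwartz. schwartz_norm m \<psi> < ennreal e \<longrightarrow> \<psi> \<in> U)"
proof -
  have "generate_topology_on {{\<psi>\<in>schwartz. schwartz_norm m (\<lambda>x. \<psi> x - \<psi>\<^sub>0 x) < ennreal e} | m \<psi>\<^sub>0 e.
      \<psi>\<^sub>0 \<in> schwartz \<and> 0 < e} U"
    using assms(1) unfolding schwartz_topology_def by (rule openin_topology_generated_by)
  then show ?thesis using assms(2)
  proof induction
    case (Int U V)
    then obtain m1 e1 m2 e2 where
      1: "0 < e1" "\<forall>\<psi>\<in>schwartz. schwartz_norm m1 \<psi> < ennreal e1 \<longrightarrow> \<psi> \<in> U" and
      2: "0 < e2" "\<forall>\<psi>\<in>schwartz. schwartz_norm m2 \<psi> < ennreal e2 \<longrightarrow> \<psi> \<in> V"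
      by auto
    show ?case
    proof (intro exI[of _ "max m1 m2"] exI[of _ "min e1 e2"] conjI ballI impI)
      fix \<psi> :: "(real, 'a) vec \<Rightarrow> complex" assume \<psi>: "\<psi> \<in> schwartz" "schwartz_norm (max m1 m2) \<psi> <
          ennreal (min e1 e2)"
      have "schwartz_norm m1 \<psi> < ennreal e1" "schwartz_norm m2 \<psi> < ennreal e2"
        using \<psi>(2) schwartz_norm_mono[of m1 "max m1 m2" \<psi>] schwartz_norm_mono[of m2 "max m1 m2" \<psi>]
          ennreal_leI[of "min e1 e2" e1] ennreal_leI[of "min e1 e2" e2]
        by (meson le_less_trans less_le_trans max.cobounded1 max.cobounded2 min.cobounded1
            min.cobounded2)+
      then show "\<psi> \<in> U \<inter> V" using 1 2 \<psi> by auto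
    qed (use 1 2 in auto)
  next
    case (UN K)
    then show ?case by (meson UnionE UnionI)
  next
    case (Basis B)
    then obtain m \<psi>0 e where B: "B = {\<psi>\<in>schwartz. schwartz_norm m (\<lambda>x. \<psi> x - \<psi>0 x) < ennreal e}"
      and \<psi>0: "\<psi>0 \<in> schwartz" and e: "0 < e" by auto
    define \<psi>1 where "\<psi>1 = (\<lambda>x. - 1 * \<psi>0 x)"
    have \<psi>1: "\<psi>1 \<in> schwartz" unfolding \<psi>1_def by (rule schwartz_cmult[OF \<psi>0])
    define d where "d = snorm m \<psi>1"
    have "(\<lambda>x. 0 - \<psi>0 x) = \<psi>1" by (simp add: \<psi>1_def)
    then have "schwartz_norm m \<psi>1 < ennreal e" using Basis(2) by (simp add: B)
    then have d: "0 \<le> d" "d < e" "schwartz_norm m \<psi>1 = ennreal d"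
    proof -
      show "schwartz_norm m \<psi>1 = ennreal d" unfolding d_def using ennreal_snorm[OF \<psi>1, of m] by simp
      then have "ennreal d < ennreal e" using \<open>schwartz_norm m \<psi>1 < ennreal e\<close> by simp
      then show "d < e" using snorm_nonneg[of m \<psi>1] by (simp add: d_def ennreal_less_iff)
      show "0 \<le> d" unfolding d_def by (rule snorm_nonneg)
    qed
    show ?case
    \<comment> \<open>A generating ball need not be centred at 0. If 0 lies at distance
      \<open>d < e\<close> from its centre, radius \<open>e - d\<close> remains.\<close>
    proof (intro exI[of _ m] exI[of _ "e - d"] conjI ballI impI)
      fix \<psi> :: "(real, 'a) vec \<Rightarrow> complex" assume \<psi>: "\<psi> \<in> schwartz" "schwartz_norm m \<psi> < ennreal
          (e - d)"
      have "(\<lambda>x. \<psi> x - \<psi>0 x) = (\<lambda>x. \<psi> x + \<psi>1 x)" by (simp add: \<psi>1_def)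
      then have "schwartz_norm m (\<lambda>x. \<psi> x - \<psi>0 x) \<le> schwartz_norm m \<psi> + ennreal d"
        using schwartz_norm_add[OF schwartz_smooth[OF \<psi>(1)] schwartz_smooth[OF \<psi>1], of m] d(3)
            by simp
      also have "\<dots> < ennreal (e - d) + ennreal d"
        using \<psi>(2) d snorm_nonneg[of m \<psi>] unfolding ennreal_snorm[OF \<psi>(1), symmetric]
        by (simp add: ennreal_less_iff flip: ennreal_plus)
      also have "\<dots> = ennreal e" using d by (simp flip: ennreal_plus)
      finally show "\<psi> \<in> B" using \<psi> by (simp add: B)
    qed (use d in simp)
  qed simp
qed

lemma tempered_bound:
  assumes f: "f \<in> tempered"
  shows "\<exists>m C. 0 \<le> C \<and> (\<forall>\<psi>\<in>schwartz. norm (f \<psi>) \<le> C * snorm m \<psi>)"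
proof -
  have cont: "continuous_map schwartz_topology euclidean f" using f by (simp add: tempered_def)
  define U where "U = {\<psi> \<in> topspace schwartz_topology. f \<psi> \<in> ball 0 1}"
  have "openin schwartz_topology U"
    unfolding U_def using cont by (rule openin_continuous_map_preimage)
        (simp add: open_openin[symmetric])
  moreover have "(\<lambda>x. 0) \<in> topspace schwartz_topology"
  proof -
    have "(\<lambda>x. 0) \<in> {\<psi>\<in>schwartz. schwartz_norm 0 (\<lambda>x. \<psi> x - (\<lambda>x. 0) x) < ennreal 1}"
      using schwartz_zero by simp
    then show ?thesis
      unfolding schwartz_topology_def topology_generated_by_topspace
      using schwartz_zero zero_less_one by blast
  qed
  then have "(\<lambda>x. 0) \<in> U" by (simp add: U_def tempered_zero[OF f])
  ultimately obtain m e where e: "0 < e" and U: "\<And>\<psi>. \<psi> \<in> schwartz \<Longrightarrow> schwartz_norm m \<psi> < ennreal e \<Longrightarrow>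
      \<psi> \<in> U"
    using schwartz_topology_nhds_zero by metis
  show ?thesis
  proof (intro exI[of _ m] exI[of _ "2 / e"] conjI ballI)
    show "0 \<le> 2 / e" using e by simp
    fix \<psi> :: "(real, 'a) vec \<Rightarrow> complex" assume \<psi>: "\<psi> \<in> schwartz"
    show "norm (f \<psi>) \<le> 2 / e * snorm m \<psi>"
    proof (rule field_le_epsilon)
      fix \<delta> :: real assume \<delta>: "0 < \<delta>"
      \<comment> \<open>The extra term keeps \<open>s\<close> positive even if the seminorm
        vanishes; scaling by \<open>e / (2 * s)\<close> moves \<psi> into the neighbourhood on which
        \<open>f\<close> is smaller than 1.\<close>
      define s where "s = snorm m \<psi> + e * \<delta> / 2"
      have s: "snorm m \<psi> < s" "0 < s" using \<delta> e snorm_nonneg[of m \<psi>]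
          by (auto simp: s_def add_nonneg_pos)
      define c where "c = e / (2 * s)"
      have c: "0 < c" using e s by (simp add: c_def)
      have "schwartz_norm m (\<lambda>x. of_real c * \<psi> x) \<le> ennreal (c * snorm m \<psi>)"
        using schwartz_norm_cmult[OF schwartz_smooth[OF \<psi>], of m "of_real c"] c
        by (simp add: ennreal_snorm[OF \<psi>, symmetric] ennreal_mult snorm_nonneg)
      also have "c * snorm m \<psi> < c * s * 2" using c s by (simp add: mult.commute) 
      then have "ennreal (c * snorm m \<psi>) < ennreal e"
        using c s e by (intro ennreal_lessI) (auto simp: c_def)
      finally have "norm (f (\<lambda>x. of_real c * \<psi> x)) < 1"
        using U[OF schwartz_cmult[OF \<psi>]] by (simp add: U_def)
      then have "c * norm (f \<psi>) < 1" using c by (simp add: tempered_cmult[OF f \<psi>] norm_mult)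
      then have "norm (f \<psi>) < 1 / c" using c by (simp add: field_simps)
      also have "\<dots> = 2 / e * snorm m \<psi> + \<delta>" using e by (simp add: c_def s_def field_simps)
      finally show "norm (f \<psi>) \<le> 2 / e * snorm m \<psi> + \<delta>" by simp
    qed
  qed
qed

section \<open>Sampling band-limited functions\<close>

text \<open>Only the term with the least a such that |v| < 2^a is kept. Minimality gives 2^(a-1)
  \<le> 1 + |v|, which costs the factor 4.\<close>

lemma kern_lower: "ennreal (1 / (1 + \<bar>v\<bar>)\<^sup>2) \<le> 4 * kern v"
proof -
  have kern_ge: "ennreal ((1/4) ^ a) \<le> kern v" if "\<bar>v\<bar> < 2 ^ a" for a :: nat
  proof -
    have "ennreal ((1/4) ^ a) = (\<Sum>b\<in>{a}. ennreal ((1/4) ^ b) * indicator (ball 0 (2 ^ b)) v)"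
      using that by (simp add: indicator_def)
    also have "\<dots> \<le> kern v" unfolding kern_def by (intro sum_le_suminf) auto
    finally show ?thesis .
  qed
  define a where "a = (LEAST a. \<bar>v\<bar> < 2 ^ a)"
  have ex: "\<exists>a. \<bar>v\<bar> < 2 ^ a" using real_arch_pow[of 2 "\<bar>v\<bar>"] by simp
  have a: "\<bar>v\<bar> < 2 ^ a" unfolding a_def using ex by (rule LeastI_ex)
  have "1 / (1 + \<bar>v\<bar>)\<^sup>2 \<le> 4 * (1/4) ^ a"
  proof (cases a)
    case 0
    have "1\<^sup>2 \<le> (1 + \<bar>v\<bar>)\<^sup>2" by (intro power_mono) auto
    then have "1 / (1 + \<bar>v\<bar>)\<^sup>2 \<le> 1" by (simp add: divide_le_eq_1)
    then show ?thesis unfolding 0 power_0 by linarith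
  next
    case (Suc b)
    have "\<not> \<bar>v\<bar> < 2 ^ b" using not_less_Least[of b "\<lambda>a. \<bar>v\<bar> < 2 ^ a"] Suc unfolding a_def by simp
    then have "(2 ^ b)\<^sup>2 \<le> (1 + \<bar>v\<bar>)\<^sup>2" by (intro power_mono) auto
    moreover have "((2::real) ^ b)\<^sup>2 = 4 ^ b"
        by (simp add: power_mult[symmetric] mult.commute[of b] power_mult)
    ultimately have "1 / (1 + \<bar>v\<bar>)\<^sup>2 \<le> 1 / 4 ^ b" by (intro divide_left_mono) auto
    then show ?thesis using Suc by (simp add: power_divide)
  qed
  then have "ennreal (1 / (1 + \<bar>v\<bar>)\<^sup>2) \<le> ennreal (4 * (1/4) ^ a)" by (rule ennreal_leI)
  also have "\<dots> = 4 * ennreal ((1/4) ^ a)" by (subst ennreal_mult) auto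
  also have "\<dots> \<le> 4 * kern v" using kern_ge[OF a] by (rule mult_left_mono) simp
  finally show ?thesis .
qed

text \<open>The function is at most the product over the coordinates of (1 + |x_b|)^(-2), and
  \<open>kern\<close> bounds each one-dimensional integral.\<close>

lemma integrable_decay: "integrable lborel (\<lambda>x :: 'a::euclidean_space. 1 / (1 + norm x) ^
    (2 * DIM('a)))"
proof (rule integrableI_bounded)
  define h where "h v = 1 / (1 + \<bar>v\<bar>)\<^sup>2" for v :: real
  have [measurable]: "h \<in> borel_measurable borel" unfolding h_def by measurable
  have le: "1 / (1 + norm x) ^ (2 * DIM('a)) \<le> (\<Prod>b\<in>Basis. h (x \<bullet> b))" for x :: 'a
  proof -
    have "1 / (1 + norm x) ^ (2 * DIM('a)) = (\<Prod>b\<in>(Basis::'a set). 1 / (1 + norm x)\<^sup>2)"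
      by (simp add: power_mult power_divide)
    also have "\<dots> \<le> (\<Prod>b\<in>Basis. h (x \<bullet> b))"
    proof (rule prod_mono, safe)
      fix b :: 'a assume b: "b \<in> Basis"
      have "(1 + \<bar>x \<bullet> b\<bar>)\<^sup>2 \<le> (1 + norm x)\<^sup>2"
        using Basis_le_norm[OF b, of x] by (intro power_mono) auto
      moreover have "0 < (1 + \<bar>x \<bullet> b\<bar>)\<^sup>2" "0 < (1 + norm x)\<^sup>2"
        by (intro zero_less_power add_pos_nonneg; simp)+
      ultimately show "1 / (1 + norm x)\<^sup>2 \<le> h (x \<bullet> b)"
        unfolding h_def by (intro divide_left_mono) auto
    qed auto
    finally show ?thesis .
  qed
  have fin: "(\<integral>\<^sup>+v. ennreal (h v) \<partial>lborel) < \<infinity>"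
  proof -
    have "(\<integral>\<^sup>+v. ennreal (h v) \<partial>lborel) \<le> (\<integral>\<^sup>+v. 4 * kern v \<partial>lborel)"
      unfolding h_def by (intro nn_integral_mono kern_lower)
    also have "\<dots> = 4 * emeasure kmeas UNIV"
      by (simp add: nn_integral_cmult kmeas_def emeasure_density)
    finally show ?thesis unfolding emeasure_kmeas_UNIV by (rule le_less_trans)
        (simp add: ennreal_mult_less_top)
  qed
  have "(\<integral>\<^sup>+x. ennreal (norm (1 / (1 + norm (x::'a)) ^ (2 * DIM('a)))) \<partial>lborel)
      \<le> (\<integral>\<^sup>+x. (\<Prod>b\<in>Basis. ennreal (h ((x::'a) \<bullet> b))) \<partial>lborel)"
    using le by (intro nn_integral_mono) (simp add: prod_ennreal h_def ennreal_leI)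
  also have "\<dots> = (\<Prod>b\<in>(Basis::'a set). \<integral>\<^sup>+v. ennreal (h v) \<partial>lborel)"
    by (rule nn_integral_lborel_prod) auto
  also have "\<dots> < \<infinity>" using fin by (simp add: power_less_top_ennreal)
  finally show "(\<integral>\<^sup>+x. ennreal (norm (1 / (1 + norm (x::'a)) ^ (2 * DIM('a)))) \<partial>lborel) < \<infinity>" .
qed auto

lemma schwartz_continuous: "g \<in> schwartz \<Longrightarrow> continuous_on UNIV g"
  using smoothD[OF schwartz_smooth, of g "[]"]
  by (auto simp: continuous_on_eq_continuous_at intro: differentiable_imp_continuous_within)

lemma schwartz_integrable:
  fixes g :: "('n::finite) cfun"
  assumes "g \<in> schwartz" shows "integrable lborel g"
proof (rule Bochner_Integration.integrable_bound)
  let ?m = "2 * DIM(real ^ 'n)"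
  show "integrable lborel (\<lambda>x :: real ^ 'n. snorm ?m g * (1 / (1 + norm x) ^ ?m))"
    by (intro integrable_mult_right integrable_decay)
  show "g \<in> borel_measurable lborel"
    using schwartz_continuous[OF assms] by (simp add: borel_measurable_continuous_onI)
  show "AE x in lborel. norm (g x) \<le> norm (snorm ?m g * (1 / (1 + norm x) ^ ?m))"
    using partials_bound[OF assms, of "[]" ?m] snorm_nonneg[of ?m g] by (auto intro!: AE_I2)
qed

lemma band_limited_schwartz:
  fixes g :: "('n::finite) cfun"
  assumes g: "g \<in> schwartz" and supp: "supp (fourier g) \<subseteq> {\<xi>. norm \<xi> \<le> R}"
  shows "band_limited R g"
proof (rule band_limitedI)
  show "norm (g x) \<le> snorm 0 g" for x using partials_bound[OF g, of "[]" 0] by simp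
  fix \<xi> :: "real ^ 'n" assume "R < norm \<xi>"
  then have "\<xi> \<notin> supp (fourier g)" using supp by auto
  then have "fourier g \<xi> = 0" unfolding supp_def using closure_subset[of "{x. fourier g x \<noteq> 0}"]
      by auto
  then show "(\<integral>y. cis (- (y \<bullet> \<xi>)) * g y \<partial>lborel) = 0" by (simp add: fourier_def)
qed (use g in \<open>simp_all add: schwartz_continuous schwartz_integrable\<close>)

text \<open>The steps 1 / (k + 1) form a sequence so that dominated convergence applies in
  \<open>band_limited_partial\<close>.\<close>

lemma difference_quotient_tendsto:
  fixes g :: "('n::finite) cfun"
  assumes "g differentiable (at x)"
  shows "(\<lambda>k. of_nat (Suc k) * (g (x + inverse (real (Suc k)) *\<^sub>R axis i 1) - g x)) \<longlonglongrightarrow> partial i g x"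
proof -
  let ?D = "frechet_derivative g (at x)"
  let ?h = "\<lambda>k. inverse (real (Suc k)) *\<^sub>R axis i 1 :: real ^ 'n"
  have D: "(g has_derivative ?D) (at x)" using assms frechet_derivative_works by blast
  have "?h \<longlonglongrightarrow> 0 *\<^sub>R axis i 1" by (intro tendsto_scaleR LIMSEQ_inverse_real_of_nat tendsto_const)
  then have "filterlim ?h (at 0) sequentially"
    by (intro filterlim_atI) (auto simp: axis_eq_0_iff)
  moreover have "((\<lambda>h. norm (g (x + h) - g x - ?D h) / norm h) \<longlongrightarrow> 0) (at 0)"
    using D unfolding has_derivative_at by blast
  ultimately have "(\<lambda>k. norm (g (x + ?h k) - g x - ?D (?h k)) / norm (?h k)) \<longlonglongrightarrow> 0"
    by (rule filterlim_compose[rotated])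
  moreover have "norm (g (x + ?h k) - g x - ?D (?h k)) / norm (?h k)
      = norm (of_nat (Suc k) * (g (x + ?h k) - g x) - partial i g x)" for k
  proof -
    have "?D (?h k) = inverse (of_nat (Suc k)) * partial i g x"
      using linear_scale[OF has_derivative_linear[OF D], of "inverse (real (Suc k))" "axis i 1"]
      by (simp add: partial_def scaleR_conv_of_real del: of_nat_Suc)
    then have "of_nat (Suc k) * (g (x + ?h k) - g x - ?D (?h k)) = of_nat (Suc k) *
        (g (x + ?h k) - g x) - partial i g x"
      by (simp add: right_diff_distrib mult.assoc[symmetric] del: of_nat_Suc)
    then have "norm (of_nat (Suc k) * (g (x + ?h k) - g x) - partial i g x)
        = real (Suc k) * norm (g (x + ?h k) - g x - ?D (?h k))"
      by (metis norm_mult norm_of_nat)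
    moreover have "norm (?h k) = inverse (real (Suc k))" by (simp del: of_nat_Suc)
    ultimately show ?thesis by (simp add: divide_inverse mult.commute del: of_nat_Suc)
  qed
  ultimately have "(\<lambda>k. norm (of_nat (Suc k) * (g (x + ?h k) - g x) - partial i g x)) \<longlonglongrightarrow> 0"
    by (simp only:)
  then show ?thesis by (rule LIM_zero_cancel[OF tendsto_norm_zero_cancel])
qed

lemma cis_quotient_tendsto:
  "(\<lambda>k. of_nat (Suc k) * (cis (inverse (real (Suc k)) * a) - 1)) \<longlonglongrightarrow> \<i> * of_real a"
proof -
  let ?h = "\<lambda>k. inverse (of_nat (Suc k)) :: complex"
  have "((\<lambda>z. exp (\<i> * of_real a * z)) has_field_derivative \<i> * of_real a) (at 0)"
    by (auto intro!: derivative_eq_intros)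
  then have lim: "((\<lambda>h. (exp (\<i> * of_real a * h) - 1) / h) \<longlongrightarrow> \<i> * of_real a) (at 0)"
    by (simp add: DERIV_def)
  have "?h \<longlonglongrightarrow> 0" by (rule LIMSEQ_Suc[OF lim_inverse_n])
  then have "filterlim ?h (at 0) sequentially"
    by (intro filterlim_atI) (auto simp del: of_nat_Suc)
  with lim have "(\<lambda>k. (exp (\<i> * of_real a * ?h k) - 1) / ?h k) \<longlonglongrightarrow> \<i> * of_real a"
    by (rule filterlim_compose)
  moreover have "(exp (\<i> * of_real a * ?h k) - 1) / ?h k = of_nat (Suc k) *
      (cis (inverse (real (Suc k)) * a) - 1)" for k
    by (simp add: cis_conv_exp divide_inverse mult_ac del: of_nat_Suc)
  ultimately show ?thesis by simp
qed

text \<open>Differentiation under the integral multiplies \<open>H\<close> by i \<xi>_i. This factor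
  is bounded where \<open>H\<close> is nonzero, so integrability and the radius persist.\<close>

lemma band_limited_partial:
  fixes g :: "('n::finite) cfun"
  assumes bl: "band_limited R g" and diff: "\<And>x. g differentiable (at x)"
  shows "band_limited R (partial i g)"
proof -
  obtain H where H: "integrable lborel H" "\<And>\<xi>. R < norm \<xi> \<Longrightarrow> H \<xi> = 0" "\<And>x. g x =
      (\<integral>\<xi>. H \<xi> * cis (x \<bullet> \<xi>) \<partial>lborel)"
    using bl unfolding band_limited_def by auto
  have [measurable]: "H \<in> borel_measurable borel" using H(1) by auto
  have [measurable]: "(\<lambda>\<xi> :: real ^ 'n. \<xi> $ i) \<in> borel_measurable borel"
    unfolding cart_eq_inner_axis by measurable
  define H' where "H' \<xi> = \<i> * of_real (\<xi> $ i) * H \<xi>" for \<xi>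
  have [measurable]: "H' \<in> borel_measurable borel" unfolding H'_def by measurable
  have le: "norm (H \<xi>) * \<bar>\<xi> $ i\<bar> \<le> norm (H \<xi>) * \<bar>R\<bar>" for \<xi>
    using component_le_norm_cart[of \<xi> i] H(2)[of \<xi>]
    by (cases "R < norm \<xi>") (auto intro!: mult_left_mono)
  have intcis: "integrable lborel (\<lambda>\<xi>. H \<xi> * cis (x \<bullet> \<xi>))" for x
    using H(1) by (rule Bochner_Integration.integrable_bound[OF _ _ AE_I2]) (auto simp: norm_mult)
  show ?thesis
    unfolding band_limited_def
  proof (intro exI conjI allI impI)
    have "integrable lborel (\<lambda>\<xi>. norm (H \<xi>) * \<bar>R\<bar>)" using H(1) by simp
    then show "integrable lborel H'"
      by (rule Bochner_Integration.integrable_bound[OF _ _ AE_I2])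
        (use le in \<open>auto simp: H'_def norm_mult mult.commute\<close>)
    show "H' \<xi> = 0" if "R < norm \<xi>" for \<xi> using H(2)[OF that] by (simp add: H'_def)
    fix x
    show "partial i g x = (\<integral>\<xi>. H' \<xi> * cis (x \<bullet> \<xi>) \<partial>lborel)"
    proof (rule LIMSEQ_unique[OF difference_quotient_tendsto[OF diff]])
      let ?t = "\<lambda>k. inverse (real (Suc k))"
      have "of_nat (Suc k) * (g (x + ?t k *\<^sub>R axis i 1) - g x)
          = (\<integral>\<xi>. (of_nat (Suc k) * (cis (?t k * (\<xi> $ i)) - 1)) * (H \<xi> * cis (x \<bullet> \<xi>)) \<partial>lborel)" for k
      proof -
        have *: "H \<xi> * cis ((x + ?t k *\<^sub>R axis i 1) \<bullet> \<xi>) - H \<xi> * cis (x \<bullet> \<xi>)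
            = (cis (?t k * (\<xi> $ i)) - 1) * (H \<xi> * cis (x \<bullet> \<xi>))" for \<xi>
        proof -
          have "cis ((x + ?t k *\<^sub>R axis i 1) \<bullet> \<xi>) = cis (?t k * (\<xi> $ i)) * cis (x \<bullet> \<xi>)"
          proof -
            have "(x + ?t k *\<^sub>R axis i 1) \<bullet> \<xi> = ?t k * (\<xi> $ i) + x \<bullet> \<xi>"
              by (simp add: inner_add_left inner_axis' del: of_nat_Suc)
            then show ?thesis by (simp only: cis_mult)
          qed
          then show ?thesis by (simp only: left_diff_distrib mult_1_left) (simp only: mult_ac)
        qed
        have "g (x + ?t k *\<^sub>R axis i 1) - g x
            = (\<integral>\<xi>. H \<xi> * cis ((x + ?t k *\<^sub>R axis i 1) \<bullet> \<xi>) - H \<xi> * cis (x \<bullet> \<xi>) \<partial>lborel)"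
          unfolding H(3) by (rule Bochner_Integration.integral_diff[symmetric, OF intcis intcis])
        then show ?thesis
          unfolding * by (simp only: mult.assoc integral_mult_right_zero)
      qed
      moreover have "(\<lambda>k. \<integral>\<xi>. (of_nat (Suc k) * (cis (?t k * (\<xi> $ i)) - 1)) * (H \<xi> * cis (x \<bullet> \<xi>))
          \<partial>lborel)
          \<longlonglongrightarrow> (\<integral>\<xi>. H' \<xi> * cis (x \<bullet> \<xi>) \<partial>lborel)"
      proof (rule integral_dominated_convergence[where w = "\<lambda>\<xi>. norm (H \<xi>) * \<bar>R\<bar>"])
        show "integrable lborel (\<lambda>\<xi>. norm (H \<xi>) * \<bar>R\<bar>)" using H(1) by simp
        show "AE \<xi> in lborel. (\<lambda>k. (of_nat (Suc k) * (cis (?t k * (\<xi> $ i)) - 1)) *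
            (H \<xi> * cis (x \<bullet> \<xi>))) \<longlonglongrightarrow> H' \<xi> * cis (x \<bullet> \<xi>)"
        proof (rule AE_I2)
          fix \<xi> :: "real ^ 'n"
          show "(\<lambda>k. (of_nat (Suc k) * (cis (?t k * (\<xi> $ i)) - 1)) * (H \<xi> * cis (x \<bullet> \<xi>))) \<longlonglongrightarrow> H' \<xi> *
              cis (x \<bullet> \<xi>)"
            using tendsto_mult_right[OF cis_quotient_tendsto[of "\<xi> $ i"], of "H \<xi> * cis (x \<bullet> \<xi>)"]
            by (simp add: H'_def mult.assoc)
        qed
        show "AE \<xi> in lborel. norm ((of_nat (Suc k) * (cis (?t k * (\<xi> $ i)) - 1)) *
            (H \<xi> * cis (x \<bullet> \<xi>))) \<le> norm (H \<xi>) * \<bar>R\<bar>" for k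
        proof (rule AE_I2)
          fix \<xi> :: "real ^ 'n"
          have "real (Suc k) * norm (cis (?t k * (\<xi> $ i)) - 1) \<le> real (Suc k) * (?t k * \<bar>\<xi> $ i\<bar>)"
            using norm_cis_diff_le[of "?t k * (\<xi> $ i)" 0]
            by (intro mult_left_mono) (auto simp: abs_mult simp del: of_nat_Suc)
          also have "\<dots> = \<bar>\<xi> $ i\<bar>" by (simp add: mult.assoc[symmetric] del: of_nat_Suc)
          finally have "norm (H \<xi>) * (real (Suc k) * norm (cis (?t k * (\<xi> $ i)) - 1)) \<le> norm (H \<xi>) *
              \<bar>\<xi> $ i\<bar>"
            by (rule mult_left_mono) simp
          also have "\<dots> \<le> norm (H \<xi>) * \<bar>R\<bar>" by (rule le)
          finally show "norm ((of_nat (Suc k) * (cis (?t k * (\<xi> $ i)) - 1)) * (H \<xi> * cis (x \<bullet> \<xi>))) \<le>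
              norm (H \<xi>) * \<bar>R\<bar>"
            by (simp add: norm_mult mult_ac del: of_nat_Suc)
        qed
      qed (auto simp: H'_def)
      ultimately show "(\<lambda>k. of_nat (Suc k) * (g (x + ?t k *\<^sub>R axis i 1) - g x)) \<longlonglongrightarrow>
          (\<integral>\<xi>. H' \<xi> * cis (x \<bullet> \<xi>) \<partial>lborel)"
        by (simp only:)
    qed
  qed
qed

lemma band_limited_partials: "smooth g \<Longrightarrow> band_limited R g \<Longrightarrow> band_limited R (partials is g)"
proof (induction "is")
  case (Cons i js)
  then show ?case by (simp add: band_limited_partial smoothD)
qed simp

lemma infsum_Compl_tendsto:
  fixes f :: "'i \<Rightarrow> real"
  assumes "f summable_on UNIV"
  shows "((\<lambda>F. infsum f (- F)) \<longlongrightarrow> 0) (finite_subsets_at_top UNIV)"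
proof -
  have "(sum f \<longlongrightarrow> infsum f UNIV) (finite_subsets_at_top UNIV)"
    using has_sum_infsum[OF assms] by (simp add: has_sum_def)
  then have "((\<lambda>F. infsum f UNIV - sum f F) \<longlongrightarrow> infsum f UNIV - infsum f UNIV)
      (finite_subsets_at_top UNIV)"
    by (intro tendsto_diff tendsto_const)
  moreover have "\<forall>\<^sub>F F in finite_subsets_at_top UNIV. infsum f UNIV - sum f F = infsum f (- F)"
    using infsum_Diff[OF assms summable_on_finite]
    by (intro eventually_finite_subsets_at_top_weakI) (simp add: Compl_eq_Diff_UNIV)
  ultimately show ?thesis by (simp add: Lim_transform_eventually)
qed

text \<open>The interpolation formula at \<theta> = \<xi>_i is integrated against \<open>H\<close>.
  Its error is at most the tail \<open>T F\<close>, uniformly in the band, so finite sums suffice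
  and no series is interchanged with the integral.\<close>

lemma band_limited_sampling:
  fixes g :: "('n::finite) cfun"
  assumes bl: "band_limited R g" and R: "0 \<le> R"
    and ds: "\<And>d. d \<in> set ds \<Longrightarrow> 0 < d" "R + sum_list ds < pi"
    and summable: "(\<lambda>m. norm (ikern ds (s - of_int m))) summable_on UNIV"
  shows "((\<lambda>m. ikern ds (s - of_int m) * g (w + of_int m *\<^sub>R axis i 1)) has_sum g
      (w + s *\<^sub>R axis i 1)) UNIV"
proof -
  obtain H where H: "integrable lborel H" "\<And>\<xi>. R < norm \<xi> \<Longrightarrow> H \<xi> = 0" "\<And>x. g x =
      (\<integral>\<xi>. H \<xi> * cis (x \<bullet> \<xi>) \<partial>lborel)"
    using bl unfolding band_limited_def by auto
  have [measurable]: "H \<in> borel_measurable borel" using H(1) by auto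
  have [measurable]: "(\<lambda>\<xi> :: real ^ 'n. \<xi> $ i) \<in> borel_measurable borel"
    unfolding cart_eq_inner_axis by measurable
  define K where "K m = ikern ds (s - of_int m)" for m
  define T where "T F = infsum (\<lambda>m. norm (K m)) (- F)" for F
  have sK: "(\<lambda>m. norm (K m)) summable_on UNIV" using summable by (simp add: K_def)
  have T0: "(T \<longlongrightarrow> 0) (finite_subsets_at_top UNIV)"
    unfolding T_def by (rule infsum_Compl_tendsto[OF sK])
  have intcis: "integrable lborel (\<lambda>\<xi>. H \<xi> * cis (x \<bullet> \<xi>))" for x
    using H(1) by (rule Bochner_Integration.integrable_bound[OF _ _ AE_I2]) (auto simp: norm_mult)
  have exp_err: "norm (cis (s * \<theta>) - (\<Sum>m\<in>F. K m * cis (of_int m * \<theta>))) \<le> T F" if "finite F" "\<bar>\<theta>\<bar> \<le>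
      R" for F \<theta>
  proof -
    have s1: "(\<lambda>m. norm (cis (of_int m * \<theta>) * K m)) summable_on UNIV" using sK
        by (simp add: norm_mult)
    have "cis (s * \<theta>) = (\<Sum>\<^sub>\<infinity>m. cis (of_int m * \<theta>) * K m)"
      unfolding K_def using ds that summable by (intro infsum_cis_ikern[symmetric]) auto
    moreover have "(\<Sum>\<^sub>\<infinity>m\<in>-F. cis (of_int m * \<theta>) * K m) = (\<Sum>\<^sub>\<infinity>m. cis (of_int m * \<theta>) * K m) -
        (\<Sum>m\<in>F. cis (of_int m * \<theta>) * K m)"
      using infsum_Diff[OF abs_summable_summable[OF s1] summable_on_finite[OF \<open>finite F\<close>]] \<open>finite
          F\<close>
      by (simp add: Compl_eq_Diff_UNIV)
    ultimately have "cis (s * \<theta>) - (\<Sum>m\<in>F. K m * cis (of_int m * \<theta>)) =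
        (\<Sum>\<^sub>\<infinity>m\<in>-F. cis (of_int m * \<theta>) * K m)"
      by (simp add: mult.commute)
    also have "norm \<dots> \<le> (\<Sum>\<^sub>\<infinity>m\<in>-F. norm (cis (of_int m * \<theta>) * K m))"
      by (rule norm_infsum_bound, rule summable_on_subset_banach[OF s1]) simp
    also have "\<dots> = T F" by (simp add: T_def norm_mult)
    finally show ?thesis .
  qed
  have err: "norm ((\<Sum>m\<in>F. K m * g (w + of_int m *\<^sub>R axis i 1)) - g (w + s *\<^sub>R axis i 1)) \<le> T F *
      (\<integral>\<xi>. norm (H \<xi>) \<partial>lborel)"
    if "finite F" for F
  proof -
    have shift: "cis ((w + c *\<^sub>R axis i 1) \<bullet> \<xi>) = cis (w \<bullet> \<xi>) * cis (c * (\<xi> $ i))" for c and \<xi> ::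
        "real ^ 'n"
      by (simp add: inner_add_left inner_axis' cis_mult)
    have TF: "0 \<le> T F" unfolding T_def by (intro infsum_nonneg) simp
    have "(\<Sum>m\<in>F. K m * g (w + of_int m *\<^sub>R axis i 1)) =
        (\<integral>\<xi>. (\<Sum>m\<in>F. K m * (H \<xi> * cis ((w + of_int m *\<^sub>R axis i 1) \<bullet> \<xi>))) \<partial>lborel)"
      unfolding H(3) using intcis by (subst Bochner_Integration.integral_sum) auto
    then have "(\<Sum>m\<in>F. K m * g (w + of_int m *\<^sub>R axis i 1)) - g (w + s *\<^sub>R axis i 1)
        = (\<integral>\<xi>. (\<Sum>m\<in>F. K m * (H \<xi> * cis ((w + of_int m *\<^sub>R axis i 1) \<bullet> \<xi>))) - H \<xi> * cis
            ((w + s *\<^sub>R axis i 1) \<bullet> \<xi>) \<partial>lborel)"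
      using intcis by (subst Bochner_Integration.integral_diff) (auto simp: H(3))
    also have "norm \<dots> \<le> (\<integral>\<xi>. T F * norm (H \<xi>) \<partial>lborel)"
    proof (rule Bochner_Integration.integral_norm_bound_integral)
      fix \<xi> :: "real ^ 'n"
      have "(\<Sum>m\<in>F. K m * (H \<xi> * cis ((w + of_int m *\<^sub>R axis i 1) \<bullet> \<xi>))) - H \<xi> * cis
          ((w + s *\<^sub>R axis i 1) \<bullet> \<xi>)
          = - (H \<xi> * cis (w \<bullet> \<xi>) * (cis (s * (\<xi> $ i)) - (\<Sum>m\<in>F. K m * cis (of_int m * (\<xi> $ i)))))"
      proof -
        have "(\<Sum>m\<in>F. K m * (H \<xi> * (cis (w \<bullet> \<xi>) * cis (of_int m * (\<xi> $ i)))))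
            = H \<xi> * cis (w \<bullet> \<xi>) * (\<Sum>m\<in>F. K m * cis (of_int m * (\<xi> $ i)))"
          unfolding sum_distrib_left by (intro sum.cong refl) (simp only: mult_ac)
        then show ?thesis
          unfolding shift by (simp only: right_diff_distrib mult.assoc minus_diff_eq)
      qed
      then have "norm ((\<Sum>m\<in>F. K m * (H \<xi> * cis ((w + of_int m *\<^sub>R axis i 1) \<bullet> \<xi>))) - H \<xi> * cis
          ((w + s *\<^sub>R axis i 1) \<bullet> \<xi>))
          = norm (H \<xi>) * norm (cis (s * (\<xi> $ i)) - (\<Sum>m\<in>F. K m * cis (of_int m * (\<xi> $ i))))"
        by (simp add: norm_mult)
      also have "\<dots> \<le> norm (H \<xi>) * T F"
      proof (cases "R < norm \<xi>")
        case False
        then have "\<bar>\<xi> $ i\<bar> \<le> R" using component_le_norm_cart[of \<xi> i] by simp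
        then show ?thesis using exp_err[OF that] by (intro mult_left_mono) auto
      qed (use H(2) in simp)
      finally show "norm ((\<Sum>m\<in>F. K m * (H \<xi> * cis ((w + of_int m *\<^sub>R axis i 1) \<bullet> \<xi>))) - H \<xi> * cis
          ((w + s *\<^sub>R axis i 1) \<bullet> \<xi>)) \<le> T F * norm (H \<xi>)"
        by (simp add: mult.commute)
    qed (use H(1) intcis in \<open>auto intro!: Bochner_Integration.integrable_diff
        Bochner_Integration.integrable_sum integrable_mult_right\<close>)
    finally show ?thesis by simp
  qed
  have "((\<lambda>F. (\<Sum>m\<in>F. K m * g (w + of_int m *\<^sub>R axis i 1)) - g (w + s *\<^sub>R axis i 1)) \<longlongrightarrow> 0)
      (finite_subsets_at_top UNIV)"
  proof (rule Lim_null_comparison)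
    show "\<forall>\<^sub>F F in finite_subsets_at_top UNIV. norm
        ((\<Sum>m\<in>F. K m * g (w + of_int m *\<^sub>R axis i 1)) - g (w + s *\<^sub>R axis i 1))
        \<le> T F * (\<integral>\<xi>. norm (H \<xi>) \<partial>lborel)"
      by (intro eventually_finite_subsets_at_top_weakI err) simp
    show "((\<lambda>F. T F * (\<integral>\<xi>. norm (H \<xi>) \<partial>lborel)) \<longlongrightarrow> 0) (finite_subsets_at_top UNIV)"
      by (rule tendsto_mult_left_zero[OF T0])
  qed
  then show ?thesis unfolding has_sum_def K_def by (rule LIM_zero_cancel)
qed

section \<open>Decay of the sampling kernel\<close>

lemma norm_ufac_power_le:
  assumes "0 < d" shows "norm (ufac d v) ^ n \<le> ((1 + 1 / d) / (1 + \<bar>v\<bar>)) ^ n"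
proof (rule power_mono)
  have "norm (ufac d v) * \<bar>v\<bar> \<le> 1 / d"
    using norm_ufac_le[OF assms, of v] assms by (cases "v = 0") (auto simp: field_simps)
  then have "norm (ufac d v) * (1 + \<bar>v\<bar>) \<le> 1 + 1 / d"
    using norm_ufac_le_1[OF assms, of v] by (simp add: distrib_left)
  then show "norm (ufac d v) \<le> (1 + 1 / d) / (1 + \<bar>v\<bar>)"
    by (subst pos_le_divide_eq) auto
qed simp

text \<open>The first \<open>N\<close> factors give a decay that is uniform in \<open>L\<close>; the other \<open>L\<close> factors only
  serve to make the sampling series of functions of large polynomial growth converge.\<close>

definition sfac :: "nat \<Rightarrow> nat \<Rightarrow> real list"
  where "sfac N L = replicate N (1 / (2 * real N)) @ replicate L (1 / (4 * real L))"

lemma sfac_pos: "0 < N \<Longrightarrow> 0 < L \<Longrightarrow> d \<in> set (sfac N L) \<Longrightarrow> 0 < d"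
  by (auto simp: sfac_def)

text \<open>The bandwidth budget 1/2 + 1/4, the same for all \<open>N\<close> and \<open>L\<close>.
  With a spectrum of radius 2 it gives 2 + 3/4 < pi.\<close>

lemma sum_list_sfac: "0 < N \<Longrightarrow> 0 < L \<Longrightarrow> sum_list (sfac N L) = 3 / 4"
  by (simp add: sfac_def sum_list_replicate)

lemma norm_ikern_sfac_le:
  assumes NL: "0 < N" "0 < L"
  shows "norm (ikern (sfac N L) v) \<le> 1"
    and "norm (ikern (sfac N L) v) \<le> ((1 + 2 * real N) / (1 + \<bar>v\<bar>)) ^ N"
    and "norm (ikern (sfac N L) v) \<le> ((1 + 4 * real L) / (1 + \<bar>v\<bar>)) ^ L"
proof -
  let ?a = "norm (ufac (1 / (2 * real N)) v) ^ N" and ?b = "norm (ufac (1 / (4 * real L)) v) ^ L"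
      and ?c = "norm (ufac pi v)"
  have eq: "norm (ikern (sfac N L) v) = ?a * ?b * ?c"
    by (simp add: ikern_def sfac_def norm_mult norm_power prod_list_replicate map_replicate)
  have le: "?a \<le> 1" "?b \<le> 1" "?c \<le> 1"
    using NL by (auto intro!: power_le_one norm_ufac_le_1)
  have bc: "?b * ?c \<le> 1" and ac: "?a * ?c \<le> 1"
    using le by (auto intro!: mult_le_one)
  have "?a * (?b * ?c) \<le> ?a * 1" "?b * (?a * ?c) \<le> ?b * 1"
    using bc ac by (intro mult_left_mono; simp)+
  then have a: "norm (ikern (sfac N L) v) \<le> ?a" and b: "norm (ikern (sfac N L) v) \<le> ?b"
    unfolding eq by (simp_all add: mult_ac)
  show "norm (ikern (sfac N L) v) \<le> 1" using a le by linarith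
  have "?a \<le> ((1 + 1 / (1 / (2 * real N))) / (1 + \<bar>v\<bar>)) ^ N" using NL by (intro norm_ufac_power_le)
      auto
  then show "norm (ikern (sfac N L) v) \<le> ((1 + 2 * real N) / (1 + \<bar>v\<bar>)) ^ N" using a by simp
  have "?b \<le> ((1 + 1 / (1 / (4 * real L))) / (1 + \<bar>v\<bar>)) ^ L" using NL by (intro norm_ufac_power_le)
      auto
  then show "norm (ikern (sfac N L) v) \<le> ((1 + 4 * real L) / (1 + \<bar>v\<bar>)) ^ L" using b by simp
qed

text \<open>With \<open>c\<close> of order (1 + |v|)^(-1) the N factors give c^(N t) \<le> c^2 if c
  \<le> 1, and the bound by 1 settles c > 1. The constant is free of \<open>L\<close>, hence later
  of the distribution.\<close>

lemma ikern_sfac_powr_le_kern: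
  assumes NL: "0 < N" "0 < L" and t: "0 < t" "2 \<le> real N * t"
  shows "ennpow (ennreal (norm (ikern (sfac N L) v))) t \<le> ennreal (4 * (1 + 2 * real N)\<^sup>2) * kern v"
proof -
  define c where "c = (1 + 2 * real N) / (1 + \<bar>v\<bar>)"
  have c: "0 < c" by (simp add: c_def add_pos_nonneg)
  have "norm (ikern (sfac N L) v) powr t \<le> c\<^sup>2"
  proof (cases "c \<le> 1")
    case True
    have "norm (ikern (sfac N L) v) powr t \<le> (c ^ N) powr t"
      using norm_ikern_sfac_le(2)[OF NL, of v] t unfolding c_def by (intro powr_mono2) auto
    also have "\<dots> = c powr (real N * t)" using c by (simp add: powr_powr flip: powr_realpow)
    also have "\<dots> \<le> c powr 2" using True c t by (intro powr_mono') auto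
    finally show ?thesis using c by (simp add: powr_numeral)
  next
    case False
    have "norm (ikern (sfac N L) v) powr t \<le> 1 powr t"
      using norm_ikern_sfac_le(1)[OF NL, of v] t by (intro powr_mono2) auto
    also have "\<dots> \<le> c\<^sup>2" using False one_le_power[of c 2] by simp
    finally show ?thesis .
  qed
  then have "ennpow (ennreal (norm (ikern (sfac N L) v))) t \<le> ennreal
      ((1 + 2 * real N)\<^sup>2 * (1 / (1 + \<bar>v\<bar>)\<^sup>2))"
    by (simp add: ennpow_ennreal c_def power_divide ennreal_leI)
  also have "\<dots> = ennreal ((1 + 2 * real N)\<^sup>2) * ennreal (1 / (1 + \<bar>v\<bar>)\<^sup>2)" by (subst ennreal_mult)
      auto
  also have "\<dots> \<le> ennreal ((1 + 2 * real N)\<^sup>2) * (4 * kern v)"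
    by (intro mult_left_mono kern_lower) simp
  also have "\<dots> = ennreal (4 * (1 + 2 * real N)\<^sup>2) * kern v"
    by (simp add: ennreal_mult' mult_ac)
  finally show ?thesis .
qed

lemma summable_on_int_inverse_square: "(\<lambda>m::int. 1 / (1 + \<bar>real_of_int m\<bar>)\<^sup>2) summable_on UNIV"
proof -
  let ?f = "\<lambda>m::int. 1 / (1 + \<bar>real_of_int m\<bar>)\<^sup>2"
  have s: "summable (\<lambda>n. inverse (real n ^ 2))" by (rule inverse_power_summable) simp
  then have s1: "summable (\<lambda>n. inverse (real (Suc n) ^ 2))"
    by (subst summable_Suc_iff[of "\<lambda>n. inverse (real n ^ 2)"])
  then have s2: "summable (\<lambda>n. inverse (real (Suc (Suc n)) ^ 2))"
    by (subst summable_Suc_iff[of "\<lambda>n. inverse (real (Suc n) ^ 2)"])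
  have "(\<lambda>n. ?f (int n)) summable_on UNIV"
  proof (rule norm_summable_imp_summable_on)
    show "summable (\<lambda>n. norm (?f (int n)))" using s1 by (simp add: divide_inverse)
  qed
  moreover have bij: "bij_betw int UNIV {0..}"
    by (rule bij_betw_byWitness[where f' = nat]) auto
  ultimately have 1: "?f summable_on {0..}"
    by (simp only: summable_on_reindex_bij_betw[OF bij, of ?f])
  have "(\<lambda>n. ?f (- int (Suc n))) summable_on UNIV"
  proof (rule norm_summable_imp_summable_on)
    show "summable (\<lambda>n. norm (?f (- int (Suc n))))" using s2 by (simp add: divide_inverse)
  qed
  moreover have bij': "bij_betw (\<lambda>n. - int (Suc n)) UNIV {..<0}"
    by (rule bij_betw_byWitness[where f' = "\<lambda>m. nat (- m - 1)"]) auto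
  ultimately have 2: "?f summable_on {..<0}"
    by (simp only: summable_on_reindex_bij_betw[OF bij', of ?f])
  have "?f summable_on {0..} \<union> {..<0}" by (rule summable_on_Un_disjoint[OF 1 2]) auto
  moreover have "{0..} \<union> {..<0} = (UNIV :: int set)" by auto
  ultimately show ?thesis by simp
qed

text \<open>Of the \<open>M + 2\<close> orders of decay, \<open>M\<close> compensate the polynomial
  weight and 2 leave a convergent series.\<close>

lemma ikern_sfac_summable:
  assumes N: "0 < N"
  shows "(\<lambda>m. norm (ikern (sfac N (M + 2)) (s - of_int m)) * (1 + \<bar>real_of_int m\<bar>) ^ M) summable_on
      UNIV"
proof (rule summable_on_comparison_test)
  let ?L = "M + 2"
  let ?C = "((1 + 4 * real ?L) * (1 + \<bar>s\<bar>)) ^ ?L"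
  show "(\<lambda>m::int. ?C * (1 / (1 + \<bar>real_of_int m\<bar>)\<^sup>2)) summable_on UNIV"
    by (intro summable_on_cmult_right summable_on_int_inverse_square)
  fix m :: int
  define x where "x = 1 + \<bar>real_of_int m\<bar>"
  define y where "y = 1 + \<bar>s - real_of_int m\<bar>"
  have pos: "0 < x" "0 < y" by (simp_all add: x_def y_def)
  have "x \<le> (1 + \<bar>s\<bar>) * y"
  proof -
    have "\<bar>real_of_int m\<bar> \<le> \<bar>s\<bar> + \<bar>s - real_of_int m\<bar>" by linarith
    moreover have "0 \<le> \<bar>s\<bar> * \<bar>s - real_of_int m\<bar>" by simp
    moreover have "(1 + \<bar>s\<bar>) * y = 1 + \<bar>s\<bar> + \<bar>s - real_of_int m\<bar> + \<bar>s\<bar> * \<bar>s - real_of_int m\<bar>"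
      by (simp add: y_def algebra_simps)
    ultimately show ?thesis unfolding x_def by linarith
  qed
  then have "1 / y \<le> (1 + \<bar>s\<bar>) / x" using pos by (simp add: field_simps)
  then have "(1 + 4 * real ?L) * (1 / y) \<le> (1 + 4 * real ?L) * ((1 + \<bar>s\<bar>) / x)"
    by (rule mult_left_mono) simp
  then have "((1 + 4 * real ?L) / y) ^ ?L \<le> ((1 + 4 * real ?L) * (1 + \<bar>s\<bar>) / x) ^ ?L"
    using pos by (intro power_mono) auto
  also have "\<dots> = ?C * (1 / x ^ ?L)" by (simp only: power_divide) simp
  finally have "norm (ikern (sfac N ?L) (s - of_int m)) \<le> ?C * (1 / x ^ ?L)"
    using norm_ikern_sfac_le(3)[OF N, of ?L "s - of_int m"] unfolding y_def by simp
  then have "norm (ikern (sfac N ?L) (s - of_int m)) * x ^ M \<le> ?C * (1 / x ^ ?L) * x ^ M"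
    using pos by (intro mult_right_mono) auto
  also have "\<dots> = ?C * (1 / x\<^sup>2)"
  proof -
    have "1 / x ^ ?L * x ^ M = 1 / x\<^sup>2" using pos by (simp add: power_add power2_eq_square)
    then show ?thesis by (simp only: mult.assoc)
  qed
  finally show "norm (ikern (sfac N ?L) (s - of_int m)) * (1 + \<bar>real_of_int m\<bar>) ^ M \<le> ?C *
      (1 / (1 + \<bar>real_of_int m\<bar>)\<^sup>2)"
    unfolding x_def .
qed simp

lemma partials_lincomb:
  assumes "\<And>m. m \<in> F \<Longrightarrow> smooth (g m)"
  shows "smooth (\<lambda>y. \<Sum>m\<in>F. c m * g m y) \<and> partials is (\<lambda>y. \<Sum>m\<in>F. c m * g m y) =
      (\<lambda>y. \<Sum>m\<in>F. c m * partials is (g m) y)"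
  using assms
proof (induction F rule: infinite_finite_induct)
  case (insert m F)
  then have IH: "smooth (\<lambda>y. \<Sum>m\<in>F. c m * g m y)" "partials is (\<lambda>y. \<Sum>m\<in>F. c m * g m y) =
      (\<lambda>y. \<Sum>m\<in>F. c m * partials is (g m) y)"
    and gm: "smooth (g m)" by auto
  have "smooth (\<lambda>y. c m * g m y)" using gm by (rule smooth_cmult)
  then show ?case
    using insert.hyps IH gm
    by (simp add: smooth_add partials_add partials_cmult)
qed (simp_all add: partials_zero smooth_def)

text \<open>For a = 2^k this is, up to a constant factor, the k-th block at the point 2^(-k) z. In
  this scale the spectrum has radius 2 for every k and sampling has unit step.\<close>

definition tempered_conv :: "('n::finite) dist \<Rightarrow> 'n cfun \<Rightarrow> real \<Rightarrow> real ^ 'n \<Rightarrow> complex"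
  where "tempered_conv f \<phi> a z = f (\<lambda>y. \<phi> (z + (- a) *\<^sub>R y))"

context
  fixes f :: "('n::finite) dist" and \<phi> :: "'n cfun" and a :: real
  assumes f: "f \<in> tempered" and \<phi>: "\<phi> \<in> schwartz" and bl: "band_limited 2 \<phi>" and a: "1 \<le> a"
begin

abbreviation tconv :: "real ^ 'n \<Rightarrow> complex"
  where "tconv \<equiv> tempered_conv f \<phi> a"

lemma schwartz_reflected: "(\<lambda>y. \<phi> (z + (- a) *\<^sub>R y)) \<in> schwartz"
  using a by (intro schwartz_affine \<phi>) simp

text \<open>\<open>tconv\<close> may grow polynomially, so it is not sampled directly. Instead the
  sampling series of the test functions is shown to converge in the seminorm of order
  \<open>M\<close> that bounds \<open>f\<close>. This works because all derivatives of \<phi> are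
  band-limited with the same radius and so obey the same formula.\<close>

lemma tempered_conv_sampling:
  "\<exists>M. \<forall>s z i N. 0 < N \<longrightarrow>
    ((\<lambda>m. ikern (sfac N (M + 2)) (s - of_int m) * tconv (z + of_int m *\<^sub>R axis i 1)) has_sum tconv
        (z + s *\<^sub>R axis i 1)) UNIV"
proof -
  obtain M C where C: "0 \<le> C" "\<And>\<psi>. \<psi> \<in> schwartz \<Longrightarrow> norm (f \<psi>) \<le> C * snorm M \<psi>"
    using tempered_bound[OF f] by blast
  show ?thesis
  proof (intro exI[of _ M] allI impI)
    fix s :: real and z :: "real ^ 'n" and i :: 'n and N :: nat assume N: "0 < N"
    define K where "K m = ikern (sfac N (M + 2)) (s - of_int m)" for m
    define w where "w m = norm (K m) * (1 + \<bar>real_of_int m\<bar>) ^ M" for m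
    define T where "T F = infsum w (- F)" for F
    define B where "B = a ^ M * ((1 + norm z) ^ M * snorm M \<phi>)"
    have sw: "w summable_on UNIV" unfolding w_def K_def by (rule ikern_sfac_summable[OF N])
    have T0: "(T \<longlongrightarrow> 0) (finite_subsets_at_top UNIV)"
      unfolding T_def by (rule infsum_Compl_tendsto[OF sw])
    have Tnn: "0 \<le> T F" for F unfolding T_def by (intro infsum_nonneg) (simp add: w_def)
    have sK: "(\<lambda>m. norm (K m)) summable_on UNIV"
      using sw by (rule summable_on_comparison_test) (auto simp: w_def mult_le_cancel_left1)
    have B: "0 \<le> B" using a by (simp add: B_def snorm_nonneg)
    let ?g = "\<lambda>c y. \<phi> ((z + c *\<^sub>R axis i 1) + (- a) *\<^sub>R y)"
    have err: "norm ((\<Sum>m\<in>F. K m * tconv (z + of_int m *\<^sub>R axis i 1)) - tconv (z + s *\<^sub>R axis i 1)) \<le> C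
        * (B * T F)"
      if F: "finite F" for F
    proof -
      define S where "S = (\<lambda>y. \<Sum>m\<in>F. K m * ?g (of_int m) y)"
      have S: "S \<in> schwartz" unfolding S_def
        by (intro schwartz_sum schwartz_cmult schwartz_reflected)
      have Ds: "(\<lambda>y. S y - ?g s y) \<in> schwartz" by (intro schwartz_diff S schwartz_reflected)
      have "(\<Sum>m\<in>F. K m * tconv (z + of_int m *\<^sub>R axis i 1)) - tconv (z + s *\<^sub>R axis i 1) = f
          (\<lambda>y. S y - ?g s y)"
        unfolding tempered_diff[OF f S schwartz_reflected] unfolding S_def tempered_conv_def
        by (subst tempered_sum[OF f schwartz_reflected]) (rule refl)
      also have "norm \<dots> \<le> C * snorm M (\<lambda>y. S y - ?g s y)" by (rule C(2)[OF Ds])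
      also have "\<dots> \<le> C * (B * T F)"
      proof (rule mult_left_mono[OF snorm_le[OF Ds]])
        fix js :: "'n list" and y assume l: "length js \<le> M"
        let ?p = "partials js \<phi>"
        define x where "x = z + (- a) *\<^sub>R y"
        have aff: "partials js (?g c) y = of_real ((- a) ^ length js) * ?p (x + c *\<^sub>R axis i 1)" for
            c
        proof -
          have "(z + c *\<^sub>R axis i 1) + (- a) *\<^sub>R y = x + c *\<^sub>R axis i 1" by (simp add: x_def)
          then show ?thesis by (simp only: partials_affine[OF schwartz_smooth[OF \<phi>]])
        qed
        have sm: "smooth (?g c)" for c by (rule schwartz_smooth[OF schwartz_reflected])
        have "partials js (\<lambda>y. S y - ?g s y) y = partials js S y - partials js (?g s) y"
        proof -
          have "(\<lambda>y. S y - ?g s y) = (\<lambda>y. S y + (- 1) * ?g s y)" by simp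
          then show ?thesis
            using partials_add[OF schwartz_smooth[OF S] smooth_cmult[OF sm], of js "- 1" s]
                partials_cmult[OF sm, of js "- 1" s]
            by simp
        qed
        also have "partials js S y = (\<Sum>m\<in>F. K m * partials js (?g (of_int m)) y)"
          unfolding S_def using partials_lincomb[of F "\<lambda>m. ?g (of_int m)" K js] sm by simp
        also have "\<dots> - partials js (?g s) y
            = of_real ((- a) ^ length js) * ((\<Sum>m\<in>F. K m * ?p (x + of_int m *\<^sub>R axis i 1)) - ?p
                (x + s *\<^sub>R axis i 1))"
          unfolding aff right_diff_distrib sum_distrib_left by (simp only: mult.left_commute)
        finally have "norm (partials js (\<lambda>y. S y - ?g s y) y)
            = a ^ length js * norm ((\<Sum>m\<in>F. K m * ?p (x + of_int m *\<^sub>R axis i 1)) - ?p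
                (x + s *\<^sub>R axis i 1))"
          using a by (simp add: norm_mult norm_power)
        also have "\<dots> \<le> a ^ M * norm ((\<Sum>m\<in>F. K m * ?p (x + of_int m *\<^sub>R axis i 1)) - ?p
            (x + s *\<^sub>R axis i 1))"
          using a l by (intro mult_right_mono power_increasing) auto
        finally have p1: "norm (partials js (\<lambda>y. S y - ?g s y) y)
            \<le> a ^ M * norm ((\<Sum>m\<in>F. K m * ?p (x + of_int m *\<^sub>R axis i 1)) - ?p (x + s *\<^sub>R axis i 1))" .
        have hs: "((\<lambda>m. K m * ?p (x + of_int m *\<^sub>R axis i 1)) has_sum ?p (x + s *\<^sub>R axis i 1)) UNIV"
          unfolding K_def
        proof (rule band_limited_sampling[where R = 2])
          show "band_limited 2 ?p" by (rule band_limited_partials[OF schwartz_smooth[OF \<phi>] bl])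
          show "2 + sum_list (sfac N (M + 2)) < pi" using N pi_gt3 by (simp add: sum_list_sfac)
          show "0 < d" if "d \<in> set (sfac N (M + 2))" for d using that
              by (rule sfac_pos[OF N, rotated]) simp
        qed (use sK in \<open>simp_all add: K_def\<close>)
        \<comment> \<open>Moving the argument to the m-th node costs (1 + |m|)^M in the weight;
          \<open>w m\<close> contains precisely this factor, and the kernel with
          \<open>M + 2\<close> extra factors was built to pay for it.\<close>
        have pt: "(1 + norm y) ^ M * norm (K m * ?p (x + of_int m *\<^sub>R axis i 1)) \<le>
            ((1 + norm z) ^ M * snorm M \<phi>) * w m" for m
        proof -
          let ?u = "x + of_int m *\<^sub>R axis i 1 :: real ^ 'n"
          have "(1 + norm y) ^ M \<le> (1 + norm z) ^ M * (1 + norm x) ^ M"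
            unfolding x_def using a by (intro one_plus_norm_le norm_le_affine) simp
          also have "(1 + norm x) ^ M \<le> (1 + norm ?u) ^ M * (1 + norm (real_of_int m)) ^ M"
          proof (rule one_plus_norm_le)
            have "norm x = norm (?u - of_int m *\<^sub>R axis i 1)" by simp
            also have "\<dots> \<le> norm ?u + norm (of_int m *\<^sub>R axis i 1 :: real ^ 'n)"
                by (rule norm_triangle_ineq4)
            finally show "norm x \<le> norm ?u + norm (real_of_int m)" by simp
          qed
          finally have 1: "(1 + norm y) ^ M \<le> (1 + norm z) ^ M *
              ((1 + norm ?u) ^ M * (1 + \<bar>real_of_int m\<bar>) ^ M)"
            by (simp add: mult_left_mono)
          have "(1 + norm y) ^ M * norm (K m * ?p ?u)
              \<le> (1 + norm z) ^ M * ((1 + norm ?u) ^ M * (1 + \<bar>real_of_int m\<bar>) ^ M) * norm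
                  (K m * ?p ?u)"
            using 1 by (rule mult_right_mono) simp
          also have "\<dots> = (1 + norm z) ^ M * ((1 + norm ?u) ^ M * norm (?p ?u)) * w m"
            by (simp add: w_def norm_mult mult_ac)
          also have "\<dots> \<le> (1 + norm z) ^ M * snorm M \<phi> * w m"
            by (intro mult_right_mono mult_left_mono snorm_bound[OF \<phi> l]) (auto simp: w_def)
          finally show ?thesis .
        qed
        have sC: "w summable_on - F" by (rule summable_on_subset_banach[OF sw]) simp
        have "?p (x + s *\<^sub>R axis i 1) = infsum (\<lambda>m. K m * ?p (x + of_int m *\<^sub>R axis i 1)) UNIV"
          using hs by (simp add: infsumI)
        moreover have "infsum (\<lambda>m. K m * ?p (x + of_int m *\<^sub>R axis i 1)) (- F)
            = infsum (\<lambda>m. K m * ?p (x + of_int m *\<^sub>R axis i 1)) UNIV -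
                (\<Sum>m\<in>F. K m * ?p (x + of_int m *\<^sub>R axis i 1))"
          using infsum_Diff[OF has_sum_imp_summable[OF hs] summable_on_finite[OF F]] F
          by (simp add: Compl_eq_Diff_UNIV)
        ultimately have "norm ((\<Sum>m\<in>F. K m * ?p (x + of_int m *\<^sub>R axis i 1)) - ?p (x + s *\<^sub>R axis i 1))
            = norm (infsum (\<lambda>m. K m * ?p (x + of_int m *\<^sub>R axis i 1)) (- F))"
          by (simp add: norm_minus_commute)
        then have "(1 + norm y) ^ M * norm ((\<Sum>m\<in>F. K m * ?p (x + of_int m *\<^sub>R axis i 1)) - ?p
            (x + s *\<^sub>R axis i 1))
            = norm (infsum (\<lambda>m. of_real ((1 + norm y) ^ M) * (K m * ?p (x + of_int m *\<^sub>R axis i 1)))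
                (- F))"
          unfolding infsum_cmult_right' norm_mult norm_of_real by simp
        also have "\<dots> \<le> infsum (\<lambda>m. ((1 + norm z) ^ M * snorm M \<phi>) * w m) (- F)"
        proof (rule norm_infsum_le)
          show "norm (of_real ((1 + norm y) ^ M) * (K m * ?p (x + of_int m *\<^sub>R axis i 1))) \<le>
              ((1 + norm z) ^ M * snorm M \<phi>) * w m" for m
            using pt[of m] unfolding norm_mult[of "of_real _"] norm_of_real by simp
          show "((\<lambda>m. of_real ((1 + norm y) ^ M) * (K m * ?p (x + of_int m *\<^sub>R axis i 1))) has_sum
              infsum (\<lambda>m. of_real ((1 + norm y) ^ M) * (K m * ?p (x + of_int m *\<^sub>R axis i 1))) (- F))
                  (- F)"
            by (intro has_sum_infsum summable_on_cmult_right
                summable_on_subset_banach[OF has_sum_imp_summable[OF hs]]) simp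
          show "((\<lambda>m. ((1 + norm z) ^ M * snorm M \<phi>) * w m) has_sum infsum
              (\<lambda>m. ((1 + norm z) ^ M * snorm M \<phi>) * w m) (- F)) (- F)"
            by (intro has_sum_infsum summable_on_cmult_right sC)
        qed
        also have "\<dots> = (1 + norm z) ^ M * snorm M \<phi> * T F"
          unfolding T_def by (rule infsum_cmult_right')
        finally have p2: "(1 + norm y) ^ M * norm
            ((\<Sum>m\<in>F. K m * ?p (x + of_int m *\<^sub>R axis i 1)) - ?p (x + s *\<^sub>R axis i 1))
            \<le> (1 + norm z) ^ M * snorm M \<phi> * T F" .
        have "(1 + norm y) ^ M * norm (partials js (\<lambda>y. S y - ?g s y) y)
            \<le> (1 + norm y) ^ M * (a ^ M * norm
                ((\<Sum>m\<in>F. K m * ?p (x + of_int m *\<^sub>R axis i 1)) - ?p (x + s *\<^sub>R axis i 1)))"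
          by (rule mult_left_mono[OF p1]) simp
        also have "\<dots> = a ^ M * ((1 + norm y) ^ M * norm
            ((\<Sum>m\<in>F. K m * ?p (x + of_int m *\<^sub>R axis i 1)) - ?p (x + s *\<^sub>R axis i 1)))"
          by (rule mult.left_commute)
        also have "\<dots> \<le> a ^ M * ((1 + norm z) ^ M * snorm M \<phi> * T F)"
          using a by (intro mult_left_mono[OF p2]) simp
        also have "\<dots> = B * T F" by (simp add: B_def mult_ac)
        finally show "(1 + norm y) ^ M * norm (partials js (\<lambda>y. S y - ?g s y) y) \<le> B * T F" .
      qed (use B Tnn C in auto)
      finally show ?thesis .
    qed
    have "((\<lambda>F. (\<Sum>m\<in>F. K m * tconv (z + of_int m *\<^sub>R axis i 1)) - tconv (z + s *\<^sub>R axis i 1)) \<longlongrightarrow> 0)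
        (finite_subsets_at_top UNIV)"
    proof (rule Lim_null_comparison)
      show "\<forall>\<^sub>F F in finite_subsets_at_top UNIV. norm
          ((\<Sum>m\<in>F. K m * tconv (z + of_int m *\<^sub>R axis i 1)) - tconv (z + s *\<^sub>R axis i 1)) \<le> C *
          (B * T F)"
        by (intro eventually_finite_subsets_at_top_weakI err) simp
      show "((\<lambda>F. C * (B * T F)) \<longlongrightarrow> 0) (finite_subsets_at_top UNIV)"
        by (intro tendsto_mult_right_zero T0)
    qed
    then show "((\<lambda>m. ikern (sfac N (M + 2)) (s - of_int m) * tconv (z + of_int m *\<^sub>R axis i 1))
        has_sum tconv (z + s *\<^sub>R axis i 1)) UNIV"
      unfolding has_sum_def K_def by (rule LIM_zero_cancel)
  qed
qed

lemma norm_frechet_derivative_le: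
  fixes g :: "'n cfun"
  assumes "g differentiable (at x)"
  shows "onorm (frechet_derivative g (at x)) \<le> (\<Sum>j\<in>UNIV. norm (partial j g x))"
proof (rule onorm_le)
  fix v :: "real ^ 'n"
  let ?D = "frechet_derivative g (at x)"
  have D: "(g has_derivative ?D) (at x)" using assms frechet_derivative_works by blast
  have "?D v = ?D (\<Sum>j\<in>UNIV. v $ j *\<^sub>R axis j 1)"
    using basis_expansion[of v] by (simp add: scalar_mult_eq_scaleR)
  also have "\<dots> = (\<Sum>j\<in>UNIV. v $ j *\<^sub>R partial j g x)"
    using has_derivative_linear[OF D] by (simp add: linear_sum linear_scale partial_def o_def)
  also have "norm \<dots> \<le> (\<Sum>j\<in>UNIV. norm (v $ j *\<^sub>R partial j g x))" by (rule norm_sum)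
  also have "\<dots> \<le> (\<Sum>j\<in>UNIV. norm (partial j g x) * norm v)"
    using component_le_norm_cart[of v]
    by (intro sum_mono) (simp add: mult.commute[of _ "norm v"] mult_right_mono)
  finally show "norm (?D v) \<le> (\<Sum>j\<in>UNIV. norm (partial j g x)) * norm v"
    by (simp add: sum_distrib_right)
qed

text \<open>Its purpose is measurability of the blocks. The mean value inequality, applied to the
  derivatives of \<phi> up to order M, bounds the seminorm of the difference, which requires one
  derivative more.\<close>

lemma tempered_conv_isCont: "isCont tconv z"
proof -
  obtain M C where C: "0 \<le> C" "\<And>\<psi>. \<psi> \<in> schwartz \<Longrightarrow> norm (f \<psi>) \<le> C * snorm M \<psi>"
    using tempered_bound[OF f] by blast
  define B where "B = a ^ M * (real CARD('n) * (snorm (Suc M) \<phi> * (2 + norm z) ^ M))"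
  have B: "0 \<le> B" using a by (simp add: B_def snorm_nonneg)
  let ?g = "\<lambda>z y. \<phi> (z + (- a) *\<^sub>R y)"
  have lip: "norm (tconv z' - tconv z) \<le> C * (B * norm (z' - z))" if z': "norm (z' - z) < 1" for z'
  proof -
    have Ds: "(\<lambda>y. ?g z' y - ?g z y) \<in> schwartz" by (intro schwartz_diff schwartz_reflected)
    have "tconv z' - tconv z = f (\<lambda>y. ?g z' y - ?g z y)"
      by (simp only: tempered_conv_def tempered_diff[OF f schwartz_reflected schwartz_reflected])
    also have "norm \<dots> \<le> C * snorm M (\<lambda>y. ?g z' y - ?g z y)" by (rule C(2)[OF Ds])
    also have "\<dots> \<le> C * (B * norm (z' - z))"
    proof (rule mult_left_mono[OF snorm_le[OF Ds]])
      fix js :: "'n list" and y assume l: "length js \<le> M"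
      let ?p = "partials js \<phi>"
      have sm: "smooth (?g c)" for c by (rule schwartz_smooth[OF schwartz_reflected])
      have aff: "partials js (?g c) y = of_real ((- a) ^ length js) * ?p (c + (- a) *\<^sub>R y)" for c
        by (simp only: partials_affine[OF schwartz_smooth[OF \<phi>]])
      have "(\<lambda>y. ?g z' y - ?g z y) = (\<lambda>y. ?g z' y + (- 1) * ?g z y)" by simp
      then have "partials js (\<lambda>y. ?g z' y - ?g z y) y = partials js (?g z') y - partials js (?g z)
          y"
        using partials_add[OF sm smooth_cmult[OF sm], of js z' "- 1" z]
            partials_cmult[OF sm, of js "- 1" z]
        by simp
      also have "\<dots> = of_real ((- a) ^ length js) * (?p (z' + (- a) *\<^sub>R y) - ?p (z + (- a) *\<^sub>R y))"
        unfolding aff by (simp only: right_diff_distrib)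
      finally have "norm (partials js (\<lambda>y. ?g z' y - ?g z y) y) = a ^ length js * norm
          (?p (z' + (- a) *\<^sub>R y) - ?p (z + (- a) *\<^sub>R y))"
        using a by (simp add: norm_mult norm_power)
      also have "\<dots> \<le> a ^ M * norm (?p (z' + (- a) *\<^sub>R y) - ?p (z + (- a) *\<^sub>R y))"
        using a l by (intro mult_right_mono power_increasing) auto
      finally have 1: "norm (partials js (\<lambda>y. ?g z' y - ?g z y) y) \<le> a ^ M * norm
          (?p (z' + (- a) *\<^sub>R y) - ?p (z + (- a) *\<^sub>R y))" .
      define b where "b = real CARD('n) * (snorm (Suc M) \<phi> * ((2 + norm z) ^ M / (1 + norm y) ^ M))"
      have "norm (?p (z' + (- a) *\<^sub>R y) - ?p (z + (- a) *\<^sub>R y)) \<le> b * norm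
          ((z' + (- a) *\<^sub>R y) - (z + (- a) *\<^sub>R y))"
      proof (rule differentiable_bound[where S = "closed_segment (z + (- a) *\<^sub>R y) (z' + (- a) *\<^sub>R y)"
          and f = ?p])
        fix u assume "u \<in> closed_segment (z + (- a) *\<^sub>R y) (z' + (- a) *\<^sub>R y)"
        then obtain \<theta> where \<theta>: "0 \<le> \<theta>" "\<theta> \<le> 1" "u = (1 - \<theta>) *\<^sub>R (z + (- a) *\<^sub>R y) + \<theta> *\<^sub>R
            (z' + (- a) *\<^sub>R y)"
          by (auto simp: in_segment)
        define v where "v = z + \<theta> *\<^sub>R (z' - z)"
        have u: "u = v + (- a) *\<^sub>R y" unfolding \<theta>(3) v_def by (simp add: algebra_simps)
        have "norm v \<le> norm z + \<theta> * norm (z' - z)"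
          unfolding v_def using norm_triangle_ineq[of z "\<theta> *\<^sub>R (z' - z)"] \<theta> by simp
        also have "\<theta> * norm (z' - z) \<le> 1" using \<theta> z' by (intro mult_le_one) auto
        finally have v: "1 + norm v \<le> 2 + norm z" by simp
        have d: "?p differentiable (at u)" by (rule smoothD[OF schwartz_smooth[OF \<phi>]])
        then show "(?p has_derivative frechet_derivative ?p (at u))
            (at u within closed_segment (z + (- a) *\<^sub>R y) (z' + (- a) *\<^sub>R y))"
          using frechet_derivative_works has_derivative_at_withinI by blast
        have yu: "(1 + norm y) ^ M \<le> (2 + norm z) ^ M * (1 + norm u) ^ M"
        proof -
          have "(1 + norm y) ^ M \<le> (1 + norm v) ^ M * (1 + norm u) ^ M"
            unfolding u using a by (intro one_plus_norm_le norm_le_affine) simp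
          also have "\<dots> \<le> (2 + norm z) ^ M * (1 + norm u) ^ M"
            using v by (intro mult_right_mono power_mono) auto
          finally show ?thesis .
        qed
        have "norm (partial j ?p u) \<le> snorm (Suc M) \<phi> * ((2 + norm z) ^ M / (1 + norm y) ^ M)" for j
        proof -
          have "norm (partials (j # js) \<phi> u) \<le> snorm (Suc M) \<phi> / (1 + norm u) ^ Suc M"
            using l by (intro partials_bound[OF \<phi>]) simp
          also have "\<dots> \<le> snorm (Suc M) \<phi> / (1 + norm u) ^ M"
            by (intro divide_left_mono power_increasing snorm_nonneg mult_pos_pos zero_less_power
                add_pos_nonneg) auto
          also have "\<dots> = snorm (Suc M) \<phi> * (1 / (1 + norm u) ^ M)" by simp
          also have "\<dots> \<le> snorm (Suc M) \<phi> * ((2 + norm z) ^ M / (1 + norm y) ^ M)"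
          proof (intro mult_left_mono snorm_nonneg)
            have "0 < (1 + norm u) ^ M" "0 < (1 + norm y) ^ M"
                by (intro zero_less_power add_pos_nonneg; simp)+
            then show "1 / (1 + norm u) ^ M \<le> (2 + norm z) ^ M / (1 + norm y) ^ M"
              using yu by (simp add: frac_le_eq pos_divide_le_eq pos_le_divide_eq)
          qed
          finally show ?thesis by simp
        qed
        then have "(\<Sum>j\<in>UNIV. norm (partial j ?p u)) \<le> b"
          unfolding b_def by (intro order_trans[OF sum_bounded_above]) auto
        then show "onorm (frechet_derivative ?p (at u)) \<le> b"
          using norm_frechet_derivative_le[OF d] by linarith
      qed auto
      also have "(z' + (- a) *\<^sub>R y) - (z + (- a) *\<^sub>R y) = z' - z" by simp
      finally have 2: "norm (?p (z' + (- a) *\<^sub>R y) - ?p (z + (- a) *\<^sub>R y)) \<le> b * norm (z' - z)" .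
      have "(1 + norm y) ^ M * norm (partials js (\<lambda>y. ?g z' y - ?g z y) y) \<le> (1 + norm y) ^ M *
          (a ^ M * (b * norm (z' - z)))"
      proof (rule mult_left_mono[OF order_trans[OF 1]])
        show "a ^ M * norm (?p (z' + (- a) *\<^sub>R y) - ?p (z + (- a) *\<^sub>R y)) \<le> a ^ M *
            (b * norm (z' - z))"
          using a by (intro mult_left_mono[OF 2]) simp
      qed simp
      also have "\<dots> = B * norm (z' - z)"
      proof -
        have "(1 + norm y) ^ M \<noteq> 0" by (simp add: add_nonneg_eq_0_iff)
        then have "(1 + norm y) ^ M * b = real CARD('n) * (snorm (Suc M) \<phi> * (2 + norm z) ^ M)"
          by (simp add: b_def)
        then show ?thesis unfolding B_def by (metis mult.assoc mult.left_commute)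
      qed
      finally show "(1 + norm y) ^ M * norm (partials js (\<lambda>y. ?g z' y - ?g z y) y) \<le> B * norm
          (z' - z)" .
    qed (use B C in auto)
    finally show ?thesis .
  qed
  have "((\<lambda>z'. tconv z' - tconv z) \<longlongrightarrow> 0) (at z)"
  proof (rule Lim_null_comparison)
    show "\<forall>\<^sub>F z' in at z. norm (tconv z' - tconv z) \<le> C * (B * norm (z' - z))"
      unfolding eventually_at using lip by (intro exI[of _ 1]) (auto simp: dist_norm)
    have "((\<lambda>z'. C * (B * norm (z' - z))) \<longlongrightarrow> C * (B * norm (z - z))) (at z)"
      by (intro tendsto_intros)
    then show "((\<lambda>z'. C * (B * norm (z' - z))) \<longlongrightarrow> 0) (at z)" by simp
  qed
  then show ?thesis unfolding isCont_def by (rule LIM_zero_cancel)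
qed

lemma measurable_tempered_conv [measurable]: "tconv \<in> borel_measurable borel"
  by (intro borel_measurable_continuous_onI continuous_at_imp_continuous_on)
      (simp add: tempered_conv_isCont)

text \<open>The order \<open>M\<close> of \<open>f\<close> enters only through
  \<open>sfac N (M + 2)\<close>, whose bound by \<open>kern\<close> does not involve it. Hence the
  constant is the same for all f and a.\<close>

lemma tempered_conv_submean:
  assumes t: "0 < t" "t \<le> 1" and N: "0 < N" "2 \<le> real N * t"
  shows "ennpow (ennreal (norm (tconv x))) t
    \<le> ennreal (4 * (1 + 2 * real N)\<^sup>2) * (\<integral>\<^sup>+y. ennpow (ennreal (norm (tconv (x - y *\<^sub>R axis i 1)))) t
        \<partial>kmeas)"
proof -
  define A where "A = ennreal (4 * (1 + 2 * real N)\<^sup>2)"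
  define W where "W y = ennpow (ennreal (norm (tconv (x - y *\<^sub>R axis i 1)))) t" for y
  have [measurable]: "W \<in> borel_measurable borel" unfolding W_def by measurable
  obtain M where samp: "\<And>s z. ((\<lambda>m. ikern (sfac N (M + 2)) (s - of_int m) * tconv
      (z + of_int m *\<^sub>R axis i 1)) has_sum tconv (z + s *\<^sub>R axis i 1)) UNIV"
    using tempered_conv_sampling N(1) by blast
  have series: "W 0 \<le> (\<integral>\<^sup>+m. A * (kern (s - of_int m) * W (s - of_int m)) \<partial>count_space UNIV)"
      (is "_ \<le> ?R") for s
  proof -
    \<comment> \<open>The base point x - s e_i moves with \<open>s\<close>, so that every lattice
      reproduces the same value at \<open>x\<close> while its nodes are x - (s - m) e_i.\<close>
    let ?a = "\<lambda>m. ikern (sfac N (M + 2)) (s - of_int m) * tconv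
        ((x - s *\<^sub>R axis i 1) + of_int m *\<^sub>R axis i 1)"
    have lim: "((\<lambda>F. ennreal (norm (\<Sum>m\<in>F. ?a m))) \<longlongrightarrow> ennreal (norm (tconv x)))
        (finite_subsets_at_top UNIV)"
      using samp[of s "x - s *\<^sub>R axis i 1"] unfolding has_sum_def
          by (intro tendsto_ennrealI tendsto_norm) simp
    have le: "ennreal (norm (\<Sum>m\<in>F. ?a m)) \<le> ennpow ?R (1 / t)" if F: "finite F" for F
    proof -
      have "ennpow (ennreal (norm (\<Sum>m\<in>F. ?a m))) t \<le> ennpow (\<Sum>m\<in>F. ennreal (norm (?a m))) t"
        using t norm_sum[of ?a F] by (intro ennpow_mono) (auto simp: ennreal_leI)
      also have "\<dots> \<le> (\<Sum>m\<in>F. ennpow (ennreal (norm (?a m))) t)" by (rule ennpow_sum_le[OF t])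
      also have "\<dots> \<le> (\<Sum>m\<in>F. A * (kern (s - of_int m) * W (s - of_int m)))"
      proof (rule sum_mono)
        fix m
        have "ennpow (ennreal (norm (?a m))) t = ennpow
            (ennreal (norm (ikern (sfac N (M + 2)) (s - of_int m)))) t * W (s - of_int m)"
          using t by (simp add: norm_mult ennreal_mult ennpow_mult W_def algebra_simps)
        also have "\<dots> \<le> A * kern (s - of_int m) * W (s - of_int m)"
          unfolding A_def using t N by (intro mult_right_mono ikern_sfac_powr_le_kern) auto
        finally show "ennpow (ennreal (norm (?a m))) t \<le> A *
            (kern (s - of_int m) * W (s - of_int m))"
          by (simp add: mult.assoc)
      qed
      also have "\<dots> \<le> ?R" unfolding nn_integral_count_space_SUP using F by (intro SUP_upper) auto
      finally have "ennpow (ennreal (norm (\<Sum>m\<in>F. ?a m))) t \<le> ennpow (ennpow ?R (1 / t)) t"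
        using t by (simp add: ennpow_ennpow)
      then show ?thesis using t by (simp add: ennpow_le_iff)
    qed
    have "ennreal (norm (tconv x)) \<le> ennpow ?R (1 / t)"
    proof (rule tendsto_upperbound[OF lim])
      show "\<forall>\<^sub>F F in finite_subsets_at_top UNIV. ennreal (norm (\<Sum>m\<in>F. ?a m)) \<le> ennpow ?R (1 / t)"
        by (rule eventually_finite_subsets_at_top_weakI) (rule le)
    qed simp
    then have "W 0 \<le> ennpow (ennpow ?R (1 / t)) t" using t by (simp add: W_def ennpow_mono)
    then show ?thesis using t by (simp add: ennpow_ennpow)
  qed
  have "W 0 = (\<integral>\<^sup>+s. W 0 * indicator {0..<1::real} s \<partial>lborel)"
    by (subst nn_integral_cmult_indicator) auto
  also have "\<dots> \<le> (\<integral>\<^sup>+s. (\<integral>\<^sup>+m. A * (kern (s - of_int m) * W (s - of_int m)) \<partial>count_space UNIV) *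
      indicator {0..<1} s \<partial>lborel)"
    by (intro nn_integral_mono mult_right_mono series) simp
  also have "\<dots> = (\<integral>\<^sup>+s. \<integral>\<^sup>+m. A * (kern (s - of_int m) * W (s - of_int m)) * indicator {0..<1} s
      \<partial>count_space UNIV \<partial>lborel)"
    by (simp add: nn_integral_multc)
  also have "\<dots> = (\<integral>\<^sup>+m. \<integral>\<^sup>+s. A * (kern (s - real_of_int m) * W (s - of_int m)) * indicator {0..<1} s
      \<partial>lborel \<partial>count_space UNIV)"
    by (rule nn_integral_count_space_nn_integral) auto
  also have "\<dots> = (\<integral>\<^sup>+m. \<integral>\<^sup>+v. A * (kern v * W v) * indicator {- real_of_int m..<1 - of_int m} v
      \<partial>lborel \<partial>count_space UNIV)"
  proof (rule nn_integral_cong)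
    fix m :: int
    have "(\<integral>\<^sup>+s. A * (kern (s - real_of_int m) * W (s - of_int m)) * indicator {0..<1} s \<partial>lborel)
        = (\<integral>\<^sup>+v. A * (kern ((of_int m + 1 * v) - real_of_int m) * W ((of_int m + 1 * v) - of_int m))
            * indicator {0..<1} (of_int m + 1 * v) \<partial>lborel)"
      by (subst nn_integral_real_affine[where c = 1 and t = "of_int m"]) auto
    also have "\<dots> = (\<integral>\<^sup>+v. A * (kern v * W v) * indicator {- real_of_int m..<1 - of_int m} v \<partial>lborel)"
      by (intro nn_integral_cong) (auto simp: indicator_def)
    finally show "(\<integral>\<^sup>+s. A * (kern (s - real_of_int m) * W (s - of_int m)) * indicator {0..<1} s
        \<partial>lborel)
        = (\<integral>\<^sup>+v. A * (kern v * W v) * indicator {- real_of_int m..<1 - of_int m} v \<partial>lborel)" .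
  qed
  also have "\<dots> = (\<integral>\<^sup>+v. \<integral>\<^sup>+m. A * (kern v * W v) * indicator {- real_of_int m..<1 - of_int m} v
      \<partial>count_space UNIV \<partial>lborel)"
    by (rule nn_integral_count_space_nn_integral[symmetric]) auto
  also have "\<dots> = (\<integral>\<^sup>+v. A * (kern v * W v) \<partial>lborel)"
  proof (rule nn_integral_cong)
    fix v :: real
    \<comment> \<open>The half-open cells tile the line: exactly m = -\<lfloor>v\<rfloor>
      contributes, and summing over m with averaging over \<open>s\<close> becomes one
      integral.\<close>
    have "indicator {- real_of_int m..<1 - of_int m} v = (indicator {- \<lfloor>v\<rfloor>} m :: ennreal)" for m ::
        int
      unfolding indicator_def by (auto simp: floor_eq_iff) linarith+
    then show "(\<integral>\<^sup>+m. A * (kern v * W v) * indicator {- real_of_int m..<1 - of_int m} v \<partial>count_space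
        UNIV) = A * (kern v * W v)"
      by (simp add: nn_integral_cmult)
  qed
  also have "\<dots> = A * (\<integral>\<^sup>+v. W v \<partial>kmeas)"
    by (simp add: nn_integral_cmult kmeas_def nn_integral_density)
  finally show ?thesis by (simp add: W_def A_def)
qed

end

section \<open>The embeddings\<close>

lemma conv_eq_tempered_conv:
  assumes "f \<in> tempered" "\<psi> \<in> schwartz" "1 \<le> a"
  shows "conv (\<lambda>x. c * \<psi> (a *\<^sub>R x)) f x = c * tempered_conv f \<psi> a (a *\<^sub>R x)"
proof -
  have "(\<lambda>y. \<psi> (a *\<^sub>R x + (- a) *\<^sub>R y)) \<in> schwartz"
    using assms by (intro schwartz_affine) auto
  from tempered_cmult[OF assms(1) this, of c] show ?thesis
    by (simp add: conv_def tempered_conv_def scaleR_diff_right)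
qed

text \<open>Puts k = 0 and k \<ge> 1 on the same footing, since \<Phi> and \<phi> both have spectrum
  in the ball of radius 2; the dilation is 2^k in either case.\<close>

lemma block_eq_tempered_conv:
  assumes lp: "lp_pair \<Phi> \<phi>" and f: "f \<in> tempered"
  obtains c :: complex and \<psi> where "\<psi> \<in> schwartz" "band_limited 2 \<psi>"
    "\<And>x. block \<Phi> \<phi> f k x = ennreal (norm c) * ennreal
        (norm (tempered_conv f \<psi> (2 ^ k) (2 ^ k *\<^sub>R x)))"
proof (cases "k = 0")
  case True
  have "\<Phi> \<in> schwartz" "supp (fourier \<Phi>) \<subseteq> {\<xi>. norm \<xi> \<le> 2}" using lp by (auto simp: lp_pair_def)
  then show thesis
    using True conv_eq_tempered_conv[OF f \<open>\<Phi> \<in> schwartz\<close>, of 1 1]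
    by (intro that[of \<Phi> 1] band_limited_schwartz) (auto simp: block_def dyadic_def)
next
  case False
  have \<phi>: "\<phi> \<in> schwartz" "supp (fourier \<phi>) \<subseteq> {\<xi>. norm \<xi> \<le> 2}" using lp by (auto simp: lp_pair_def)
  show thesis
  proof (rule that[of \<phi> "of_real (2 ^ (k * CARD('a)))"])
    show "\<phi> \<in> schwartz" "band_limited 2 \<phi>" using \<phi> by (auto intro: band_limited_schwartz)
    show "block \<Phi> \<phi> f k x = ennreal (norm (of_real (2 ^ (k * CARD('a))) :: complex))
        * ennreal (norm (tempered_conv f \<phi> (2 ^ k) (2 ^ k *\<^sub>R x)))" for x
      unfolding block_def dyadic_def using False conv_eq_tempered_conv[OF f \<phi>(1), of "2 ^ k"]
      by (simp add: norm_mult ennreal_mult)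
  qed
qed

lemma measurable_block:
  assumes "lp_pair \<Phi> \<phi>" "f \<in> tempered"
  shows "block \<Phi> \<phi> f k \<in> borel_measurable borel"
proof -
  obtain c :: complex and \<psi> where \<psi>: "\<psi> \<in> schwartz" "band_limited 2 \<psi>"
    "\<And>x. block \<Phi> \<phi> f k x = ennreal (norm c) * ennreal
        (norm (tempered_conv f \<psi> (2 ^ k) (2 ^ k *\<^sub>R x)))"
    using block_eq_tempered_conv[OF assms, of k] by blast
  have [measurable]: "tempered_conv f \<psi> (2 ^ k) \<in> borel_measurable borel"
    using \<psi> assms by (intro measurable_tempered_conv) auto
  show ?thesis unfolding \<psi>(3)[abs_def] by measurable
qed

lemma submean_block:
  fixes f :: "('n::finite) dist"
  assumes "lp_pair \<Phi> \<phi>" "f \<in> tempered" and t: "0 < t" "t \<le> 1" and N: "0 < N" "2 \<le> real N * t"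
  shows "submean t (4 * (1 + 2 * real N)\<^sup>2) k i (block \<Phi> \<phi> f k)"
  unfolding submean_def
proof
  fix x :: "real ^ 'n"
  obtain c :: complex and \<psi> where \<psi>: "\<psi> \<in> schwartz" "band_limited 2 \<psi>" and
    eq: "\<And>x. block \<Phi> \<phi> f k x = ennreal (norm c) * ennreal
        (norm (tempered_conv f \<psi> (2 ^ k) (2 ^ k *\<^sub>R x)))"
    using block_eq_tempered_conv[OF assms(1,2), of k] by blast
  have [measurable]: "tempered_conv f \<psi> (2 ^ k) \<in> borel_measurable borel"
    using \<psi> assms by (intro measurable_tempered_conv) auto
  let ?A = "ennreal (4 * (1 + 2 * real N)\<^sup>2)" and ?c = "ennpow (ennreal (norm c)) t"
  let ?W = "\<lambda>z. ennpow (ennreal (norm (tempered_conv f \<psi> (2 ^ k) z))) t"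
  \<comment> \<open>Unit shifts in the rescaled variable are shifts by 2^(-k) in the original
    one.\<close>
  have arg: "2 ^ k *\<^sub>R (x - (y * 2 powr - real k) *\<^sub>R axis i 1) = 2 ^ k *\<^sub>R x - y *\<^sub>R axis i 1" for y
    by (simp add: scaleR_diff_right powr_minus powr_realpow)
  have "?c * ?W (2 ^ k *\<^sub>R x) \<le> ?c * (?A * (\<integral>\<^sup>+y. ?W (2 ^ k *\<^sub>R x - y *\<^sub>R axis i 1) \<partial>kmeas))"
    using \<psi> assms by (intro mult_left_mono tempered_conv_submean) auto
  also have "\<dots> = ?A * (\<integral>\<^sup>+y. ?c * ?W (2 ^ k *\<^sub>R x - y *\<^sub>R axis i 1) \<partial>kmeas)"
    by (simp add: nn_integral_cmult mult.left_commute)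
  finally show "ennpow (block \<Phi> \<phi> f k x) t
      \<le> ?A * (\<integral>\<^sup>+y. ennpow (block \<Phi> \<phi> f k (x - (y * 2 powr - real k) *\<^sub>R axis i 1)) t \<partial>kmeas)"
    unfolding eq arg using t by (simp add: ennpow_mult)
qed

lemma last_sorted_list_of_set_UNIV: "last (sorted_list_of_set (UNIV :: 'n::{finite,linorder} set)) =
    Max UNIV"
proof (rule Max_eqI[symmetric])
  let ?xs = "sorted_list_of_set (UNIV :: 'n set)"
  have ne: "?xs \<noteq> []" by simp
  fix y :: 'n
  have "y \<in> set ?xs" by simp
  then obtain j where j: "j < length ?xs" "y = ?xs ! j" unfolding in_set_conv_nth by blast
  then have "?xs ! j \<le> ?xs ! (length ?xs - 1)" by (intro sorted_nth_mono) auto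
  then show "y \<le> last ?xs" using j ne by (simp add: last_conv_nth)
qed auto

lemma embedsI:
  assumes "\<And>f. f \<in> tempered \<Longrightarrow> N\<^sub>2 f \<le> ennreal C * N\<^sub>1 f"
  shows "N\<^sub>1 \<hookrightarrow> N\<^sub>2"
  unfolding embeds_def space_of_def
proof (intro conjI subsetI exI[of _ C] ballI)
  fix f assume "f \<in> {f \<in> tempered. N\<^sub>1 f < \<infinity>}"
  then have f: "f \<in> tempered" "N\<^sub>1 f < \<infinity>" by auto
  show "N\<^sub>2 f \<le> ennreal C * N\<^sub>1 f" using assms f by simp
  also have "\<dots> < \<infinity>" using f by (simp add: ennreal_mult_less_top)
  finally show "f \<in> {f \<in> tempered. N\<^sub>2 f < \<infinity>}" using f by simp
qed

theorem corollary6p20: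
  fixes \<Phi> \<phi> :: "real ^ 'n::{finite,linorder} \<Rightarrow> complex"
    and p q :: "'n \<Rightarrow> real"
    and s1 s2 :: real
  assumes "lp_pair \<Phi> \<phi>"
    and "\<And>i. 0 < q i" and "\<And>i. q i < p i"
    and "s1 - (\<Sum>i\<in>UNIV. 1 / p i) = s2 - (\<Sum>i\<in>UNIV. 1 / q i)"
  shows "F_norm \<Phi> \<phi> q s2 \<infinity> \<hookrightarrow> HerzB_norm \<Phi> \<phi> (\<lambda>i. 0) p q s1 (q (Max UNIV)) \<and>
    HerzB_norm \<Phi> \<phi> (\<lambda>i. 0) p q s1 (q (Max UNIV)) \<hookrightarrow> B_norm \<Phi> \<phi> p s1 (q (Max UNIV))"
proof
  note lp = assms(1) and q = assms(2) and qp = assms(3)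
  have p: "0 < p i" for i using q[of i] qp[of i] by simp
  let ?xs = "sorted_list_of_set (UNIV :: 'n set)"
  let ?HF = "fold_coords (\<lambda>i. Herz_norm 0 (ennreal (p i)) (ennreal (q i)))"
  let ?\<sigma> = "\<Sum>i\<in>UNIV. 1 / p i - 1 / q i"
  have s1: "s1 = s2 + ?\<sigma>" using assms(4) by (simp add: sum_subtractf)
  \<comment> \<open>Half the smallest q_i is strictly below all of them; the cap at 1 permits taking
    t-th powers inside sums.\<close>
  define t where "t = min 1 (Min (range q) / 2)"
  have m: "0 < Min (range q)" using q by (subst Min_gr_iff) auto
  have "t < q i" for i
  proof -
    have "t \<le> Min (range q) / 2" unfolding t_def by (rule min.cobounded2)
    also have "\<dots> < Min (range q)" using m by simp
    also have "\<dots> \<le> q i" by (rule Min_le) auto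
    finally show ?thesis .
  qed
  moreover have "0 < t" "t \<le> 1" using m unfolding t_def
      by (auto simp only: min_less_iff_conj min.cobounded1)
  ultimately have t: "0 < t" "t \<le> 1" "\<And>i. t < q i" by auto
  \<comment> \<open>Enough factors for the t-th power of the kernel to decay like
    \<open>kern\<close>.\<close>
  define N where "N = nat \<lceil>2 / t\<rceil>"
  have "2 / t \<le> real N" unfolding N_def by (rule real_nat_ceiling_ge)
  then have N2: "2 \<le> real N * t" using t(1) by (simp add: pos_divide_le_eq)
  then have N: "0 < N" "2 \<le> real N * t" by (cases N, auto)
  define A where "A = 4 * (1 + 2 * real N)\<^sup>2"
  have A: "0 < A" by (simp add: A_def add_pos_nonneg)
  have xs: "?xs \<noteq> []" "distinct ?xs" by simp_all
  \<comment> \<open>The constant is fixed before any distribution is chosen.\<close>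
  obtain C where C: "0 < C" and JF: "\<And>g G x. \<lbrakk>\<forall>k. g k \<in> borel_measurable borel; G \<in> borel_measurable
      borel;
      \<forall>k x. g k x \<le> G x; \<forall>k. \<forall>i\<in>set ?xs. submean t A k i (g k)\<rbrakk> \<Longrightarrow>
      lq_norm (ennreal (q (last ?xs))) (\<lambda>k::nat. ennreal
          (2 powr (real k * (\<Sum>i\<in>set ?xs. 1 / p i - 1 / q i))) * ?HF ?xs (g k) x)
        \<le> ennreal C * fold_coords (\<lambda>i. Lp_norm (ennreal (q i))) ?xs G x"
    using fold_coords_jawerth_franke[where p = p and q = q and xs = ?xs, OF t(1) t(3) qp A xs]
        by blast
  show "F_norm \<Phi> \<phi> q s2 \<infinity> \<hookrightarrow> HerzB_norm \<Phi> \<phi> (\<lambda>i. 0) p q s1 (q (Max UNIV))"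
  proof (rule embedsI)
    fix f :: "'n dist" assume f: "f \<in> tempered"
    note [measurable] = measurable_block[OF lp f]
    \<comment> \<open>The weights for \<open>s2\<close> are built into the functions, so that their
      supremum is exactly the integrand of the F quasi-norm. The missing power with exponent
      \<open>?\<sigma>\<close> then comes from the iterated inequality.\<close>
    define g where "g k x = ennreal (2 powr (real k * s2)) * block \<Phi> \<phi> f k x" for k x
    define G where "G x = (SUP k. g k x)" for x
    have [measurable]: "g k \<in> borel_measurable borel" for k unfolding g_def by measurable
    have [measurable]: "G \<in> borel_measurable borel" unfolding G_def by measurable
    have "lq_norm (ennreal (q (last ?xs))) (\<lambda>k::nat. ennreal
        (2 powr (real k * (\<Sum>i\<in>set ?xs. 1 / p i - 1 / q i))) * ?HF ?xs (g k) 0)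
        \<le> ennreal C * fold_coords (\<lambda>i. Lp_norm (ennreal (q i))) ?xs G 0"
    proof (rule JF)
      show "\<forall>k x. g k x \<le> G x" unfolding G_def by (intro allI SUP_upper) auto
      show "\<forall>k. \<forall>i\<in>set ?xs. submean t A k i (g k)"
        unfolding g_def A_def using t N by (intro allI ballI submean_cmult submean_block lp f) auto
    qed auto
    moreover have "ennreal (2 powr (real k * ?\<sigma>)) * ?HF ?xs (g k) 0
        = ennreal (2 powr (real k * s1)) * mixed_Herz_norm (\<lambda>i. 0) p q (block \<Phi> \<phi> f k)" for k
    proof -
      have "?HF ?xs (g k) 0 = ennreal (2 powr (real k * s2)) * mixed_Herz_norm (\<lambda>i. 0) p q
          (block \<Phi> \<phi> f k)"
        unfolding g_def using fold_coords_Herz_cmult[where p = p and q = q and xs = ?xs, OF p q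
            measurable_block[OF lp f]]
        by (simp add: mixed_Herz_norm_def mixed_norm_def)
      moreover have "ennreal (2 powr (real k * ?\<sigma>)) * ennreal (2 powr (real k * s2)) = ennreal
          (2 powr (real k * s1))"
        by (simp add: s1 distrib_left add.commute flip: ennreal_mult powr_add)
      ultimately show ?thesis by (simp add: mult.assoc[symmetric])
    qed
    ultimately show "HerzB_norm \<Phi> \<phi> (\<lambda>i. 0) p q s1 (q (Max UNIV)) f \<le> ennreal C * F_norm \<Phi> \<phi> q s2 \<infinity>
        f"
      by (simp add: HerzB_norm_def F_norm_def mixed_Lp_norm_def mixed_norm_def
          last_sorted_list_of_set_UNIV
          lq_norm_def[of top] G_def[abs_def] g_def)
  qed
  show "HerzB_norm \<Phi> \<phi> (\<lambda>i. 0) p q s1 (q (Max UNIV)) \<hookrightarrow> B_norm \<Phi> \<phi> p s1 (q (Max UNIV))"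
  proof (rule embedsI)
    fix f :: "'n dist" assume f: "f \<in> tempered"
    have "mixed_Lp_norm p (block \<Phi> \<phi> f k) \<le> mixed_Herz_norm (\<lambda>i. 0) p q (block \<Phi> \<phi> f k)" for k
      unfolding mixed_Lp_norm_def mixed_Herz_norm_def mixed_norm_def
      using q qp by (intro fold_coords_Lp_le_Herz measurable_block lp f) (auto simp: less_imp_le)
    then show "B_norm \<Phi> \<phi> p s1 (q (Max UNIV)) f \<le> ennreal 1 * HerzB_norm \<Phi> \<phi> (\<lambda>i. 0) p q s1
        (q (Max UNIV)) f"
      unfolding B_norm_def HerzB_norm_def lq_norm_eq_nrm[OF q]
      using q by (simp add: nrm_mono mult_left_mono)
  qed
qed

end
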